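(* Assume the model accuracy, preconditioner and regularity conditions given in the context, with $\overline{\eta}=\overline{\tau}=0$. Assume that $\mathcal{X}^*$ is nonempty and that, writing $\varphi(\cdot;s)=f(\cdot;s)+r(\cdot)$: (i) there exists $\sigma_\phi\in\mathbb{R}_{++}$ such that for all $x^*\in\mathcal{X}^*$, $\mathbb{E}_{s\sim P}[\|\varphi'(x^*;s)\|_2^2]\le\sigma_\phi^2$ for all measurable selections $\varphi'(x^*;s)\in\partial\varphi(x^*;s)$; and (ii) for any fixed $x^*\in\mathcal{X}^*$ and $\phi'(x^* )\in\partial\phi(x^* )$ there exists a measurable mapping $\varphi'(x^*;\cdot)$ with $\varphi'(x^*;s)\in\partial\varphi(x^*;s)$ for $P$-almost all $s\in\mathcal{S}$ and $\mathbb{E}_{s\sim P}[\varphi'(x^*;s)]=\int_{\mathcal{S}}\varphi'(x^*;s)\,\mathrm{d}P(s)=\phi'(x^* )$. Let $\{x_k\}$ be generated by the model-based ispPPA algorithm with stepsizes $\{\alpha_k\}$ and parameters $\{\epsilon_k\}$, and suppose there exists $\gamma\in\mathbb{R}_+$ such that $\epsilon_k=\gamma\alpha_k^2$ for all $k\in\mathbb{Z}_+$ and $\sum_{k=1}^\infty\alpha_k^2<\infty$. Then $\sup_{k\in\mathbb{Z}_+}\|x_k\|_2<\infty$ holds with probability $1$. If, in addition, the local Lipschitz condition given in the context holds and $\sum_{k=1}^\infty\alpha_k=\infty$, then with probability $1$ there exists $x^*\in\mathcal{X}^*$ such that $\lim_{k\to\infty}\|x_k-x^*\|_2=0$.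
   Context: Notation: $\mathbb{Z}_+=\{1,2,\dots\}$, $\mathbb{R}_+=[0,\infty)$, $\mathbb{R}_{++}=(0,\infty)$. For a self-adjoint positive-definite linear map $M$ on $\mathbb{R}^d$: $\|x\|_M^2=\langle x,Mx\rangle$, $\mathrm{dist}_M(x,X)=\inf_{y\in X}\|x-y\|_M$; for $p:\mathbb{R}^d\to(-\infty,+\infty]$ proper closed and $\alpha>0$, $\mathrm{prox}^M_{\alpha p}(x)=\arg\min_y\{p(y)+\frac1{2\alpha}\|y-x\|_M^2\}$. $p$ is $\overline{\tau}$-weakly convex if $p+\frac{\overline{\tau}}2\|\cdot\|_2^2$ is convex (so $0$-weakly convex means convex); $\partial p$ is the regular (Fréchet) subdifferential. Problem: minimize $\phi(x)=F(x)+r(x)$ over $\mathbb{R}^d$, $F(x)=\mathbb{E}_{s\sim P}[f(x;s)]$, $P$ a distribution on a sample space $\mathcal{S}$, $r:\mathbb{R}^d\to(-\infty,+\infty]$. $\mathcal{X}^*=\arg\min\phi$. Model functions: $V$ is an open convex set containing $\mathrm{dom}(r)$, and $(x,y,s)\mapsto f_x(y;s)$ is a measurable function on $V\times V\times\mathcal{S}$; $\varphi_x(y;s)=f_x(y;s)+r(y)$, with value $+\infty$ for $y\notin\mathrm{dom}(r)$. For a minibatch $S_k^{1:m}=\{S_k^i\}_{i=1}^m$: $\overline{f}_{x_k}(x;S_k^{1:m})=\frac1m\sum_{i=1}^m f_{x_k}(x;S_k^i)$, $\overline{\varphi}_{x_k}(x;S_k^{1:m})=\overline{f}_{x_k}(x;S_k^{1:m})+r(x)$.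 Model-based ispPPA algorithm: given $x_1$, stepsizes $\alpha_k>0$, accuracies $\epsilon_k\ge0$, minibatch size $m$ and self-adjoint positive-definite linear maps (preconditioners) $M_k$, which may depend on the sampled minibatches, at iteration $k=1,2,\dots$ draw $S_k^1,\dots,S_k^m$ i.i.d. from $P$ and let $x_{k+1}$ be an approximate minimizer of $\Phi_k(x)=\overline{\varphi}_{x_k}(x;S_k^{1:m})+\frac1{2\alpha_k}\|x-x_k\|_{M_k}^2$ satisfying one of: (a) $\|x_{k+1}-\tilde{x}_{k+1}\|_{M_k}\le\epsilon_k$, where $\tilde{x}_{k+1}=\mathrm{prox}^{M_k}_{\alpha_k\overline{\varphi}_{x_k}(\cdot;S_k^{1:m})}(x_k)$; (b) $\Phi_k(x_{k+1})-\min\Phi_k\le\frac{1-\tau\alpha_k}{2\alpha_k}\epsilon_k^2$; (c) $\mathrm{dist}_{M_k^{-1}}(0,\partial\Phi_k(x_{k+1}))\le\frac{1-\tau\alpha_k}{\alpha_k}\epsilon_k$; here $\tau=L_\infty^2\overline{\tau}$ (which is $0$ in this theorem). $\mathcal{F}_k=\sigma(S_1^{1:m},\dots,S_k^{1:m})$ and $\mathbb{E}_k[\cdot]=\mathbb{E}[\cdot\mid\mathcal{F}_{k-1}]$. Model accuracy condition: there is a scalar $\overline{\eta}$ such that for $P$-almost all $s$, $f_x(x;s)=f(x;s)$ and $|f_x(y;s)-f(y;s)|\le\frac{\overline{\eta}}2\|y-x\|_2^2$ for all $x,y\in V$. Preconditioner condition: there are $\mu_\infty\in(0,1]$, $L_\infty\in[1,\infty)$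 such that for every $k\in\mathbb{Z}_+$, $\mu_k\|x\|_{M_k}\le\|x\|_2\le L_k\|x\|_{M_k}$ for all $x\in\mathbb{R}^d$, with $\mu_k\in[\mu_\infty,\infty)$, $L_k\in(0,L_\infty]$; and $\rho_k^{-2}\le\mathbb{E}_k\big[\|x\|_{M_k}^2/\|x\|_{M_{k-1}}^2\big]\le\rho_k^2$ for all $x\ne0$, with $\rho_k\in[1,\infty)$ and $\nu_k=\prod_{i=0}^{k-1}\rho_i\nearrow\nu_\infty=\prod_{i=0}^\infty\rho_i<\infty$; by definition $M_0=I_d$, $\mu_0=L_0=\rho_0=1$. Regularity condition: $F:\mathbb{R}^d\to\mathbb{R}$ is locally Lipschitz, $r$ is proper closed, and for $P$-almost all $s$, $f(\cdot;s):\mathbb{R}^d\to(-\infty,+\infty]$ is proper closed with $\mathrm{dom}(f(\cdot;s))\supset\mathrm{dom}(r)$, and $\varphi_x(\cdot;s)$ is $\overline{\tau}$-weakly convex for all $x\in V$, where $\overline{\tau}\in\mathbb{R}_+$ is a constant. Local Lipschitz condition: for any bounded subset $U\subset V$ there is a measurable $\overline{L}_{f,U}:\mathcal{S}\to\mathbb{R}_+$ with $\sqrt{\mathbb{E}_{s\sim P}[\overline{L}_{f,U}(s)^2]}\le\overline{L}_F(U)$ for some constant $\overline{L}_F(U)\in\mathbb{R}_+$ such that for $P$-almost all $s$, $|f_x(x;s)-f_x(y;s)|\le\overline{L}_{f,U}(s)\|x-y\|_2$ for all $x,y\in U$. *)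

theory Defs
  imports "HOL-Probability.Probability"
begin

section \<open>Extended-real-valued functions\<close>

definition effdom :: "('a \<Rightarrow> ereal) \<Rightarrow> 'a set" where
  "effdom p = {x. p x < \<infinity>}"

definition proper :: "('a \<Rightarrow> ereal) \<Rightarrow> bool" where
  "proper p \<longleftrightarrow> (\<forall>x. p x \<noteq> -\<infinity>) \<and> effdom p \<noteq> {}"

definition ereal_epigraph :: "('a \<Rightarrow> ereal) \<Rightarrow> ('a \<times> real) set" where
  "ereal_epigraph p = {(x, t). p x \<le> ereal t}"

definition closed_fun :: "('a::topological_space \<Rightarrow> ereal) \<Rightarrow> bool" where
  "closed_fun p \<longleftrightarrow> closed (ereal_epigraph p)"

definition convex_fun :: "('a::real_vector \<Rightarrow> ereal) \<Rightarrow> bool" where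
  "convex_fun p \<longleftrightarrow> convex (ereal_epigraph p)"

definition weakly_convex :: "real \<Rightarrow> ('a::real_normed_vector \<Rightarrow> ereal) \<Rightarrow> bool" where
  "weakly_convex t p \<longleftrightarrow> convex_fun (\<lambda>x. p x + ereal (t / 2 * (norm x)\<^sup>2))"

definition argmin :: "('a \<Rightarrow> ereal) \<Rightarrow> 'a set" where
  "argmin p = {x. is_arg_min p (\<lambda>_. True) x}"

text \<open>The regular (Frechet) subdifferential; it is empty outside the effective domain.\<close>

definition subdifferential :: "('a::euclidean_space \<Rightarrow> ereal) \<Rightarrow> 'a \<Rightarrow> 'a set" where
  "subdifferential p x =
     {v. \<bar>p x\<bar> \<noteq> \<infinity> \<and>
         0 \<le> Liminf (at x) (\<lambda>y. (p y - p x - ereal (v \<bullet> (y - x))) / ereal (norm (y - x)))}"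


section \<open>Weighted norms and proximal points\<close>

definition spd :: "('a::euclidean_space \<Rightarrow> 'a) \<Rightarrow> bool" where
  "spd M \<longleftrightarrow> linear M \<and> adjoint M = M \<and> (\<forall>x. x \<noteq> 0 \<longrightarrow> 0 < x \<bullet> M x)"

definition wnorm :: "('a::euclidean_space \<Rightarrow> 'a) \<Rightarrow> 'a \<Rightarrow> real" where
  "wnorm M x = sqrt (x \<bullet> M x)"

text \<open>Extended-real-valued, so that the distance to the empty set is \<open>\<infinity>\<close>.\<close>

definition wdist :: "('a::euclidean_space \<Rightarrow> 'a) \<Rightarrow> 'a \<Rightarrow> 'a set \<Rightarrow> ereal" where
  "wdist M x X = (INF y\<in>X. ereal (wnorm M (x - y)))"

definition prox_objective ::
  "('a::euclidean_space \<Rightarrow> 'a) \<Rightarrow> real \<Rightarrow> ('a \<Rightarrow> ereal) \<Rightarrow> 'a \<Rightarrow> 'a \<Rightarrow> ereal" where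
  "prox_objective M a p x y = p y + ereal (1 / (2 * a) * (wnorm M (y - x))\<^sup>2)"

text \<open>The set of proximal points; it is a singleton for proper closed convex \<open>p\<close>.\<close>

definition prox :: "('a::euclidean_space \<Rightarrow> 'a) \<Rightarrow> real \<Rightarrow> ('a \<Rightarrow> ereal) \<Rightarrow> 'a \<Rightarrow> 'a set" where
  "prox M a p x = argmin (prox_objective M a p x)"


section \<open>The stochastic problem and its models\<close>

text \<open>
  \<open>P\<close> is the distribution on the sample space, \<open>f y s\<close> stands for \<open>f(y;s)\<close>, and \<open>fm x y s\<close> for
  the model \<open>f\<^sub>x(y;s)\<close>, whose values matter only for \<open>x\<close> and \<open>y\<close> in \<open>V\<close>.
  The formula for \<open>risk\<close> is the expectation of \<open>f(x;\<cdot>)\<close> only where this function is almost surely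
  finite and integrable; \<open>regularity\<close> below requires this at every \<open>x\<close>.
\<close>

definition risk :: "'s measure \<Rightarrow> ('a \<Rightarrow> 's \<Rightarrow> ereal) \<Rightarrow> 'a \<Rightarrow> real" where
  "risk P f x = (\<integral>s. real_of_ereal (f x s) \<partial>P)"

definition objective ::
  "'s measure \<Rightarrow> ('a \<Rightarrow> 's \<Rightarrow> ereal) \<Rightarrow> ('a \<Rightarrow> ereal) \<Rightarrow> 'a \<Rightarrow> ereal" where
  "objective P f r x = ereal (risk P f x) + r x"

definition sample_objective ::
  "('a \<Rightarrow> 's \<Rightarrow> ereal) \<Rightarrow> ('a \<Rightarrow> ereal) \<Rightarrow> 's \<Rightarrow> 'a \<Rightarrow> ereal" where
  "sample_objective f r s y = f y s + r y"

definition model_objective ::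
  "('a \<Rightarrow> 'a \<Rightarrow> 's \<Rightarrow> real) \<Rightarrow> ('a \<Rightarrow> ereal) \<Rightarrow> 'a \<Rightarrow> 's \<Rightarrow> 'a \<Rightarrow> ereal" where
  "model_objective fm r x s y = ereal (fm x y s) + r y"

definition minibatch_objective ::
  "('a \<Rightarrow> 'a \<Rightarrow> 's \<Rightarrow> real) \<Rightarrow> ('a \<Rightarrow> ereal) \<Rightarrow> nat \<Rightarrow> 'a \<Rightarrow> (nat \<Rightarrow> 's) \<Rightarrow> 'a \<Rightarrow> ereal" where
  "minibatch_objective fm r m x s y = ereal (1 / real m * (\<Sum>i=1..m. fm x y (s i))) + r y"

definition model_family ::
  "'s measure \<Rightarrow> ('a::euclidean_space \<Rightarrow> ereal) \<Rightarrow> 'a set \<Rightarrow> ('a \<Rightarrow> 'a \<Rightarrow> 's \<Rightarrow> real) \<Rightarrow> bool" where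
  "model_family P r V fm \<longleftrightarrow>
     open V \<and> convex V \<and> effdom r \<subseteq> V \<and>
     (\<lambda>(x, y, s). fm x y s) \<in>
       borel_measurable (restrict_space borel V \<Otimes>\<^sub>M (restrict_space borel V \<Otimes>\<^sub>M P))"

definition model_accuracy ::
  "'s measure \<Rightarrow> ('a::euclidean_space \<Rightarrow> 's \<Rightarrow> ereal) \<Rightarrow> 'a set \<Rightarrow> ('a \<Rightarrow> 'a \<Rightarrow> 's \<Rightarrow> real) \<Rightarrow> real \<Rightarrow> bool"
where
  "model_accuracy P f V fm \<eta> \<longleftrightarrow>
     (AE s in P. \<forall>x\<in>V. \<forall>y\<in>V.
        ereal (fm x x s) = f x s \<and>
        \<bar>ereal (fm x y s) - f y s\<bar> \<le> ereal (\<eta> / 2 * (norm (y - x))\<^sup>2))"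

text \<open>The first two conjuncts say that the expectation \<open>F\<close> is well defined and real-valued.\<close>

definition regularity ::
  "'s measure \<Rightarrow> ('a::euclidean_space \<Rightarrow> 's \<Rightarrow> ereal) \<Rightarrow> ('a \<Rightarrow> ereal) \<Rightarrow> 'a set \<Rightarrow>
     ('a \<Rightarrow> 'a \<Rightarrow> 's \<Rightarrow> real) \<Rightarrow> real \<Rightarrow> bool"
where
  "regularity P f r V fm \<tau> \<longleftrightarrow>
     (\<forall>x. AE s in P. \<bar>f x s\<bar> \<noteq> \<infinity>) \<and>
     (\<forall>x. integrable P (\<lambda>s. real_of_ereal (f x s))) \<and>
     (\<forall>x. \<exists>u>0. \<exists>L. L-lipschitz_on (cball x u) (risk P f)) \<and>
     proper r \<and> closed_fun r \<and>
     (AE s in P.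
        proper (\<lambda>x. f x s) \<and> closed_fun (\<lambda>x. f x s) \<and> effdom r \<subseteq> effdom (\<lambda>x. f x s) \<and>
        (\<forall>x\<in>V. weakly_convex \<tau> (model_objective fm r x s))) \<and>
     0 \<le> \<tau>"

definition local_lipschitz_models ::
  "'s measure \<Rightarrow> 'a::euclidean_space set \<Rightarrow> ('a \<Rightarrow> 'a \<Rightarrow> 's \<Rightarrow> real) \<Rightarrow> bool"
where
  "local_lipschitz_models P V fm \<longleftrightarrow>
     (\<forall>U. bounded U \<and> U \<subseteq> V \<longrightarrow>
       (\<exists>Lf. Lf \<in> borel_measurable P \<and> (\<forall>s. 0 \<le> Lf s) \<and>
          integrable P (\<lambda>s. (Lf s)\<^sup>2) \<and>
          (\<exists>LF\<ge>0. sqrt (\<integral>s. (Lf s)\<^sup>2 \<partial>P) \<le> LF) \<and>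
          (AE s in P. \<forall>x\<in>U. \<forall>y\<in>U. \<bar>fm x x s - fm x y s\<bar> \<le> Lf s * norm (x - y))))"


section \<open>The inexact stochastic preconditioned proximal point algorithm\<close>

text \<open>\<open>S k i\<close> is the \<open>i\<close>-th sample of the \<open>k\<close>-th minibatch, where \<open>1 \<le> k\<close> and \<open>1 \<le> i \<le> m\<close>.\<close>

definition iid_samples ::
  "'w measure \<Rightarrow> 's measure \<Rightarrow> nat \<Rightarrow> (nat \<Rightarrow> nat \<Rightarrow> 'w \<Rightarrow> 's) \<Rightarrow> bool" where
  "iid_samples \<Omega> P m S \<longleftrightarrow>
     prob_space.indep_vars \<Omega> (\<lambda>_. P) (\<lambda>(k, i). S k i) ({1..} \<times> {1..m}) \<and>
     (\<forall>k\<ge>1. \<forall>i\<in>{1..m}. distr \<Omega> P (S k i) = P)"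

text \<open>The \<open>\<sigma>\<close>-algebra generated by the first \<open>k\<close> minibatches; it is trivial for \<open>k = 0\<close>.\<close>

definition sample_filtration ::
  "'w measure \<Rightarrow> 's measure \<Rightarrow> nat \<Rightarrow> (nat \<Rightarrow> nat \<Rightarrow> 'w \<Rightarrow> 's) \<Rightarrow> nat \<Rightarrow> 'w measure" where
  "sample_filtration \<Omega> P m S k =
     sigma (space \<Omega>) {S j i -` A \<inter> space \<Omega> | j i A. j \<in> {1..k} \<and> i \<in> {1..m} \<and> A \<in> sets P}"

text \<open>
  \<open>\<tau>\<close> is the weak convexity constant relative to the weighted norms. The criterion used may change
  from step to step. The infimum is a minimum for almost all samples when \<open>\<tau> * a < 1\<close>.
\<close>

definition inexact_step ::
  "('a::euclidean_space \<Rightarrow> 'a) \<Rightarrow> real \<Rightarrow> real \<Rightarrow> real \<Rightarrow> ('a \<Rightarrow> ereal) \<Rightarrow> 'a \<Rightarrow> 'a \<Rightarrow> bool" where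
  "inexact_step M \<tau> a \<epsilon> p x x' \<longleftrightarrow>
     (\<exists>z\<in>prox M a p x. wnorm M (x' - z) \<le> \<epsilon>) \<or>
     prox_objective M a p x x' - (INF y. prox_objective M a p x y)
       \<le> ereal ((1 - \<tau> * a) / (2 * a) * \<epsilon>\<^sup>2) \<or>
     wdist (inv M) 0 (subdifferential (prox_objective M a p x) x')
       \<le> ereal ((1 - \<tau> * a) / a * \<epsilon>)"

text \<open>
  The preconditioner \<open>M\<^sub>k\<close> and the iterate \<open>x\<^sub>k\<^sub>+\<^sub>1\<close> depend (measurably) on the first \<open>k\<close> minibatches
  only. The models are defined only at points of \<open>V\<close>, so the iterates have to stay in \<open>V\<close>; this is
  not automatic under the first accuracy criterion.
\<close>

definition ispPPA ::
  "'w measure \<Rightarrow> 's measure \<Rightarrow> nat \<Rightarrow> (nat \<Rightarrow> nat \<Rightarrow> 'w \<Rightarrow> 's) \<Rightarrow>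
   ('a::euclidean_space \<Rightarrow> ereal) \<Rightarrow> 'a set \<Rightarrow> ('a \<Rightarrow> 'a \<Rightarrow> 's \<Rightarrow> real) \<Rightarrow>
   (nat \<Rightarrow> real) \<Rightarrow> (nat \<Rightarrow> real) \<Rightarrow> (nat \<Rightarrow> 'w \<Rightarrow> 'a \<Rightarrow> 'a) \<Rightarrow> real \<Rightarrow> 'a \<Rightarrow> (nat \<Rightarrow> 'w \<Rightarrow> 'a) \<Rightarrow> bool"
where
  "ispPPA \<Omega> P m S r V fm \<alpha> \<epsilon> M \<tau> x1 x \<longleftrightarrow>
     0 < m \<and> iid_samples \<Omega> P m S \<and>
     (\<forall>k\<ge>1. 0 < \<alpha> k \<and> 0 \<le> \<epsilon> k) \<and>
     (\<forall>k\<ge>1. \<forall>\<omega>\<in>space \<Omega>. spd (M k \<omega>)) \<and>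
     (\<forall>k\<ge>1. \<forall>v. (\<lambda>\<omega>. M k \<omega> v) \<in> borel_measurable (sample_filtration \<Omega> P m S k)) \<and>
     (\<forall>\<omega>\<in>space \<Omega>. x 1 \<omega> = x1) \<and>
     (\<forall>k\<ge>1. x (k + 1) \<in> borel_measurable (sample_filtration \<Omega> P m S k)) \<and>
     (AE \<omega> in \<Omega>. \<forall>k\<ge>1.
        x k \<omega> \<in> V \<and>
        inexact_step (M k \<omega>) \<tau> (\<alpha> k) (\<epsilon> k)
          (minibatch_objective fm r m (x k \<omega>) (\<lambda>i. S k i \<omega>)) (x k \<omega>) (x (k + 1) \<omega>))"

text \<open>
  The parameter \<open>\<FF>\<close> is the filtration, and \<open>real_cond_exp \<Omega> (\<FF> (k - 1))\<close> is the conditional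
  expectation \<open>E\<^sub>k\<close>. It is determined only up to null sets, which may depend on \<open>x\<close>.
  As all \<open>\<rho> i \<ge> 1\<close>, convergence of the product means that it is finite.
\<close>

definition preconditioner_condition ::
  "'w measure \<Rightarrow> (nat \<Rightarrow> 'w measure) \<Rightarrow> (nat \<Rightarrow> 'w \<Rightarrow> 'a::euclidean_space \<Rightarrow> 'a) \<Rightarrow>
   real \<Rightarrow> real \<Rightarrow> (nat \<Rightarrow> real) \<Rightarrow> (nat \<Rightarrow> real) \<Rightarrow> (nat \<Rightarrow> real) \<Rightarrow> bool"
where
  "preconditioner_condition \<Omega> \<FF> M \<mu>_inf L_inf \<mu> L \<rho> \<longleftrightarrow>
     0 < \<mu>_inf \<and> \<mu>_inf \<le> 1 \<and> 1 \<le> L_inf \<and>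
     (\<forall>\<omega>\<in>space \<Omega>. M 0 \<omega> = id) \<and> \<mu> 0 = 1 \<and> L 0 = 1 \<and> \<rho> 0 = 1 \<and>
     (\<forall>k\<ge>1.
        \<mu>_inf \<le> \<mu> k \<and> 0 < L k \<and> L k \<le> L_inf \<and> 1 \<le> \<rho> k \<and>
        (AE \<omega> in \<Omega>. \<forall>v. \<mu> k * wnorm (M k \<omega>) v \<le> norm v \<and> norm v \<le> L k * wnorm (M k \<omega>) v) \<and>
        (\<forall>v. v \<noteq> 0 \<longrightarrow>
          (AE \<omega> in \<Omega>.
             1 / (\<rho> k)\<^sup>2 \<le> real_cond_exp \<Omega> (\<FF> (k - 1))
               (\<lambda>\<omega>. (wnorm (M k \<omega>) v)\<^sup>2 / (wnorm (M (k - 1) \<omega>) v)\<^sup>2) \<omega> \<and>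
             real_cond_exp \<Omega> (\<FF> (k - 1))
               (\<lambda>\<omega>. (wnorm (M k \<omega>) v)\<^sup>2 / (wnorm (M (k - 1) \<omega>) v)\<^sup>2) \<omega> \<le> (\<rho> k)\<^sup>2))) \<and>
     convergent_prod \<rho>"

end

theory Submission
  imports Defs
begin

text \<open>
  With accuracy constant \<open>0\<close> the models are exact: on \<open>V\<close> every \<open>fm x \<cdot> s\<close> is \<open>f \<cdot> s\<close>, and weak convexity
  with constant \<open>0\<close> makes the sample objectives \<open>\<phi>(\<cdot>; s) = f(\<cdot>; s) + r\<close> convex. The method is a stochastic
  proximal point method, and the proof follows the squared distance of the iterates to a minimizer \<open>xs\<close>,
  measured in the preconditioner of the preceding step.

  Let \<open>z\<close> be the exact proximal point of a step from \<open>x\<close> with stepsize \<open>\<alpha>\<close> and minibatch objective \<open>p\<close>.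
  Strong convexity of the proximal objective gives (\<open>minibatch_step\<close>)
  \<open>\<parallel>z - xs\<parallel>\<^sup>2 \<le> \<parallel>x - xs\<parallel>\<^sup>2 - \<parallel>z - x\<parallel>\<^sup>2 + 2 \<alpha> (p xs - p z)\<close> in the norm of the current preconditioner, and
  all three accuracy criteria put the next iterate within \<open>\<gamma> \<alpha>\<^sup>2\<close> of \<open>z\<close> (\<open>inexact_step_near_prox\<close>). This
  inexactness costs a factor \<open>1 + \<alpha>\<^sup>2\<close> and a summand of order \<open>\<alpha>\<^sup>2\<close>.

  \<^emph>\<open>Boundedness.\<close> Below \<open>p z\<close> stands the value at \<open>z\<close> of the affine function through \<open>(xs, p xs)\<close> whose
  slope is an average of sample subgradients at \<open>xs\<close>. These can be selected with mean \<open>0\<close>. As the minibatch is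
  independent of the past, the term linear in \<open>x - xs\<close> vanishes on average, and the rest is of order \<open>\<alpha>\<^sup>2\<close>
  after Young's inequality. Passing to the new preconditioner costs the factor \<open>\<rho>\<^sup>2\<close> on average
  (\<open>preconditioner_change\<close>). So the squared distances form a nonnegative almost supermartingale and converge
  almost surely by the theorem of Robbins and Siegmund (\<open>robbins_siegmund\<close>), derived here from the upcrossing
  inequality; in particular the iterates are bounded.

  \<^emph>\<open>Convergence.\<close> With Lipschitz models \<open>p xs - p z\<close> is instead compared with the true objective: it is at
  most minus the objective gap at \<open>z\<close>, plus a centred noise and a term \<open>\<parallel>z - x\<parallel>\<close> times a random Lipschitz
  constant, which Young's inequality absorbs. Summing, stopped at the exit from a ball, shows that the
  gaps weighted by the stepsizes are summable on bounded paths (\<open>AE_gaps_summable\<close>). Since \<open>z\<close> need not be chosen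
  measurably, the expectations are taken of the slack of the recursion, a function of the data that dominates
  the weighted gap. As the stepsizes are not summable, the gaps have lower limit \<open>0\<close>, and lower
  semicontinuity yields a cluster point that is a minimizer. The distances to a countable dense set of minimizers
  converge, so that the cluster point is the limit (\<open>cluster_point_imp_limit\<close>).
\<close>

section \<open>Nonnegative almost supermartingales\<close>

text \<open>
  The trading strategy behind the upcrossing inequality: the unit is bought when the path is below \<open>a\<close>
  and sold when it is above \<open>b\<close>. The value at \<open>n\<close> is the position held from time \<open>n\<close> to \<open>n + 1\<close>.
\<close>

primrec holding :: "real \<Rightarrow> real \<Rightarrow> (nat \<Rightarrow> real) \<Rightarrow> nat \<Rightarrow> bool" where
  "holding a b X 0 \<longleftrightarrow> X 0 < a"
| "holding a b X (Suc n) \<longleftrightarrow> (if holding a b X n then X (Suc n) \<le> b else X (Suc n) < a)"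

text \<open>
  Every completed upcrossing earns at least \<open>b - a\<close>. The last summand on the left is at most the
  gain on a position that is still open, because that was bought below \<open>a\<close>.
\<close>

lemma upcrossings_le_gain:
  assumes "a < b"
  shows "(b - a) * (\<Sum>i<n. of_bool (holding a b X i \<and> \<not> holding a b X (Suc i)))
           + (if holding a b X n then X n - a else 0)
         \<le> (\<Sum>i<n. of_bool (holding a b X i) * (X (Suc i) - X i))"
proof (induction n)
  case 0
  show ?case by simp
next
  case (Suc n)
  define U G where "U = (\<Sum>i<n. of_bool (holding a b X i \<and> \<not> holding a b X (Suc i)) :: real)"
    and "G = (\<Sum>i<n. of_bool (holding a b X i) * (X (Suc i) - X i))"
  have "(b - a) * U + (if holding a b X n then X n - a else 0) \<le> G"
    using Suc.IH unfolding U_def G_def .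
  then have "(b - a) * (U + of_bool (holding a b X n \<and> \<not> holding a b X (Suc n)))
           + (if holding a b X (Suc n) then X (Suc n) - a else 0)
         \<le> G + of_bool (holding a b X n) * (X (Suc n) - X n)"
    using assms by (cases "holding a b X n") (auto simp: algebra_simps)
  then show ?case unfolding U_def G_def sum.lessThan_Suc .
qed

lemma finite_upcrossings_imp_no_oscillation:
  assumes "summable (\<lambda>i. of_bool (holding a b X i \<and> \<not> holding a b X (Suc i)) :: real)"
    and "frequently (\<lambda>n. X n < a) sequentially" and "frequently (\<lambda>n. X n > b) sequentially"
  shows False
proof -
  have "(\<lambda>i. of_bool (holding a b X i \<and> \<not> holding a b X (Suc i)) :: real) \<longlonglongrightarrow> 0"
    using assms(1) by (rule summable_LIMSEQ_zero)
  then have "eventually (\<lambda>i. (of_bool (holding a b X i \<and> \<not> holding a b X (Suc i)) :: real) < 1) sequentially"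
    by (rule order_tendstoD) simp
  then obtain N where N: "\<And>i. i \<ge> N \<Longrightarrow> holding a b X i \<Longrightarrow> holding a b X (Suc i)"
    by (auto simp: eventually_sequentially)
  show False
  proof (cases "\<exists>n\<ge>N. holding a b X n")
    case True
    then obtain n where n: "n \<ge> N" "holding a b X n" by auto
    have hold: "holding a b X (n + i)" for i
    proof (induction i)
      case (Suc i)
      then show ?case using N[of "n + i"] n by simp
    qed (use n in simp)
    have "X (Suc (n + i)) \<le> b" for i
      using hold[of i] hold[of "Suc i"] by simp
    then have "eventually (\<lambda>k. \<not> X k > b) sequentially"
      unfolding eventually_sequentially by (metis add_Suc_right Suc_le_D add_Suc le_add_diff_inverse not_le)
    then show False using assms(3) by (simp add: frequently_def)
  next
    case False
    then have "\<not> X (Suc n) < a" if "n \<ge> N" for n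
      using that by (metis holding.simps(2) le_Suc_eq)
    then have "eventually (\<lambda>k. \<not> X k < a) sequentially"
      unfolding eventually_sequentially by (metis Suc_le_D Suc_le_mono)
    then show False using assms(2) by (simp add: frequently_def)
  qed
qed

text \<open>
  Rational levels suffice, which leaves only countably many exceptional null sets in the application.
\<close>

lemma convergent_if_no_oscillation:
  fixes X :: "nat \<Rightarrow> real"
  assumes nonneg: "\<And>n. 0 \<le> X n"
    and bdd: "liminf (\<lambda>n. ereal (X n)) < \<infinity>"
    and osc: "\<And>a b. a \<in> \<rat> \<Longrightarrow> b \<in> \<rat> \<Longrightarrow> 0 < a \<Longrightarrow> a < b \<Longrightarrow>
      \<not> (frequently (\<lambda>n. X n < a) sequentially \<and> frequently (\<lambda>n. X n > b) sequentially)"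
  shows "convergent X"
proof -
  have lim0: "0 \<le> liminf (\<lambda>n. ereal (X n))"
    by (rule Liminf_bounded) (simp add: nonneg)
  have "\<not> liminf (\<lambda>n. ereal (X n)) < limsup (\<lambda>n. ereal (X n))"
  proof
    assume less: "liminf (\<lambda>n. ereal (X n)) < limsup (\<lambda>n. ereal (X n))"
    obtain c d where cd: "liminf (\<lambda>n. ereal (X n)) < ereal c" "c < d"
       "ereal d < limsup (\<lambda>n. ereal (X n))"
      using ereal_dense2[OF less] by (metis ereal_dense2 ereal_less_eq(3) less_ereal.simps(1))
    obtain a where a: "a \<in> \<rat>" "c < a" "a < d" using Rats_dense_in_real[OF cd(2)] by auto
    obtain b where b: "b \<in> \<rat>" "a < b" "b < d" using Rats_dense_in_real[OF a(3)] by auto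
    have "0 < a" using lim0 cd(1) a(2)
      by (metis ereal_less(2) less_ereal.simps(1) order_le_less_trans order_less_trans)
    moreover have "frequently (\<lambda>n. X n < a) sequentially"
    proof (rule ccontr)
      assume "\<not> ?thesis"
      then have "eventually (\<lambda>n. ereal a \<le> ereal (X n)) sequentially"
        by (simp add: frequently_def not_less)
      then have "ereal a \<le> liminf (\<lambda>n. ereal (X n))" by (rule Liminf_bounded)
      with cd(1) a(2) show False
        by (metis ereal_less_eq(3) leD less_le_trans order_less_imp_le)
    qed
    moreover have "frequently (\<lambda>n. X n > b) sequentially"
    proof (rule ccontr)
      assume "\<not> ?thesis"
      then have "eventually (\<lambda>n. ereal (X n) \<le> ereal b) sequentially"
        by (simp add: frequently_def not_less)
      then have "limsup (\<lambda>n. ereal (X n)) \<le> ereal b" by (rule Limsup_bounded)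
      with cd(3) b(3) show False
        by (metis ereal_less_eq(3) leD less_le_trans order_less_imp_le)
    qed
    ultimately show False using osc a b by blast
  qed
  then have eq: "liminf (\<lambda>n. ereal (X n)) = limsup (\<lambda>n. ereal (X n))"
    using Liminf_le_Limsup[of sequentially "\<lambda>n. ereal (X n)"] by (simp add: antisym_conv)
  obtain l where l: "liminf (\<lambda>n. ereal (X n)) = ereal l"
    using lim0 bdd by (cases "liminf (\<lambda>n. ereal (X n))") auto
  have "(\<lambda>n. ereal (X n)) \<longlonglongrightarrow> ereal l"
    using eq l by (simp add: Liminf_eq_Limsup)
  then show ?thesis by (auto simp: convergent_def)
qed

lemma integrable_sum_bounded_imp_AE_summable:
  fixes u :: "nat \<Rightarrow> 'w \<Rightarrow> real"
  assumes int: "\<And>n. integrable \<Omega> (u n)" and nonneg: "\<And>n. AE \<omega> in \<Omega>. 0 \<le> u n \<omega>"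
    and bound: "\<And>n. (\<Sum>i<n. \<integral>\<omega>. u i \<omega> \<partial>\<Omega>) \<le> C"
  shows "AE \<omega> in \<Omega>. summable (\<lambda>i. u i \<omega>)"
proof -
  have [measurable]: "u i \<in> borel_measurable \<Omega>" for i using int by auto
  have "(\<integral>\<^sup>+\<omega>. (\<Sum>i. ennreal (u i \<omega>)) \<partial>\<Omega>) = (\<Sum>i. \<integral>\<^sup>+\<omega>. ennreal (u i \<omega>) \<partial>\<Omega>)"
    by (rule nn_integral_suminf) measurable
  also have "\<dots> = (\<Sum>i. ennreal (\<integral>\<omega>. u i \<omega> \<partial>\<Omega>))"
    by (intro suminf_cong nn_integral_eq_integral int nonneg)
  also have "\<dots> \<le> ennreal C"
  proof (rule suminf_le_const)
    fix n
    have "(\<Sum>i<n. ennreal (\<integral>\<omega>. u i \<omega> \<partial>\<Omega>)) = ennreal (\<Sum>i<n. \<integral>\<omega>. u i \<omega> \<partial>\<Omega>)"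
      by (rule sum_ennreal) (rule integral_nonneg_AE[OF nonneg])
    also have "\<dots> \<le> ennreal C" by (intro ennreal_leI bound)
    finally show "(\<Sum>i<n. ennreal (\<integral>\<omega>. u i \<omega> \<partial>\<Omega>)) \<le> ennreal C" .
  qed simp
  finally have "(\<integral>\<^sup>+\<omega>. (\<Sum>i. ennreal (u i \<omega>)) \<partial>\<Omega>) \<noteq> \<infinity>"
    by (auto simp: top_unique)
  then have "AE \<omega> in \<Omega>. (\<Sum>i. ennreal (u i \<omega>)) \<noteq> \<infinity>"
    by (intro nn_integral_noteq_infinite) auto
  moreover have "AE \<omega> in \<Omega>. \<forall>n. 0 \<le> u n \<omega>" using nonneg by (simp add: AE_all_countable)
  ultimately show ?thesis
    by eventually_elim (auto intro!: summable_suminf_not_top)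
qed

text \<open>
  The supermartingale property is stated by integrals over past events, so that no version of a
  conditional expectation has to be chosen. The gain of the strategy \<open>holding\<close> has nonpositive expectation,
  and by nonnegativity its open position loses at most \<open>a\<close>. Hence the number of upcrossings is integrable. Fatou's
  lemma excludes divergence to infinity.
\<close>

lemma nonneg_supermartingale_AE_convergent:
  fixes F :: "nat \<Rightarrow> 'w measure" and X :: "nat \<Rightarrow> 'w \<Rightarrow> real"
  assumes "prob_space \<Omega>"
    and sub: "\<And>n. subalgebra \<Omega> (F n)" and mono: "\<And>n. sets (F n) \<subseteq> sets (F (Suc n))"
    and adapted: "\<And>n. X n \<in> borel_measurable (F n)"
    and int: "\<And>n. integrable \<Omega> (X n)" and nonneg: "\<And>n \<omega>. 0 \<le> X n \<omega>"
    and super: "\<And>n A. A \<in> sets (F n) \<Longrightarrow>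
      (\<integral>\<omega>. indicator A \<omega> * X (Suc n) \<omega> \<partial>\<Omega>) \<le> (\<integral>\<omega>. indicator A \<omega> * X n \<omega> \<partial>\<Omega>)"
  shows "AE \<omega> in \<Omega>. convergent (\<lambda>n. X n \<omega>)"
proof -
  interpret prob_space \<Omega> by fact
  have sp: "space (F n) = space \<Omega>" and setsF: "sets (F n) \<subseteq> sets \<Omega>" for n
    using sub[of n] by (auto simp: subalgebra_def)
  have [measurable]: "X n \<in> borel_measurable \<Omega>" for n
    using adapted sub measurable_from_subalg by blast
  define H where "H a b n = {\<omega>\<in>space \<Omega>. holding a b (\<lambda>i. X i \<omega>) n}" for a b n
  have HF: "H a b n \<in> sets (F n)" for a b n
  proof (induction n)
    case 0
    have "{\<omega>\<in>space (F 0). X 0 \<omega> < a} \<in> sets (F 0)" using adapted[of 0] by measurable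
    then show ?case by (simp add: H_def sp)
  next
    case (Suc n)
    then have [measurable]: "H a b n \<in> sets (F (Suc n))" using mono by blast
    have [measurable]: "X (Suc n) \<in> borel_measurable (F (Suc n))" by (rule adapted)
    have "{\<omega>\<in>space (F (Suc n)). if \<omega> \<in> H a b n then X (Suc n) \<omega> \<le> b else X (Suc n) \<omega> < a}
        \<in> sets (F (Suc n))" by measurable
    also have "{\<omega>\<in>space (F (Suc n)). if \<omega> \<in> H a b n then X (Suc n) \<omega> \<le> b else X (Suc n) \<omega> < a}
        = H a b (Suc n)" by (auto simp: H_def sp)
    finally show ?case .
  qed
  have Hm[measurable]: "H a b n \<in> sets \<Omega>" for a b n using HF setsF by blast
  have intI: "integrable \<Omega> (\<lambda>\<omega>. indicator A \<omega> * X n \<omega>)" if "A \<in> sets \<Omega>" for A n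
    using integrable_real_mult_indicator[OF that int[of n]] by (simp add: mult.commute)
  \<comment> \<open>The expected number of upcrossings of \<open>[a, b]\<close> is at most \<open>a / (b - a)\<close>.\<close>
  have up: "AE \<omega> in \<Omega>. \<not> (frequently (\<lambda>n. X n \<omega> < a) sequentially \<and> frequently (\<lambda>n. X n \<omega> > b) sequentially)"
    if ab: "0 < a" "a < b" for a b
  proof -
    define u where "u i \<omega> = (of_bool (\<omega> \<in> H a b i \<and> \<omega> \<notin> H a b (Suc i)) :: real)" for i \<omega>
    have [measurable]: "u i \<in> borel_measurable \<Omega>" for i unfolding u_def by measurable
    have uint: "integrable \<Omega> (u i)" for i
      by (rule integrable_const_bound[where B=1]) (auto simp: u_def)
    have usum: "integrable \<Omega> (\<lambda>\<omega>. (b - a) * (\<Sum>i<n. u i \<omega>))" for n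
      using uint by (intro integrable_mult_right Bochner_Integration.integrable_sum) auto
    have bound: "(\<integral>\<omega>. (\<Sum>i<n. u i \<omega>) \<partial>\<Omega>) \<le> a / (b - a)" for n
    proof -
      have "(\<integral>\<omega>. (b - a) * (\<Sum>i<n. u i \<omega>) - a \<partial>\<Omega>)
          \<le> (\<integral>\<omega>. (\<Sum>i<n. indicator (H a b i) \<omega> * X (Suc i) \<omega> - indicator (H a b i) \<omega> * X i \<omega>) \<partial>\<Omega>)"
      proof (rule integral_mono)
        fix \<omega> assume "\<omega> \<in> space \<Omega>"
        then have eq: "\<omega> \<in> H a b i \<longleftrightarrow> holding a b (\<lambda>i. X i \<omega>) i" for i by (simp add: H_def)
        have e1: "(\<Sum>i<n. indicator (H a b i) \<omega> * X (Suc i) \<omega> - indicator (H a b i) \<omega> * X i \<omega>)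
          = (\<Sum>i<n. of_bool (holding a b (\<lambda>i. X i \<omega>) i) * (X (Suc i) \<omega> - X i \<omega>))"
          by (rule sum.cong) (auto simp: indicator_def eq)
        have e2: "(\<Sum>i<n. u i \<omega>) =
            (\<Sum>i<n. of_bool (holding a b (\<lambda>i. X i \<omega>) i \<and> \<not> holding a b (\<lambda>i. X i \<omega>) (Suc i)))"
          unfolding u_def eq ..
        have "(b - a) * (\<Sum>i<n. u i \<omega>) + (if holding a b (\<lambda>i. X i \<omega>) n then X n \<omega> - a else 0)
           \<le> (\<Sum>i<n. indicator (H a b i) \<omega> * X (Suc i) \<omega> - indicator (H a b i) \<omega> * X i \<omega>)"
          unfolding e1 e2 by (rule upcrossings_le_gain[OF ab(2)])
        moreover have "- a \<le> (if holding a b (\<lambda>i. X i \<omega>) n then X n \<omega> - a else 0)"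
          using nonneg[of n \<omega>] ab(1) by simp
        ultimately show "(b - a) * (\<Sum>i<n. u i \<omega>) - a
           \<le> (\<Sum>i<n. indicator (H a b i) \<omega> * X (Suc i) \<omega> - indicator (H a b i) \<omega> * X i \<omega>)"
          by linarith
      qed (intro Bochner_Integration.integrable_diff Bochner_Integration.integrable_sum usum intI integrable_const Hm)+
      also have "\<dots> = (\<Sum>i<n. (\<integral>\<omega>. indicator (H a b i) \<omega> * X (Suc i) \<omega> \<partial>\<Omega>)
          - (\<integral>\<omega>. indicator (H a b i) \<omega> * X i \<omega> \<partial>\<Omega>))"
        by (subst Bochner_Integration.integral_sum) (auto intro!: intI sum.cong Bochner_Integration.integral_diff)
      also have "\<dots> \<le> 0"
        by (rule sum_nonpos) (use super HF in auto)
      finally have "(b - a) * (\<integral>\<omega>. (\<Sum>i<n. u i \<omega>) \<partial>\<Omega>) - a \<le> 0"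
        by (subst (asm) Bochner_Integration.integral_diff) (auto intro!: uint simp: prob_space)
      then show ?thesis using ab by (simp add: field_simps)
    qed
    have "AE \<omega> in \<Omega>. summable (\<lambda>i. u i \<omega>)"
    proof (rule integrable_sum_bounded_imp_AE_summable[OF uint])
      show "(\<Sum>i<n. \<integral>\<omega>. u i \<omega> \<partial>\<Omega>) \<le> a / (b - a)" for n
        using bound[of n] uint by (simp add: Bochner_Integration.integral_sum)
    qed (simp add: u_def)
    then show ?thesis
    proof (rule AE_mp, intro AE_I2 impI)
      fix \<omega> assume "\<omega> \<in> space \<Omega>" and "summable (\<lambda>i. u i \<omega>)"
      then have "summable (\<lambda>i. of_bool (holding a b (\<lambda>i. X i \<omega>) i \<and> \<not> holding a b (\<lambda>i. X i \<omega>) (Suc i)) :: real)"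
        by (simp add: u_def H_def)
      then show "\<not> (frequently (\<lambda>n. X n \<omega> < a) sequentially \<and> frequently (\<lambda>n. X n \<omega> > b) sequentially)"
        using finite_upcrossings_imp_no_oscillation by blast
    qed
  qed
  have all: "AE \<omega> in \<Omega>. \<forall>p\<in>{p\<in>\<rat>\<times>\<rat>. 0 < fst p \<and> fst p < snd p}.
      \<not> (frequently (\<lambda>n. X n \<omega> < fst p) sequentially \<and> frequently (\<lambda>n. X n \<omega> > snd p) sequentially)"
  proof (subst AE_ball_countable)
    show "countable {p\<in>\<rat>\<times>\<rat>. 0 < fst p \<and> fst p < (snd p :: real)}"
      by (rule countable_subset[OF _ countable_SIGMA[OF countable_rat countable_rat]]) auto
  qed (use up in blast)
  have EX: "(\<integral>\<omega>. X n \<omega> \<partial>\<Omega>) \<le> (\<integral>\<omega>. X 0 \<omega> \<partial>\<Omega>)" for n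
  proof (induction n)
    case (Suc n)
    have "(\<integral>\<omega>. X (Suc n) \<omega> \<partial>\<Omega>) = (\<integral>\<omega>. indicator (space \<Omega>) \<omega> * X (Suc n) \<omega> \<partial>\<Omega>)"
      by (rule Bochner_Integration.integral_cong) auto
    also have "\<dots> \<le> (\<integral>\<omega>. indicator (space \<Omega>) \<omega> * X n \<omega> \<partial>\<Omega>)"
      by (rule super) (use sp[of n] in \<open>metis sets.top\<close>)
    also have "\<dots> = (\<integral>\<omega>. X n \<omega> \<partial>\<Omega>)"
      by (rule Bochner_Integration.integral_cong) auto
    finally show ?case using Suc by simp
  qed simp
  have "(\<integral>\<^sup>+\<omega>. liminf (\<lambda>n. ennreal (X n \<omega>)) \<partial>\<Omega>) \<le> liminf (\<lambda>n. \<integral>\<^sup>+\<omega>. ennreal (X n \<omega>) \<partial>\<Omega>)"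
    by (rule nn_integral_liminf) measurable
  also have "\<dots> \<le> ennreal (\<integral>\<omega>. X 0 \<omega> \<partial>\<Omega>)"
  proof -
    have "(\<integral>\<^sup>+\<omega>. ennreal (X n \<omega>) \<partial>\<Omega>) \<le> ennreal (\<integral>\<omega>. X 0 \<omega> \<partial>\<Omega>)" for n
      by (subst nn_integral_eq_integral) (auto simp: int nonneg EX intro!: ennreal_leI)
    then have "liminf (\<lambda>n. \<integral>\<^sup>+\<omega>. ennreal (X n \<omega>) \<partial>\<Omega>) \<le> liminf (\<lambda>n. ennreal (\<integral>\<omega>. X 0 \<omega> \<partial>\<Omega>))"
      by (intro Liminf_mono) auto
    then show ?thesis by (simp add: Liminf_const)
  qed
  finally have "(\<integral>\<^sup>+\<omega>. liminf (\<lambda>n. ennreal (X n \<omega>)) \<partial>\<Omega>) \<noteq> \<infinity>"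
    by (auto simp: top_unique)
  then have fin: "AE \<omega> in \<Omega>. liminf (\<lambda>n. ennreal (X n \<omega>)) \<noteq> \<infinity>"
    by (intro nn_integral_noteq_infinite) auto
  from fin all show ?thesis
  proof eventually_elim
    case (elim \<omega>)
    show ?case
    proof (rule convergent_if_no_oscillation)
      show "liminf (\<lambda>n. ereal (X n \<omega>)) < \<infinity>"
      proof (rule ccontr)
        assume "\<not> ?thesis"
        then have top: "liminf (\<lambda>n. ereal (X n \<omega>)) = \<infinity>" by simp
        have "ennreal c \<le> liminf (\<lambda>n. ennreal (X n \<omega>))" for c
        proof (rule Liminf_bounded)
          have "ereal c < liminf (\<lambda>n. ereal (X n \<omega>))" using top by simp
          then have "eventually (\<lambda>n. ereal c < ereal (X n \<omega>)) sequentially" by (rule less_LiminfD)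
          then show "eventually (\<lambda>n. ennreal c \<le> ennreal (X n \<omega>)) sequentially"
            by eventually_elim (auto intro!: ennreal_leI)
        qed
        then have "liminf (\<lambda>n. ennreal (X n \<omega>)) = \<infinity>"
        proof (cases "liminf (\<lambda>n. ennreal (X n \<omega>))")
          case (real c)
          with \<open>\<And>c. ennreal c \<le> liminf (\<lambda>n. ennreal (X n \<omega>))\<close>[of "c + 1"] show ?thesis by simp
        qed simp
        then show False using elim(1) by simp
      qed
    qed (use elim nonneg in auto)
  qed
qed


lemma convergent_prod_one_plus:
  fixes a :: "nat \<Rightarrow> real"
  assumes "\<And>n. 0 \<le> a n" and "summable a"
  shows "convergent (\<lambda>n. \<Prod>i<n. 1 + a i)"
proof (rule Bseq_mono_convergent)
  show "\<forall>m n. m \<le> n \<longrightarrow> (\<Prod>i<m. 1 + a i) \<le> (\<Prod>i<n. 1 + a i)"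
    using assms(1) by (auto intro!: prod_mono2 simp: add_nonneg_nonneg)
  have "norm (\<Prod>i<n. 1 + a i) \<le> exp (suminf a)" for n
  proof -
    have "(\<Prod>i<n. 1 + a i) \<le> exp (\<Sum>i<n. a i)"
      by (simp add: exp_sum) (auto intro!: prod_mono simp: assms add_nonneg_nonneg)
    also have "\<dots> \<le> exp (suminf a)" using sum_le_suminf[OF assms(2)] assms(1) by simp
    finally show ?thesis using assms(1) by (simp add: abs_prod)
  qed
  then show "Bseq (\<lambda>n. \<Prod>i<n. 1 + a i)" by (rule BseqI')
qed

text \<open>
  Dividing by the accumulated factors and adding the tail of the series of perturbations turns the
  almost supermartingale into a supermartingale. Both corrections converge.
\<close>

lemma robbins_siegmund:
  fixes F :: "nat \<Rightarrow> 'w measure" and X :: "nat \<Rightarrow> 'w \<Rightarrow> real" and a b :: "nat \<Rightarrow> real"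
  assumes "prob_space \<Omega>"
    and sub: "\<And>n. subalgebra \<Omega> (F n)" and mono: "\<And>n. sets (F n) \<subseteq> sets (F (Suc n))"
    and adapted: "\<And>n. X n \<in> borel_measurable (F n)"
    and int: "\<And>n. integrable \<Omega> (X n)" and nonneg: "\<And>n \<omega>. 0 \<le> X n \<omega>"
    and a: "\<And>n. 0 \<le> a n" "summable a" and b: "\<And>n. 0 \<le> b n" "summable b"
    and step: "\<And>n A. A \<in> sets (F n) \<Longrightarrow>
      (\<integral>\<omega>. indicator A \<omega> * X (Suc n) \<omega> \<partial>\<Omega>)
        \<le> (1 + a n) * (\<integral>\<omega>. indicator A \<omega> * X n \<omega> \<partial>\<Omega>) + b n * measure \<Omega> A"
  shows "AE \<omega> in \<Omega>. convergent (\<lambda>n. X n \<omega>)"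
proof -
  interpret prob_space \<Omega> by fact
  define \<pi> where "\<pi> n = (\<Prod>i<n. 1 + a i)" for n
  define T where "T n = (\<Sum>i. b (i + n))" for n
  have pi1: "1 \<le> \<pi> n" for n unfolding \<pi>_def using a by (intro prod_ge_1) auto
  have piS: "\<pi> (Suc n) = (1 + a n) * \<pi> n" for n by (simp add: \<pi>_def)
  have Ts: "summable (\<lambda>i. b (i + n))" for n using b(2) by (rule summable_ignore_initial_segment)
  have TS: "T n = T (Suc n) + b n" for n
    using suminf_split_head[OF Ts[of n]] by (simp add: T_def)
  have T0: "0 \<le> T n" for n unfolding T_def by (rule suminf_nonneg[OF Ts b(1)])
  have Tlim: "T \<longlonglongrightarrow> 0" unfolding T_def by (rule suminf_exist_split2[OF b(2)])
  define Y where "Y n \<omega> = X n \<omega> / \<pi> n + T n" for n \<omega>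
  have setsF: "sets (F n) \<subseteq> sets \<Omega>" for n using sub[of n] by (auto simp: subalgebra_def)
  have intA: "integrable \<Omega> (\<lambda>\<omega>. indicator A \<omega> * X n \<omega>)" if "A \<in> sets \<Omega>" for A n
    using integrable_real_mult_indicator[OF that int[of n]] by (simp add: mult.commute)
  have intY: "(\<integral>\<omega>. indicator A \<omega> * Y n \<omega> \<partial>\<Omega>)
      = (\<integral>\<omega>. indicator A \<omega> * X n \<omega> \<partial>\<Omega>) / \<pi> n + T n * measure \<Omega> A" if "A \<in> sets \<Omega>" for A n
  proof -
    have "(\<integral>\<omega>. indicator A \<omega> * Y n \<omega> \<partial>\<Omega>) = (\<integral>\<omega>. indicator A \<omega> * X n \<omega> / \<pi> n + T n * indicator A \<omega> \<partial>\<Omega>)"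
      by (simp add: Y_def algebra_simps)
    also have "\<dots> = (\<integral>\<omega>. indicator A \<omega> * X n \<omega> / \<pi> n \<partial>\<Omega>) + (\<integral>\<omega>. T n * indicator A \<omega> \<partial>\<Omega>)"
      using intA[OF that, of n] that
      by (intro Bochner_Integration.integral_add) (auto intro!: integrable_real_indicator simp: emeasure_eq_measure)
    finally show ?thesis using that by simp
  qed
  have "AE \<omega> in \<Omega>. convergent (\<lambda>n. Y n \<omega>)"
  proof (rule nonneg_supermartingale_AE_convergent[where F=F, OF \<open>prob_space \<Omega>\<close> sub mono])
    fix n A assume A: "A \<in> sets (F n)"
    then have A': "A \<in> sets \<Omega>" using setsF by blast
    have "(\<integral>\<omega>. indicator A \<omega> * X (Suc n) \<omega> \<partial>\<Omega>) / \<pi> (Suc n)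
       \<le> ((1 + a n) * (\<integral>\<omega>. indicator A \<omega> * X n \<omega> \<partial>\<Omega>) + b n * measure \<Omega> A) / \<pi> (Suc n)"
      using step[OF A] pi1[of "Suc n"] by (intro divide_right_mono) auto
    also have "\<dots> = (\<integral>\<omega>. indicator A \<omega> * X n \<omega> \<partial>\<Omega>) / \<pi> n + b n * measure \<Omega> A / \<pi> (Suc n)"
    proof -
      have "1 + a n \<noteq> 0" using a(1)[of n] by linarith
      then show ?thesis unfolding piS add_divide_distrib by simp
    qed
    also have "b n * measure \<Omega> A / \<pi> (Suc n) \<le> b n * measure \<Omega> A"
      using mult_left_mono[OF pi1[of "Suc n"], of "b n * measure \<Omega> A"] pi1[of "Suc n"] b(1)[of n]
      by (subst pos_divide_le_eq) auto
    finally show "(\<integral>\<omega>. indicator A \<omega> * Y (Suc n) \<omega> \<partial>\<Omega>) \<le> (\<integral>\<omega>. indicator A \<omega> * Y n \<omega> \<partial>\<Omega>)"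
      unfolding intY[OF A'] TS[of n] by (simp add: algebra_simps)
  next
    show "Y n \<in> borel_measurable (F n)" for n
      using adapted[of n] unfolding Y_def[abs_def] by measurable
    show "0 \<le> Y n \<omega>" for n \<omega>
      using nonneg[of n \<omega>] pi1[of n] T0[of n] by (simp add: Y_def)
    show "integrable \<Omega> (Y n)" for n
      unfolding Y_def[abs_def] using int[of n] by auto
  qed
  then show ?thesis
  proof eventually_elim
    case (elim \<omega>)
    have "convergent \<pi>" unfolding \<pi>_def by (rule convergent_prod_one_plus[OF a])
    then have "convergent (\<lambda>n. (Y n \<omega> - T n) * \<pi> n)"
      using elim \<open>convergent \<pi>\<close> Tlim by (intro convergent_mult convergent_diff) (auto simp: convergent_def)
    moreover have "(Y n \<omega> - T n) * \<pi> n = X n \<omega>" for n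
      using pi1[of n] by (simp add: Y_def)
    ultimately show ?case by simp
  qed
qed

section \<open>Convex functions, weighted norms and proximal points\<close>

lemma convex_funD:
  fixes p :: "'a::real_vector \<Rightarrow> ereal"
  assumes "convex_fun p" "p y \<le> ereal a" "p z \<le> ereal b" "0 \<le> t" "t \<le> 1"
  shows "p ((1 - t) *\<^sub>R y + t *\<^sub>R z) \<le> ereal ((1 - t) * a + t * b)"
proof -
  have "(1 - t) *\<^sub>R (y, a) + t *\<^sub>R (z, b) \<in> ereal_epigraph p"
    using assms by (intro convexD) (auto simp: convex_fun_def ereal_epigraph_def)
  then show ?thesis by (simp add: ereal_epigraph_def)
qed

lemma spd_linear: "spd M \<Longrightarrow> linear M" by (simp add: spd_def)

lemma spd_sym:
  assumes "spd M" shows "x \<bullet> M y = y \<bullet> M x"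
  using adjoint_works[of M x y] assms by (simp add: spd_def inner_commute)

lemma spd_nonneg: "spd M \<Longrightarrow> 0 \<le> x \<bullet> M x"
  by (cases "x = 0") (auto simp: spd_def less_imp_le)

lemma wnorm_sq: "spd M \<Longrightarrow> (wnorm M x)\<^sup>2 = x \<bullet> M x"
  by (simp add: wnorm_def spd_nonneg)

lemma wnorm_nonneg: "spd M \<Longrightarrow> 0 \<le> wnorm M x"
  by (simp add: wnorm_def spd_nonneg)

lemma wnorm_minus_commute:
  assumes "spd M" shows "wnorm M (u - v) = wnorm M (v - u)"
proof -
  have "M (u - v) = - M (v - u)" using linear_neg[OF spd_linear[OF assms], of "v - u"] by simp
  then have "(u - v) \<bullet> M (u - v) = (v - u) \<bullet> M (v - u)"
    by (metis inner_minus_left inner_minus_right minus_diff_eq minus_minus)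
  then show ?thesis by (simp only: wnorm_def)
qed

lemma spd_add:
  assumes "spd M"
  shows "(x + y) \<bullet> M (x + y) = x \<bullet> M x + 2 * (x \<bullet> M y) + y \<bullet> M y"
  using spd_sym[OF assms, of x y]
  by (simp add: linear_add[OF spd_linear[OF assms]] inner_add_left inner_add_right)

lemma spd_scale: "spd M \<Longrightarrow> (c *\<^sub>R x) \<bullet> M (c *\<^sub>R x) = c\<^sup>2 * (x \<bullet> M x)"
  by (simp add: linear_scale[OF spd_linear] power2_eq_square)

text \<open>
  This form of the Cauchy-Schwarz inequality for \<open>M\<close> needs no root: it is \<open>M\<close>'s nonnegativity at
  \<open>t x - y\<close>.
\<close>

lemma spd_young:
  assumes "spd M" "0 < t"
  shows "2 * (x \<bullet> M y) \<le> t * (x \<bullet> M x) + (y \<bullet> M y) / t"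
proof -
  have "0 \<le> (t *\<^sub>R x + (- 1) *\<^sub>R y) \<bullet> M (t *\<^sub>R x + (- 1) *\<^sub>R y)"
    by (rule spd_nonneg[OF assms(1)])
  also have "\<dots> = t\<^sup>2 * (x \<bullet> M x) - 2 * t * (x \<bullet> M y) + y \<bullet> M y"
    unfolding spd_add[OF assms(1)] spd_scale[OF assms(1)]
    by (simp add: linear_scale[OF spd_linear[OF assms(1)]] linear_neg[OF spd_linear[OF assms(1)]])
  finally have "0 \<le> (t\<^sup>2 * (x \<bullet> M x) - 2 * t * (x \<bullet> M y) + y \<bullet> M y) / t"
    using assms(2) by simp
  also have "\<dots> = t * (x \<bullet> M x) + (y \<bullet> M y) / t - 2 * (x \<bullet> M y)"
    using assms(2) by (simp add: field_simps power2_eq_square)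
  finally show ?thesis by simp
qed

lemma wnorm_sq_add_le:
  assumes "spd M" "0 < t"
  shows "(wnorm M (x + y))\<^sup>2 \<le> (1 + t) * (wnorm M x)\<^sup>2 + (1 + 1 / t) * (wnorm M y)\<^sup>2"
  using spd_young[OF assms, of x y] unfolding wnorm_sq[OF assms(1)] spd_add[OF assms(1)]
  by (simp add: algebra_simps)

lemma wnorm_sq_convex_comb:
  assumes "spd M"
  shows "(wnorm M ((1 - t) *\<^sub>R y + t *\<^sub>R z - x))\<^sup>2
    = (1 - t) * (wnorm M (y - x))\<^sup>2 + t * (wnorm M (z - x))\<^sup>2 - t * (1 - t) * (wnorm M (z - y))\<^sup>2"
proof -
  define u w where "u = y - x" and "w = z - y"
  have "(1 - t) *\<^sub>R y + t *\<^sub>R z - x = u + t *\<^sub>R w" "z - x = u + w"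
    by (simp_all add: u_def w_def algebra_simps)
  then show ?thesis
    unfolding u_def[symmetric] w_def[symmetric] wnorm_sq[OF assms]
    unfolding \<open>z - x = u + w\<close> \<open>(1 - t) *\<^sub>R y + t *\<^sub>R z - x = u + t *\<^sub>R w\<close> spd_add[OF assms] spd_scale[OF assms]
    by (simp add: linear_scale[OF spd_linear[OF assms]] algebra_simps power2_eq_square)
qed

text \<open>
  Along a ray the lower limit that defines a Frechet subgradient becomes a bound in one real variable, which
  convexity can match from above.
\<close>

lemma subdifferential_ray:
  assumes v: "v \<in> subdifferential p x" and ne: "y \<noteq> x" and pre: "0 < e"
  shows "\<exists>\<delta>>0. \<forall>t. 0 < t \<and> t < \<delta> \<longrightarrow>
    p x + ereal (t * (v \<bullet> (y - x)) - t * e) \<le> p (x + t *\<^sub>R (y - x))"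
proof -
  define d where "d = norm (y - x)"
  have d: "0 < d" using ne by (simp add: d_def)
  obtain px where px: "p x = ereal px" using v by (cases "p x") (auto simp: subdifferential_def)
  have "0 \<le> Liminf (at x) (\<lambda>y. (p y - p x - ereal (v \<bullet> (y - x))) / ereal (norm (y - x)))"
    using v by (simp add: subdifferential_def)
  then have "ereal (- (e / d)) < Liminf (at x) (\<lambda>y. (p y - p x - ereal (v \<bullet> (y - x))) / ereal (norm (y - x)))"
    using d pre by (intro less_le_trans[OF _ \<open>0 \<le> _\<close>]) simp
  then have "eventually (\<lambda>y. ereal (- (e / d)) < (p y - p x - ereal (v \<bullet> (y - x))) / ereal (norm (y - x))) (at x)"
    by (rule less_LiminfD)
  then obtain \<delta> where \<delta>: "0 < \<delta>" "\<And>u. u \<noteq> x \<Longrightarrow> dist u x < \<delta> \<Longrightarrow>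
      ereal (- (e / d)) < (p u - p x - ereal (v \<bullet> (u - x))) / ereal (norm (u - x))"
    by (auto simp: eventually_at)
  show ?thesis
  proof (intro exI conjI allI impI)
    show "0 < \<delta> / d" using \<delta> d by simp
    fix t assume t: "0 < t \<and> t < \<delta> / d"
    define u where "u = x + t *\<^sub>R (y - x)"
    have nu: "norm (u - x) = t * d" using t by (simp add: u_def d_def)
    have td: "0 < t * d" using t d by simp
    have "u \<noteq> x" "dist u x < \<delta>" using nu td t d by (auto simp: dist_norm field_simps)
    then have less: "ereal (- (e / d)) < (p u - p x - ereal (v \<bullet> (u - x))) / ereal (t * d)"
      using \<delta>(2)[of u] nu by simp
    have vu: "v \<bullet> (u - x) = t * (v \<bullet> (y - x))" by (simp add: u_def)
    show "p x + ereal (t * (v \<bullet> (y - x)) - t * e) \<le> p (x + t *\<^sub>R (y - x))"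
    proof (cases "p u")
      case (real pu)
      then have "- (e / d) < (pu - px - t * (v \<bullet> (y - x))) / (t * d)"
        using less td d t by (auto simp: px vu)
      then have "- (e / d) * (t * d) < pu - px - t * (v \<bullet> (y - x))"
        using td by (simp add: pos_less_divide_eq)
      then have "px + (t * (v \<bullet> (y - x)) - t * e) \<le> pu" using d by (simp add: mult.commute)
      then show ?thesis using real unfolding u_def[symmetric] by (simp add: px)
    next
      case PInf
      then show ?thesis unfolding u_def[symmetric] by simp
    next
      case MInf
      then show ?thesis using less td by (simp add: px)
    qed
  qed
qed

text \<open>
  On a short initial piece of the ray from \<open>x\<close> to \<open>y\<close> the subgradient bounds the function from below, and
  convexity bounds it from above with a gain quadratic in the distance; dividing by the length of the piece makes
  the local inequality global. The cases \<open>c = 0\<close> and \<open>v = 0\<close> are the subgradient inequality of a convex function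
  and the quadratic growth of a proximal objective at its minimizer.
\<close>

lemma subdifferential_strong_convex_ineq:
  assumes p: "convex_fun p" and M: "spd M" and c: "0 \<le> c"
    and v: "v \<in> subdifferential (\<lambda>y. p y + ereal (c * (wnorm M (y - x0))\<^sup>2)) x"
    and px: "p x = ereal a" and py: "p y \<le> ereal b"
  shows "a + c * (wnorm M (x - x0))\<^sup>2 + v \<bullet> (y - x) + c * (wnorm M (y - x))\<^sup>2
     \<le> b + c * (wnorm M (y - x0))\<^sup>2"
proof (cases "y = x")
  case True
  then show ?thesis using py px by (simp add: wnorm_def)
next
  case False
  define q where "q u = c * (wnorm M (u - x0))\<^sup>2" for u
  define D where "D = c * (wnorm M (y - x))\<^sup>2"
  show ?thesis
    unfolding q_def[symmetric] D_def[symmetric]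
  proof (rule field_le_epsilon)
    fix e :: real assume e: "0 < e"
    from subdifferential_ray[OF v False, of "e / 2"] e obtain \<delta> where \<delta>: "0 < \<delta>"
      "\<And>t. 0 < t \<Longrightarrow> t < \<delta> \<Longrightarrow> p x + ereal (q x) + ereal (t * (v \<bullet> (y - x)) - t * (e / 2))
          \<le> p (x + t *\<^sub>R (y - x)) + ereal (q (x + t *\<^sub>R (y - x)))"
      unfolding q_def by auto
    define t where "t = min (1 / 2) (min (\<delta> / 2) (e / (2 * (D + 1))))"
    have D0: "0 \<le> D" using c by (simp add: D_def)
    have t: "0 < t" "t < \<delta>" "t \<le> 1" "t * D \<le> e / 2"
    proof -
      show "0 < t" "t < \<delta>" "t \<le> 1" using \<delta>(1) e D0 by (auto simp: t_def min_less_iff_disj)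
      have "t * D \<le> e / (2 * (D + 1)) * (D + 1)"
        using D0 e \<open>0 < t\<close> by (intro mult_mono) (auto simp: t_def)
      also have "e / (2 * (D + 1)) * (D + 1) = e / 2" using D0 by (simp add: field_simps)
      finally show "t * D \<le> e / 2" .
    qed
    have comb: "x + t *\<^sub>R (y - x) = (1 - t) *\<^sub>R x + t *\<^sub>R y" by (simp add: algebra_simps)
    have "p (x + t *\<^sub>R (y - x)) \<le> ereal ((1 - t) * a + t * b)"
      unfolding comb using px py t by (intro convex_funD[OF p]) auto
    then have "p (x + t *\<^sub>R (y - x)) + ereal (q (x + t *\<^sub>R (y - x)))
       \<le> ereal ((1 - t) * a + t * b) + ereal (q (x + t *\<^sub>R (y - x)))"
      by (rule add_right_mono)
    with \<delta>(2)[OF t(1,2)] have "ereal a + ereal (q x) + ereal (t * (v \<bullet> (y - x)) - t * (e / 2))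
        \<le> ereal ((1 - t) * a + t * b) + ereal (q (x + t *\<^sub>R (y - x)))"
      unfolding px by (rule order_trans)
    moreover have "q (x + t *\<^sub>R (y - x)) = (1 - t) * q x + t * q y - t * (1 - t) * D"
      unfolding q_def comb wnorm_sq_convex_comb[OF M] D_def by (simp add: algebra_simps)
    ultimately have "t * (v \<bullet> (y - x)) - t * (e / 2) + t * a + t * q x \<le> t * b + t * q y - t * (1 - t) * D"
      by (simp add: algebra_simps)
    then have "t * (v \<bullet> (y - x) - e / 2 + a + q x) \<le> t * (b + q y - (1 - t) * D)"
      by (simp add: algebra_simps)
    then have "v \<bullet> (y - x) - e / 2 + a + q x \<le> b + q y - (1 - t) * D"
      using t(1) by simp
    then show "a + q x + v \<bullet> (y - x) + D \<le> b + q y + e"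
      using t(4) by (simp add: algebra_simps)
  qed
qed

lemma argmin_imp_zero_subdifferential:
  assumes "x \<in> argmin p" "\<bar>p x\<bar> \<noteq> \<infinity>"
  shows "0 \<in> subdifferential p x"
proof -
  obtain px where px: "p x = ereal px" using assms(2) by auto
  have "0 \<le> (p y - p x - ereal (0 \<bullet> (y - x))) / ereal (norm (y - x))" if "y \<noteq> x" for y
  proof -
    have "p x \<le> p y" using assms(1) by (auto simp: argmin_def is_arg_min_def not_less)
    then show ?thesis using that px by (cases "p y") (auto simp: )
  qed
  then have "eventually (\<lambda>y. 0 \<le> (p y - p x - ereal (0 \<bullet> (y - x))) / ereal (norm (y - x))) (at x)"
    by (auto simp: eventually_at intro!: exI[of _ 1])
  then show ?thesis using assms(2) by (auto simp: subdifferential_def intro!: Liminf_bounded)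
qed


lemma prox_strong_ineq:
  assumes p: "convex_fun p" and M: "spd M" and \<alpha>: "0 < \<alpha>"
    and z: "z \<in> prox M \<alpha> p x" and pz: "p z = ereal a" and py: "p y \<le> ereal b"
  shows "a + 1 / (2 * \<alpha>) * (wnorm M (z - x))\<^sup>2 + 1 / (2 * \<alpha>) * (wnorm M (y - z))\<^sup>2
     \<le> b + 1 / (2 * \<alpha>) * (wnorm M (y - x))\<^sup>2"
proof -
  have "0 \<in> subdifferential (\<lambda>y. p y + ereal (1 / (2 * \<alpha>) * (wnorm M (y - x))\<^sup>2)) z"
    using z pz by (intro argmin_imp_zero_subdifferential) (auto simp: prox_def prox_objective_def[abs_def])
  from subdifferential_strong_convex_ineq[OF p M _ this pz py] \<alpha> show ?thesis by simp
qed

text \<open>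
  The affine minorant makes the proximal objective coercive. The minimum is taken over a compact piece
  of the epigraph, on which the objective becomes a continuous function of the pair of point and height.
\<close>

lemma prox_exists:
  fixes p :: "'a::euclidean_space \<Rightarrow> ereal"
  assumes "proper p" "closed_fun p" and minorant: "\<And>y. ereal (c + g \<bullet> y) \<le> p y"
    and M: "spd M" and L: "0 < L" "\<And>v. norm v \<le> L * wnorm M v" and \<alpha>: "0 < \<alpha>"
  shows "\<exists>z\<in>prox M \<alpha> p x. \<bar>p z\<bar> \<noteq> \<infinity>"
proof -
  have pmin: "p y \<noteq> -\<infinity>" for y using assms(1) by (simp add: proper_def)
  obtain y0 where "p y0 < \<infinity>" using assms(1) by (auto simp: proper_def effdom_def)
  then obtain t0 where t0: "p y0 = ereal t0" using pmin[of y0] by (cases "p y0") auto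
  define \<kappa> where "\<kappa> = 1 / (2 * \<alpha> * L\<^sup>2)"
  have \<kappa>: "0 < \<kappa>" using \<alpha> L by (simp add: \<kappa>_def)
  define q where "q y = 1 / (2 * \<alpha>) * (wnorm M (y - x))\<^sup>2" for y
  have q: "\<kappa> * (norm (y - x))\<^sup>2 \<le> q y" for y
  proof -
    have "(norm (y - x))\<^sup>2 \<le> (L * wnorm M (y - x))\<^sup>2" using L by (intro power_mono) auto
    then have "\<kappa> * (norm (y - x))\<^sup>2 \<le> \<kappa> * (L * wnorm M (y - x))\<^sup>2" using \<kappa> by simp
    also have "\<dots> = q y" using L \<alpha> by (simp add: \<kappa>_def q_def power_mult_distrib)
    finally show ?thesis .
  qed
  define h where "h = (\<lambda>(y, t). t + q y)"
  have bl: "bounded_linear M" using spd_linear[OF M] by (simp add: linear_conv_bounded_linear)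
  have "continuous_on UNIV (\<lambda>u::('a \<times> real). M (fst u - x))"
    by (rule bounded_linear.continuous_on[OF bl]) (intro continuous_intros)
  then have conth: "continuous_on UNIV h"
    unfolding h_def q_def wnorm_sq[OF M] case_prod_beta
    by (intro continuous_on_add continuous_on_mult continuous_on_inner continuous_on_diff
        continuous_on_fst continuous_on_snd continuous_on_const continuous_on_id)
  define H where "H = h (y0, t0)"
  define K where "K = ereal_epigraph p \<inter> {u. h u \<le> H}"
  have "closed K" unfolding K_def
    using assms(2) conth by (intro closed_Int closed_Collect_le continuous_on_const) (auto simp: closed_fun_def)
  moreover have "bounded K"
  proof -
    \<comment> \<open>\<open>B\<close> exceeds the positive root of \<open>\<kappa> s\<^sup>2 = A + norm g * s\<close>.\<close>
    define A where "A = \<bar>H - c - g \<bullet> x\<bar>"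
    define B where "B = (A + norm g) / \<kappa> + 1"
    define T where "T = \<bar>H\<bar> + \<bar>c + g \<bullet> x\<bar> + norm g * B"
    have "y \<in> cball x B \<and> t \<in> {- T..T}" if yt: "(y, t) \<in> K" for y t
    proof -
      define s where "s = norm (y - x)"
      have t: "c + g \<bullet> y \<le> t" "t + q y \<le> H"
        using order_trans[OF minorant[of y], of "ereal t"] yt by (auto simp: K_def ereal_epigraph_def h_def)
      have gy: "\<bar>g \<bullet> (y - x)\<bar> \<le> norm g * s" unfolding s_def by (rule Cauchy_Schwarz_ineq2)
      have gyx: "g \<bullet> y = g \<bullet> x + g \<bullet> (y - x)" by (simp add: inner_diff_right)
      have s2: "\<kappa> * s\<^sup>2 \<le> A + norm g * s"
        using t q[of y] gy gyx unfolding s_def[symmetric] A_def by linarith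
      have "s \<le> B"
      proof (rule ccontr)
        assume "\<not> s \<le> B"
        then have sB: "B < s" by simp
        have A0: "0 \<le> (A + norm g) / \<kappa>" using \<kappa> by (simp add: A_def)
        have s1: "1 < s" and "(A + norm g) / \<kappa> < s" using sB A0 by (auto simp: B_def)
        then have "A + norm g < \<kappa> * s" using \<kappa> by (simp add: field_simps)
        then have "(A + norm g) * s < \<kappa> * s * s" using s1 by simp
        moreover have "A * 1 \<le> A * s" using s1 by (intro mult_left_mono) (auto simp: A_def)
        ultimately show False using s2 by (simp add: power2_eq_square algebra_simps)
      qed
      then have "norm g * s \<le> norm g * B" by (simp add: mult_left_mono)
      moreover have "0 \<le> q y" using \<alpha> by (simp add: q_def)
      ultimately show ?thesis
        using t gy gyx \<open>s \<le> B\<close> unfolding T_def s_def by (simp add: dist_norm norm_minus_commute) linarith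
    qed
    then have "K \<subseteq> cball x B \<times> {- T..T}" by auto
    then show ?thesis by (rule bounded_subset[rotated]) (auto intro: bounded_Times)
  qed
  ultimately have compact: "compact K" by (simp add: compact_eq_bounded_closed)
  have "(y0, t0) \<in> K" by (simp add: K_def ereal_epigraph_def t0 H_def)
  then have ne: "K \<noteq> {}" by (metis empty_iff)
  have "\<exists>u\<in>K. \<forall>w\<in>K. h u \<le> h w"
    by (rule continuous_attains_inf[OF compact ne continuous_on_subset[OF conth subset_UNIV]])
  then obtain u where u: "u \<in> K" "\<And>w. w \<in> K \<Longrightarrow> h u \<le> h w" by (elim bexE) simp
  obtain z tz where "u = (z, tz)" by (cases u)
  with u have z: "(z, tz) \<in> K" and zmin: "\<And>w. w \<in> K \<Longrightarrow> h (z, tz) \<le> h w" by simp_all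
  have pz: "p z \<le> ereal tz" using z by (simp add: K_def ereal_epigraph_def)
  have min: "prox_objective M \<alpha> p x z \<le> prox_objective M \<alpha> p x y" for y
  proof (cases "p y")
    case (real b)
    have "h (z, tz) \<le> h (y, b)"
    proof (cases "h (y, b) \<le> H")
      case True
      then show ?thesis using real by (intro zmin) (simp add: K_def ereal_epigraph_def)
    next
      case False
      then show ?thesis using z by (simp add: K_def)
    qed
    then have "ereal tz + ereal (q z) \<le> ereal b + ereal (q y)" by (simp add: h_def)
    moreover have "p z + ereal (q z) \<le> ereal tz + ereal (q z)" using pz by (rule add_right_mono)
    ultimately show ?thesis unfolding prox_objective_def q_def[symmetric] real by (rule order_trans[rotated])
  qed (use pmin in \<open>auto simp: prox_objective_def\<close>)
  have "z \<in> prox M \<alpha> p x"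
    using min by (auto simp: prox_def argmin_def is_arg_min_def not_less)
  moreover have "\<bar>p z\<bar> \<noteq> \<infinity>" using pz pmin[of z] by auto
  ultimately show ?thesis by (intro bexI[of _ z])
qed

text \<open>
  Criteria on the objective gap and on the subgradient are reduced to the criterion on the distance
  by strong convexity of the proximal objective.
\<close>

lemma inexact_step_near_prox:
  fixes p :: "'a::euclidean_space \<Rightarrow> ereal"
  assumes p: "convex_fun p" "proper p" "closed_fun p" and minorant: "\<And>y. ereal (c + g \<bullet> y) \<le> p y"
    and M: "spd M" and L: "0 < L" "\<And>v. norm v \<le> L * wnorm M v" and \<alpha>: "0 < \<alpha>" and \<epsilon>: "0 \<le> \<epsilon>"
    and step: "inexact_step M 0 \<alpha> \<epsilon> p x x'"
  shows "\<exists>z\<in>prox M \<alpha> p x. \<bar>p z\<bar> \<noteq> \<infinity> \<and> wnorm M (x' - z) \<le> \<epsilon>"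
proof -
  define q where "q y = 1 / (2 * \<alpha>) * (wnorm M (y - x))\<^sup>2" for y
  have obj: "prox_objective M \<alpha> p x y = p y + ereal (q y)" for y
    by (simp add: prox_objective_def q_def)
  have pmin: "p y \<noteq> -\<infinity>" for y using p(2) by (simp add: proper_def)
  obtain z where z: "z \<in> prox M \<alpha> p x" "\<bar>p z\<bar> \<noteq> \<infinity>"
    by (rule bexE[OF prox_exists[OF p(2,3) minorant M L \<alpha>, of x]])
  then obtain a where a: "p z = ereal a" by auto
  have zmin: "prox_objective M \<alpha> p x z' \<le> prox_objective M \<alpha> p x y" if "z' \<in> prox M \<alpha> p x" for y z'
    using that by (auto simp: prox_def argmin_def is_arg_min_def not_less)
  \<comment> \<open>quadratic growth of the proximal objective at its minimizer\<close>
  have growth: "a + q z + 1 / (2 * \<alpha>) * (wnorm M (x' - z))\<^sup>2 \<le> b + q x'" if "p x' = ereal b" for b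
    using prox_strong_ineq[OF p(1) M \<alpha> z(1) a, of x' b] that by (simp add: q_def)
  consider z' where "z' \<in> prox M \<alpha> p x" "wnorm M (x' - z') \<le> \<epsilon>"
    | "prox_objective M \<alpha> p x x' - (INF y. prox_objective M \<alpha> p x y) \<le> ereal (1 / (2 * \<alpha>) * \<epsilon>\<^sup>2)"
    | "wdist (inv M) 0 (subdifferential (prox_objective M \<alpha> p x) x') \<le> ereal (1 / \<alpha> * \<epsilon>)"
    using step unfolding inexact_step_def by auto
  then show ?thesis
  proof cases
    case 1
    have "prox_objective M \<alpha> p x z' \<le> prox_objective M \<alpha> p x z" by (rule zmin[OF 1(1)])
    then have "\<bar>p z'\<bar> \<noteq> \<infinity>" using pmin[of z'] by (auto simp: obj a)
    then show ?thesis using 1 by (intro bexI[of _ z'] conjI)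
  next
    case 2
    have inf: "(INF y. prox_objective M \<alpha> p x y) = ereal (a + q z)"
    proof (rule antisym)
      show "(INF y. prox_objective M \<alpha> p x y) \<le> ereal (a + q z)"
        by (rule INF_lower2[of z]) (auto simp: obj a)
      show "ereal (a + q z) \<le> (INF y. prox_objective M \<alpha> p x y)"
        using zmin[OF z(1)] by (intro INF_greatest) (simp add: obj a)
    qed
    then obtain b where b: "p x' = ereal b" using 2 pmin[of x'] by (cases "p x'") (auto simp: obj)
    have "ereal b + ereal (q x') - ereal (a + q z) \<le> ereal (1 / (2 * \<alpha>) * \<epsilon>\<^sup>2)"
      using 2[unfolded inf] unfolding obj b .
    then have "b + q x' - (a + q z) \<le> 1 / (2 * \<alpha>) * \<epsilon>\<^sup>2"
      unfolding plus_ereal.simps ereal_minus ereal_less_eq .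
    with growth[OF b] have "1 / (2 * \<alpha>) * (wnorm M (x' - z))\<^sup>2 \<le> 1 / (2 * \<alpha>) * \<epsilon>\<^sup>2" by linarith
    then have "(wnorm M (x' - z))\<^sup>2 \<le> \<epsilon>\<^sup>2" by (rule mult_left_le_imp_le) (use \<alpha> in simp)
    then have "wnorm M (x' - z) \<le> \<epsilon>" using \<epsilon> by (rule power2_le_imp_le)
    then show ?thesis using z by (intro bexI[of _ z] conjI)
  next
    case 3
    have "wnorm M (x' - z) \<le> \<epsilon>"
    proof (rule field_le_epsilon)
      \<comment> \<open>The distance to the subdifferential need not be attained, hence the margin \<open>e\<close>.\<close>
      fix e :: real assume e: "0 < e"
      have "wdist (inv M) 0 (subdifferential (prox_objective M \<alpha> p x) x') < ereal ((\<epsilon> + e) / \<alpha>)"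
      proof (rule le_less_trans[OF 3])
        have "1 / \<alpha> * \<epsilon> < (\<epsilon> + e) / \<alpha>" using e \<alpha> by (simp add: divide_strict_right_mono)
        then show "ereal (1 / \<alpha> * \<epsilon>) < ereal ((\<epsilon> + e) / \<alpha>)" by simp
      qed
      then obtain v where v: "v \<in> subdifferential (prox_objective M \<alpha> p x) x'"
          "wnorm (inv M) (0 - v) < (\<epsilon> + e) / \<alpha>"
        unfolding wdist_def INF_less_iff by auto
      have "inj M" unfolding linear_injective_0[OF spd_linear[OF M]]
      proof (intro allI impI)
        fix u assume "M u = 0"
        then have "\<not> 0 < u \<bullet> M u" by simp
        moreover have "u \<noteq> 0 \<Longrightarrow> 0 < u \<bullet> M u" using M by (simp add: spd_def)
        ultimately show "u = 0" by argo
      qed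
      then have "surj M" using linear_injective_imp_surjective[OF spd_linear[OF M]] by blast
      then obtain w where w: "v = M w" by auto
      have "inv M (- v) = - w"
        using \<open>inj M\<close> unfolding w linear_neg[OF spd_linear[OF M], symmetric] by (rule inv_f_f)
      then have "wnorm (inv M) (0 - v) = wnorm M w"
        unfolding wnorm_def by (simp add: w inner_commute)
      then have "wnorm M w \<le> (\<epsilon> + e) / \<alpha>" using v by simp
      have "\<bar>p x' + ereal (q x')\<bar> \<noteq> \<infinity>" using v(1) by (simp add: subdifferential_def obj)
      then obtain b where b: "p x' = ereal b" by (cases "p x'") auto
      have "b + q x' + v \<bullet> (z - x') + 1 / (2 * \<alpha>) * (wnorm M (z - x'))\<^sup>2 \<le> a + q z"
        using subdifferential_strong_convex_ineq[OF p(1) M, of "1 / (2 * \<alpha>)" v x x' b z a] v(1) \<alpha> b a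
        by (simp add: prox_objective_def[abs_def] q_def)
      moreover have sym: "wnorm M (z - x') = wnorm M (x' - z)" by (rule wnorm_minus_commute[OF M])
      moreover have "v \<bullet> (z - x') = - (v \<bullet> (x' - z))" by (simp add: inner_diff_right)
      moreover have "1 / \<alpha> * (wnorm M (x' - z))\<^sup>2
          = 1 / (2 * \<alpha>) * (wnorm M (x' - z))\<^sup>2 + 1 / (2 * \<alpha>) * (wnorm M (x' - z))\<^sup>2"
        using \<alpha> by (simp add: field_simps)
      ultimately have "1 / \<alpha> * (wnorm M (x' - z))\<^sup>2 \<le> v \<bullet> (x' - z)"
        using growth[OF b] unfolding sym by linarith
      also have "v \<bullet> (x' - z) \<le> (\<alpha> * (wnorm M w)\<^sup>2 + (wnorm M (x' - z))\<^sup>2 / \<alpha>) / 2"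
        using spd_young[OF M \<alpha>, of w "x' - z"] spd_sym[OF M, of w "x' - z"]
        by (simp add: wnorm_sq[OF M] w inner_commute)
      finally have half: "(wnorm M (x' - z))\<^sup>2 / \<alpha>
          \<le> (\<alpha> * (wnorm M w)\<^sup>2 + (wnorm M (x' - z))\<^sup>2 / \<alpha>) / 2"
        unfolding times_divide_eq_left mult_1_left .
      have "s \<le> t" if "s \<le> (t + s) / 2" for s t :: real using that by simp
      from this[OF half] have "(wnorm M (x' - z))\<^sup>2 / \<alpha> \<le> \<alpha> * (wnorm M w)\<^sup>2" .
      then have "(wnorm M (x' - z))\<^sup>2 \<le> \<alpha> * (wnorm M w)\<^sup>2 * \<alpha>"
        unfolding pos_divide_le_eq[OF \<alpha>] .
      also have "\<dots> = (\<alpha> * wnorm M w)\<^sup>2" by (simp only: power_mult_distrib power2_eq_square mult_ac)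
      finally have "wnorm M (x' - z) \<le> \<alpha> * wnorm M w"
        by (rule power2_le_imp_le) (use \<alpha> wnorm_nonneg[OF M, of w] in simp)
      also have "\<dots> \<le> \<epsilon> + e"
        using \<open>wnorm M w \<le> (\<epsilon> + e) / \<alpha>\<close> unfolding pos_le_divide_eq[OF \<alpha>]
        by (simp only: mult.commute)
      finally show "wnorm M (x' - z) \<le> \<epsilon> + e" .
    qed
    then show ?thesis using z by (intro bexI[of _ z] conjI)
  qed
qed

section \<open>Minibatch objectives of exact convex models\<close>

text \<open>
  What almost every sample provides when the models are exact and convex.
\<close>

definition exact_convex_sample ::
  "('a::euclidean_space \<Rightarrow> 's \<Rightarrow> ereal) \<Rightarrow> ('a \<Rightarrow> ereal) \<Rightarrow> 'a set \<Rightarrow> ('a \<Rightarrow> 'a \<Rightarrow> 's \<Rightarrow> real) \<Rightarrow> 's \<Rightarrow> bool"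
where
  "exact_convex_sample f r V fm s \<longleftrightarrow>
     (\<forall>x\<in>V. \<forall>y\<in>V. ereal (fm x y s) = f y s) \<and>
     proper (\<lambda>x. f x s) \<and> closed_fun (\<lambda>x. f x s) \<and>
     (\<forall>x\<in>V. convex_fun (model_objective fm r x s))"

lemma AE_exact_convex_sample:
  assumes "model_accuracy P f V fm 0" "regularity P f r V fm 0"
  shows "AE s in P. exact_convex_sample f r V fm s"
proof -
  have "AE s in P. \<forall>x\<in>V. \<forall>y\<in>V. ereal (fm x x s) = f x s \<and>
        \<bar>ereal (fm x y s) - f y s\<bar> \<le> ereal (0 / 2 * (norm (y - x))\<^sup>2)"
    using assms(1) unfolding model_accuracy_def .
  moreover have "AE s in P.
        proper (\<lambda>x. f x s) \<and> closed_fun (\<lambda>x. f x s) \<and> effdom r \<subseteq> effdom (\<lambda>x. f x s) \<and>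
        (\<forall>x\<in>V. weakly_convex 0 (model_objective fm r x s))"
    using assms(2) unfolding regularity_def by (elim conjE)
  ultimately show ?thesis
  proof eventually_elim
    case (elim s)
    have eq: "ereal (fm x y s) = f y s" if "x \<in> V" "y \<in> V" for x y
    proof -
      have "\<bar>ereal (fm x y s) - f y s\<bar> \<le> 0" using elim(1) that by (simp add: zero_ereal_def)
      then show ?thesis by (cases "f y s") (auto simp: zero_ereal_def)
    qed
    have "convex_fun (model_objective fm r x s)" if "x \<in> V" for x
      using elim(2) that by (simp add: weakly_convex_def zero_ereal_def[symmetric])
    with eq elim(2) show ?case by (simp add: exact_convex_sample_def)
  qed
qed

text \<open>
  Off \<open>V\<close> the model has arbitrary values, but there \<open>r\<close> is infinite, and \<open>f\<close> never takes the value
  \<open>-\<infinity>\<close>.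
\<close>

lemma sample_objective_eq_model_objective:
  assumes "exact_convex_sample f r V fm s" "effdom r \<subseteq> V" "x \<in> V"
  shows "sample_objective f r s = model_objective fm r x s"
proof
  fix y
  show "sample_objective f r s y = model_objective fm r x s y"
  proof (cases "y \<in> V")
    case True
    then show ?thesis using assms by (simp add: exact_convex_sample_def sample_objective_def model_objective_def)
  next
    case False
    then have "r y = \<infinity>" using assms(2) by (auto simp: effdom_def)
    moreover have "f y s \<noteq> -\<infinity>" using assms(1) by (simp add: exact_convex_sample_def proper_def)
    ultimately show ?thesis by (simp add: sample_objective_def model_objective_def)
  qed
qed

lemma effdom_real:
  assumes "proper r" "y \<in> effdom r" shows "r y = ereal (real_of_ereal (r y))"
  using assms by (cases "r y") (auto simp: proper_def effdom_def)

lemma sample_subgradient_ineq: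
  assumes good: "exact_convex_sample f r V fm s" and V: "effdom r \<subseteq> V" "x \<in> V" and r: "proper r"
    and g: "g \<in> subdifferential (sample_objective f r s) xs"
    and xs: "xs \<in> effdom r" and y: "y \<in> effdom r"
  shows "fm x xs s + real_of_ereal (r xs) + g \<bullet> (y - xs) \<le> fm x y s + real_of_ereal (r y)"
proof -
  have M: "spd (\<lambda>x::'a. x)"
    by (auto simp: spd_def linear_id[unfolded id_def] adjoint_unique)
  have conv: "convex_fun (model_objective fm r x s)"
    using good V(2) by (simp add: exact_convex_sample_def)
  have g': "g \<in> subdifferential (\<lambda>y. model_objective fm r x s y + ereal (0 * (wnorm (\<lambda>x. x) (y - xs))\<^sup>2)) xs"
    using g unfolding sample_objective_eq_model_objective[OF good V] by (simp add: zero_ereal_def[symmetric])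
  have val: "model_objective fm r x s u = ereal (fm x u s + real_of_ereal (r u))" if "u \<in> effdom r" for u
    by (subst model_objective_def, subst effdom_real[OF r that]) simp
  show ?thesis
    using subdifferential_strong_convex_ineq[OF conv M _ g' val[OF xs], of y] val[OF y] by simp
qed

lemma closed_funD_less:
  assumes "closed_fun p" "ereal c < p y" "u \<longlonglongrightarrow> y"
  shows "eventually (\<lambda>n. ereal c < p (u n)) sequentially"
proof -
  have "open (- ereal_epigraph p)" "(y, c) \<in> - ereal_epigraph p"
    using assms by (auto simp: closed_fun_def ereal_epigraph_def)
  moreover have "(\<lambda>n. (u n, c)) \<longlonglongrightarrow> (y, c)" using assms(3) by (intro tendsto_intros)
  ultimately have "eventually (\<lambda>n. (u n, c) \<in> - ereal_epigraph p) sequentially"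
    by (rule topological_tendstoD[rotated])
  then show ?thesis by eventually_elim (simp add: ereal_epigraph_def)
qed

context
  fixes f :: "'a::euclidean_space \<Rightarrow> 's \<Rightarrow> ereal" and r :: "'a \<Rightarrow> ereal"
    and V :: "'a set" and fm :: "'a \<Rightarrow> 'a \<Rightarrow> 's \<Rightarrow> real" and m :: nat and s :: "nat \<Rightarrow> 's" and x :: 'a
  assumes m: "0 < m" and good: "\<And>i. i \<in> {1..m} \<Longrightarrow> exact_convex_sample f r V fm (s i)"
    and V: "effdom r \<subseteq> V" "x \<in> V" and r: "proper r" "closed_fun r"
begin

abbreviation "batch y \<equiv> 1 / real m * (\<Sum>i=1..m. fm x y (s i))"

lemma sum_batch: "(\<Sum>i=1..m. fm x y (s i) + c) = real m * (batch y + c)"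
  using m by (simp add: sum.distrib distrib_left)

lemma minibatch_objective_real:
  "y \<in> effdom r \<Longrightarrow> minibatch_objective fm r m x s y = ereal (batch y + real_of_ereal (r y))"
  by (subst minibatch_objective_def, subst effdom_real[OF r(1)]) auto

lemma minibatch_effdom: "minibatch_objective fm r m x s y \<le> ereal a \<Longrightarrow> y \<in> effdom r"
  by (cases "r y") (auto simp: minibatch_objective_def effdom_def)

lemma minibatch_objective_proper: "proper (minibatch_objective fm r m x s)"
proof -
  obtain y where "y \<in> effdom r" using r by (auto simp: proper_def)
  then have "minibatch_objective fm r m x s y < \<infinity>" by (simp add: minibatch_objective_real)
  then show ?thesis using r by (auto simp: proper_def effdom_def minibatch_objective_def)
qed

lemma minibatch_objective_convex: "convex_fun (minibatch_objective fm r m x s)"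
  unfolding convex_fun_def
proof (rule convexI)
  fix u v :: "'a \<times> real" and t t' :: real
  assume uv: "u \<in> ereal_epigraph (minibatch_objective fm r m x s)"
    "v \<in> ereal_epigraph (minibatch_objective fm r m x s)" and t: "0 \<le> t'" "0 \<le> t" "t' + t = 1"
  obtain y a z b where u: "u = (y, a)" and v: "v = (z, b)" by (cases u, cases v)
  have t': "t' = 1 - t" "t \<le> 1" using t by auto
  have epi: "minibatch_objective fm r m x s y \<le> ereal a" "minibatch_objective fm r m x s z \<le> ereal b"
    using uv by (auto simp: u v ereal_epigraph_def)
  have dom: "y \<in> effdom r" "z \<in> effdom r" using epi by (auto intro: minibatch_effdom)
  let ?R = "\<lambda>y. real_of_ereal (r y)"
  define w where "w = (1 - t) *\<^sub>R y + t *\<^sub>R z"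
  have le: "model_objective fm r x (s i) w \<le> ereal ((1 - t) * (fm x y (s i) + ?R y) + t * (fm x z (s i) + ?R z))"
    if "i \<in> {1..m}" for i
  proof -
    have val: "model_objective fm r x (s i) u = ereal (fm x u (s i) + ?R u)" if "u \<in> effdom r" for u
      by (subst model_objective_def, subst effdom_real[OF r(1) that]) simp
    show ?thesis unfolding w_def
      using good[OF that] V(2) t t' val[OF dom(1)] val[OF dom(2)]
      by (intro convex_funD) (auto simp: exact_convex_sample_def)
  qed
  have "r w \<noteq> \<infinity>" using le[of 1] m by (auto simp: model_objective_def)
  then have wdom: "w \<in> effdom r" by (auto simp: effdom_def)
  have "fm x w (s i) + ?R w \<le> (1 - t) * (fm x y (s i) + ?R y) + t * (fm x z (s i) + ?R z)"
    if "i \<in> {1..m}" for i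
  proof -
    have "model_objective fm r x (s i) w = ereal (fm x w (s i) + ?R w)"
      by (subst model_objective_def, subst effdom_real[OF r(1) wdom]) simp
    then show ?thesis using le[OF that] by simp
  qed
  then have "(\<Sum>i=1..m. fm x w (s i) + ?R w)
      \<le> (\<Sum>i=1..m. (1 - t) * (fm x y (s i) + ?R y) + t * (fm x z (s i) + ?R z))"
    by (rule sum_mono)
  also have "\<dots> = (1 - t) * (\<Sum>i=1..m. fm x y (s i) + ?R y) + t * (\<Sum>i=1..m. fm x z (s i) + ?R z)"
    by (subst sum.distrib) (simp only: sum_distrib_left)
  finally have "real m * (batch w + ?R w) \<le> real m * ((1 - t) * (batch y + ?R y) + t * (batch z + ?R z))"
    unfolding sum_batch by (simp only: distrib_left mult.left_commute)
  then have "batch w + ?R w \<le> (1 - t) * (batch y + ?R y) + t * (batch z + ?R z)"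
    by (rule mult_left_le_imp_le) (use m in simp)
  also have "\<dots> \<le> (1 - t) * a + t * b"
    using epi t t' unfolding minibatch_objective_real[OF dom(1)] minibatch_objective_real[OF dom(2)]
    by (intro add_mono mult_left_mono) auto
  finally show "t' *\<^sub>R u + t *\<^sub>R v \<in> ereal_epigraph (minibatch_objective fm r m x s)"
    using minibatch_objective_real[OF wdom] by (simp add: u v ereal_epigraph_def t'(1) w_def)
qed

text \<open>
  Lower semicontinuity of a sum: numbers strictly below the summands at the limit point stay below the
  summands nearby. For a point outside the domain of \<open>r\<close> the number below \<open>r\<close> may be taken so large that the sum
  exceeds the height \<open>t\<close>, whatever lies below the sample functions.
\<close>

lemma minibatch_objective_closed: "closed_fun (minibatch_objective fm r m x s)"
  unfolding closed_fun_def closed_sequential_limits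
proof (intro allI impI)
  fix U l assume U: "(\<forall>n. U n \<in> ereal_epigraph (minibatch_objective fm r m x s)) \<and> U \<longlonglongrightarrow> l"
  obtain y t where l: "l = (y, t)" by (cases l)
  define u v where "u n = fst (U n)" and "v n = snd (U n)" for n
  have u: "u \<longlonglongrightarrow> y" and v: "v \<longlonglongrightarrow> t"
    using U l tendsto_fst[of U "(y, t)"] tendsto_snd[of U "(y, t)"] by (simp_all add: u_def[abs_def] v_def[abs_def])
  have epi: "minibatch_objective fm r m x s (u n) \<le> ereal (v n)" for n
    using U by (auto simp: ereal_epigraph_def u_def v_def split: prod.splits)
  have le: "1 / real m * (\<Sum>i=1..m. c i) + d \<le> t"
    if c: "\<And>i. i \<in> {1..m} \<Longrightarrow> ereal (c i) < f y (s i)" and d: "ereal d < r y" for c d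
  proof (rule tendsto_lowerbound[OF v])
    have "eventually (\<lambda>n. \<forall>i\<in>{1..m}. ereal (c i) < f (u n) (s i)) sequentially"
    proof (rule eventually_ball_finite, simp, rule ballI)
      fix i assume i: "i \<in> {1..m}"
      show "eventually (\<lambda>n. ereal (c i) < f (u n) (s i)) sequentially"
        using good[OF i] by (intro closed_funD_less[where p="\<lambda>x. f x (s i)", OF _ c[OF i] u]) (simp add: exact_convex_sample_def)
    qed
    moreover have "eventually (\<lambda>n. ereal d < r (u n)) sequentially"
      by (rule closed_funD_less[OF r(2) d u])
    ultimately show "eventually (\<lambda>n. 1 / real m * (\<Sum>i=1..m. c i) + d \<le> v n) sequentially"
    proof eventually_elim
      case (elim n)
      have dom: "u n \<in> effdom r" by (rule minibatch_effdom[OF epi])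
      have "c i \<le> fm x (u n) (s i)" if "i \<in> {1..m}" for i
      proof -
        have "f (u n) (s i) = ereal (fm x (u n) (s i))"
          using good[OF that] dom V by (auto simp: exact_convex_sample_def)
        then show ?thesis using elim(1) that by fastforce
      qed
      then have "(\<Sum>i=1..m. c i) \<le> (\<Sum>i=1..m. fm x (u n) (s i))" by (rule sum_mono)
      then have "1 / real m * (\<Sum>i=1..m. c i) \<le> batch (u n)" by (intro mult_left_mono) auto
      moreover have "d \<le> real_of_ereal (r (u n))"
        using elim(2) by (subst (asm) effdom_real[OF r(1) dom]) simp
      ultimately show ?case
        using epi[of n] unfolding minibatch_objective_real[OF dom] by simp
    qed
  qed simp
  show "l \<in> ereal_epigraph (minibatch_objective fm r m x s)"
  proof (cases "y \<in> effdom r")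
    case True
    have "batch y + real_of_ereal (r y) \<le> t"
    proof (rule field_le_epsilon)
      fix e :: real assume e: "0 < e"
      have "1 / real m * (\<Sum>i=1..m. fm x y (s i) + (- e / 2)) + (real_of_ereal (r y) - e / 2) \<le> t"
      proof (rule le)
        fix i assume "i \<in> {1..m}"
        then have "f y (s i) = ereal (fm x y (s i))"
          using good True V by (auto simp: exact_convex_sample_def)
        then show "ereal (fm x y (s i) + (- e / 2)) < f y (s i)" using e by simp
      next
        show "ereal (real_of_ereal (r y) - e / 2) < r y"
          using e by (subst (2) effdom_real[OF r(1) True]) simp
      qed
      then show "batch y + real_of_ereal (r y) \<le> t + e"
        unfolding sum_batch using m by simp
    qed
    then show ?thesis by (simp add: l ereal_epigraph_def minibatch_objective_real[OF True])
  next
    case False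
    then have ry: "r y = \<infinity>" by (auto simp: effdom_def)
    have "\<exists>c. ereal c < f y (s i)" if "i \<in> {1..m}" for i
    proof -
      have "f y (s i) \<noteq> -\<infinity>" using good[OF that] by (simp add: exact_convex_sample_def proper_def)
      then have "-\<infinity> < f y (s i)" by simp
      from ereal_dense2[OF this] show ?thesis by blast
    qed
    then obtain c where c: "\<And>i. i \<in> {1..m} \<Longrightarrow> ereal (c i) < f y (s i)" by metis
    have "1 / real m * (\<Sum>i=1..m. c i) + (t + 1 - 1 / real m * (\<Sum>i=1..m. c i)) \<le> t"
      by (rule le) (use c ry in auto)
    then show ?thesis by simp
  qed
qed

lemma minibatch_subgradient_ineq:
  assumes g: "\<And>i. i \<in> {1..m} \<Longrightarrow> g i \<in> subdifferential (sample_objective f r (s i)) xs"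
    and xs: "xs \<in> effdom r" and y: "y \<in> effdom r"
  shows "batch xs + real_of_ereal (r xs) + (1 / real m) *\<^sub>R (\<Sum>i=1..m. g i) \<bullet> (y - xs)
    \<le> batch y + real_of_ereal (r y)"
proof -
  have "(\<Sum>i=1..m. fm x xs (s i) + real_of_ereal (r xs) + g i \<bullet> (y - xs))
      \<le> (\<Sum>i=1..m. fm x y (s i) + real_of_ereal (r y))"
    by (intro sum_mono sample_subgradient_ineq[OF good V r(1)] g xs y)
  then have "real m * (batch xs + real_of_ereal (r xs)) + (\<Sum>i=1..m. g i) \<bullet> (y - xs)
    \<le> real m * (batch y + real_of_ereal (r y))"
    unfolding sum_batch[symmetric] inner_sum_left sum.distrib[symmetric] .
  then have "real m * (batch xs + real_of_ereal (r xs) + (1 / real m) *\<^sub>R (\<Sum>i=1..m. g i) \<bullet> (y - xs))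
    \<le> real m * (batch y + real_of_ereal (r y))"
    using m by (simp add: distrib_left)
  then show ?thesis by (rule mult_left_le_imp_le) (use m in simp)
qed

text \<open>
  The subgradients at \<open>x0\<close> serve only to bound the minibatch objective below by an affine function, from
  which the proximal point exists; the resulting inequality then holds for every point \<open>xs\<close> of the domain.
\<close>

lemma minibatch_step:
  assumes g: "\<And>i. i \<in> {1..m} \<Longrightarrow> g i \<in> subdifferential (sample_objective f r (s i)) x0"
    and x0: "x0 \<in> effdom r"
    and M: "spd M" and L: "0 < L" "\<And>v. norm v \<le> L * wnorm M v" and \<alpha>: "0 < \<alpha>" and \<epsilon>: "0 \<le> \<epsilon>"
    and step: "inexact_step M 0 \<alpha> \<epsilon> (minibatch_objective fm r m x s) x x'"
  shows "\<exists>z\<in>effdom r. wnorm M (x' - z) \<le> \<epsilon> \<and>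
    (\<forall>xs\<in>effdom r. (wnorm M (z - xs))\<^sup>2 \<le> (wnorm M (x - xs))\<^sup>2 - (wnorm M (z - x))\<^sup>2
       + 2 * \<alpha> * (batch xs + real_of_ereal (r xs) - (batch z + real_of_ereal (r z))))"
proof -
  define h where "h = (1 / real m) *\<^sub>R (\<Sum>i=1..m. g i)"
  have minorant: "ereal (batch x0 + real_of_ereal (r x0) - h \<bullet> x0 + h \<bullet> y) \<le> minibatch_objective fm r m x s y" for y
  proof (cases "y \<in> effdom r")
    case True
    show ?thesis
      using minibatch_subgradient_ineq[OF g x0 True] unfolding minibatch_objective_real[OF True] h_def[symmetric]
      by (simp add: inner_diff_right algebra_simps)
  next
    case False
    then show ?thesis by (simp add: effdom_def minibatch_objective_def)
  qed
  obtain z where z: "z \<in> prox M \<alpha> (minibatch_objective fm r m x s) x"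
      "\<bar>minibatch_objective fm r m x s z\<bar> \<noteq> \<infinity>" "wnorm M (x' - z) \<le> \<epsilon>"
    using inexact_step_near_prox[OF minibatch_objective_convex minibatch_objective_proper
        minibatch_objective_closed minorant M L \<alpha> \<epsilon> step] by (elim bexE conjE)
  then have zdom: "z \<in> effdom r"
    using minibatch_effdom[of z "real_of_ereal (minibatch_objective fm r m x s z)"] by (simp add: ereal_real)
  have "(wnorm M (z - xs))\<^sup>2 \<le> (wnorm M (x - xs))\<^sup>2 - (wnorm M (z - x))\<^sup>2
       + 2 * \<alpha> * (batch xs + real_of_ereal (r xs) - (batch z + real_of_ereal (r z)))"
    if xs: "xs \<in> effdom r" for xs
  proof -
    let ?c = "1 / (2 * \<alpha>)"
    have "batch z + real_of_ereal (r z) + ?c * (wnorm M (z - x))\<^sup>2 + ?c * (wnorm M (xs - z))\<^sup>2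
        \<le> batch xs + real_of_ereal (r xs) + ?c * (wnorm M (xs - x))\<^sup>2"
      using prox_strong_ineq[OF minibatch_objective_convex M \<alpha> z(1) minibatch_objective_real[OF zdom], of xs]
        minibatch_objective_real[OF xs] by simp
    then have le: "2 * \<alpha> * (batch z + real_of_ereal (r z) + ?c * (wnorm M (z - x))\<^sup>2 + ?c * (wnorm M (xs - z))\<^sup>2)
        \<le> 2 * \<alpha> * (batch xs + real_of_ereal (r xs) + ?c * (wnorm M (xs - x))\<^sup>2)"
      using \<alpha> by (intro mult_left_mono) auto
    have scale: "2 * \<alpha> * (A + ?c * t) = 2 * \<alpha> * A + t" "2 * \<alpha> * (A - B) = 2 * \<alpha> * A - 2 * \<alpha> * B" for A B t
      using \<alpha> by (simp_all add: distrib_left right_diff_distrib)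
    show ?thesis
      using le unfolding wnorm_minus_commute[OF M, of xs z] wnorm_minus_commute[OF M, of xs x] scale by linarith
  qed
  then show ?thesis using zdom z(3) by (intro bexI[of _ z] conjI ballI)
qed

end

section \<open>Integrating out the next sample\<close>

lemma space_sample_filtration [simp]: "space (sample_filtration \<Omega> P m S k) = space \<Omega>"
  unfolding sample_filtration_def by (rule space_measure_of) auto

lemma sets_sample_filtration:
  "sets (sample_filtration \<Omega> P m S k) = sigma_sets (space \<Omega>)
    {S j i -` A \<inter> space \<Omega> | j i A. j \<in> {1..k} \<and> i \<in> {1..m} \<and> A \<in> sets P}"
  unfolding sample_filtration_def by (rule sets_measure_of) auto

lemma sample_filtration_mono:
  "k \<le> l \<Longrightarrow> sets (sample_filtration \<Omega> P m S k) \<subseteq> sets (sample_filtration \<Omega> P m S l)"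
  unfolding sets_sample_filtration by (rule sigma_sets_mono') fastforce

lemma iid_samples_measurable:
  assumes "prob_space \<Omega>" "iid_samples \<Omega> P m S" "1 \<le> k" "i \<in> {1..m}"
  shows "S k i \<in> measurable \<Omega> P"
proof -
  interpret prob_space \<Omega> by fact
  have "indep_vars (\<lambda>_. P) (\<lambda>(k, i). S k i) ({1..} \<times> {1..m})"
    using assms(2) by (simp add: iid_samples_def)
  then have "\<forall>p\<in>{1..} \<times> {1..m}. (\<lambda>(k, i). S k i) p \<in> measurable \<Omega> P"
    unfolding indep_vars_def by blast
  then show ?thesis using assms(3,4) by auto
qed

lemma sample_filtration_subalgebra:
  assumes "prob_space \<Omega>" "iid_samples \<Omega> P m S"
  shows "subalgebra \<Omega> (sample_filtration \<Omega> P m S k)"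
  unfolding subalgebra_def sets_sample_filtration
  using measurable_sets[OF iid_samples_measurable[OF assms]]
  by (auto intro!: sets.sigma_sets_subset)

lemma indep_filtration_sample:
  assumes "prob_space \<Omega>" "iid_samples \<Omega> P m S" "l < k" "i \<in> {1..m}"
  shows "prob_space.indep_set \<Omega> (sets (sample_filtration \<Omega> P m S l)) {S k i -` A \<inter> space \<Omega> | A. A \<in> sets P}"
proof -
  interpret prob_space \<Omega> by fact
  let ?X = "\<lambda>(k, i). S k i"
  define E where "E p = {?X p -` A \<inter> space \<Omega> | A. A \<in> sets P}" for p
  define I where "I b = (if b then {1..l} \<times> {1..m} else {(k, i)})" for b
  have k: "1 \<le> k" using assms(3) by simp
  have rv: "S k i \<in> measurable \<Omega> P" by (rule iid_samples_measurable[OF assms(1,2) k assms(4)])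
  have stable: "Int_stable (E p)" for p
    unfolding Int_stable_def E_def
  proof safe
    fix A B assume "A \<in> sets P" "B \<in> sets P"
    then show "\<exists>C. ?X p -` A \<inter> space \<Omega> \<inter> (?X p -` B \<inter> space \<Omega>) = ?X p -` C \<inter> space \<Omega> \<and> C \<in> sets P"
      by (intro exI[of _ "A \<inter> B"]) auto
  qed
  have "indep_sets E ({1..} \<times> {1..m})"
    using assms(2) unfolding iid_samples_def indep_vars_def2 E_def by blast
  then have "indep_sets E (\<Union>b\<in>UNIV. I b)"
    using assms(3,4) by (elim indep_sets_mono_index[rotated]) (auto simp: I_def split: if_splits)
  then have "indep_sets (\<lambda>b. sigma_sets (space \<Omega>) (\<Union>p\<in>I b. E p)) UNIV"
    using assms(3) by (intro indep_sets_collect_sigma stable) (auto simp: I_def disjoint_family_on_def)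
  then have "indep_set (sigma_sets (space \<Omega>) (\<Union>p\<in>I True. E p)) (sigma_sets (space \<Omega>) (\<Union>p\<in>I False. E p))"
    unfolding indep_set_def
    by (rule indep_sets_mono_sets) (auto split: bool.splits)
  moreover have "(\<Union>p\<in>I True. E p) = {S j i -` A \<inter> space \<Omega> | j i A. j \<in> {1..l} \<and> i \<in> {1..m} \<and> A \<in> sets P}"
    unfolding I_def E_def by fastforce
  moreover have "(\<Union>p\<in>I False. E p) = {S k i -` A \<inter> space \<Omega> |A. A \<in> sets P}"
    by (simp add: I_def E_def)
  ultimately have "indep_set (sets (sample_filtration \<Omega> P m S l))
      (sigma_sets (space \<Omega>) {S k i -` A \<inter> space \<Omega> |A. A \<in> sets P})"
    unfolding sets_sample_filtration by simp
  then show ?thesis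
    unfolding indep_set_def by (rule indep_sets_mono_sets) (auto split: bool.splits)
qed

text \<open>
  Independence makes the joint law of the past and a later sample a product, so that Fubini's theorem
  integrates out the sample with the past frozen. The past is represented by the outcome itself, regarded as a
  random variable into the outcome space with the smaller \<open>\<sigma>\<close>-algebra.
\<close>

lemma integral_freeze_past:
  fixes H :: "'w \<times> 's \<Rightarrow> real"
  assumes "prob_space \<Omega>" "prob_space P" "iid_samples \<Omega> P m S" "l < k" "i \<in> {1..m}"
    and H[measurable]: "H \<in> borel_measurable (sample_filtration \<Omega> P m S l \<Otimes>\<^sub>M P)"
    and int: "integrable \<Omega> (\<lambda>\<omega>. H (\<omega>, S k i \<omega>))"
  shows "(\<integral>\<omega>. H (\<omega>, S k i \<omega>) \<partial>\<Omega>) = (\<integral>\<omega>. (\<integral>s. H (\<omega>, s) \<partial>P) \<partial>\<Omega>)"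
proof -
  interpret prob_space \<Omega> by fact
  interpret P: prob_space P by fact
  let ?F = "sample_filtration \<Omega> P m S l"
  define D where "D = distr \<Omega> ?F (\<lambda>\<omega>. \<omega>)"
  have id[measurable]: "(\<lambda>\<omega>. \<omega>) \<in> measurable \<Omega> ?F"
    using sample_filtration_subalgebra[OF assms(1,3), of l]
    by (auto simp: measurable_def subalgebra_def Int_absorb2 dest: sets.sets_into_space)
  have S[measurable]: "S k i \<in> measurable \<Omega> P"
    using assms(4) by (intro iid_samples_measurable[OF assms(1,3) _ assms(5)]) simp
  have law: "distr \<Omega> P (S k i) = P" using assms(3,4,5) by (simp add: iid_samples_def)
  interpret D: prob_space D unfolding D_def by (rule prob_space_distr) simp
  interpret DP: pair_sigma_finite D P ..
  have eq: "D \<Otimes>\<^sub>M P = distr \<Omega> (?F \<Otimes>\<^sub>M P) (\<lambda>\<omega>. (\<omega>, S k i \<omega>))"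
  proof (rule pair_measure_eqI)
    fix A B assume A: "A \<in> sets D" and B: "B \<in> sets P"
    then have A': "A \<in> sets ?F" by (simp add: D_def)
    have AO: "A \<inter> space \<Omega> = A" using sets.sets_into_space[OF A'] by auto
    have "emeasure D A = prob A" using A' AO by (simp add: D_def emeasure_distr emeasure_eq_measure)
    moreover have "emeasure P B = prob (S k i -` B \<inter> space \<Omega>)"
      using B by (subst law[symmetric]) (simp add: emeasure_distr emeasure_eq_measure)
    moreover have "prob (A \<inter> (S k i -` B \<inter> space \<Omega>)) = prob A * prob (S k i -` B \<inter> space \<Omega>)"
      using indep_filtration_sample[OF assms(1,3,4,5)] A' B by (intro indep_setD) auto
    moreover have "emeasure (distr \<Omega> (?F \<Otimes>\<^sub>M P) (\<lambda>\<omega>. (\<omega>, S k i \<omega>))) (A \<times> B)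
        = prob (A \<inter> (S k i -` B \<inter> space \<Omega>))"
    proof -
      have "(\<lambda>\<omega>. (\<omega>, S k i \<omega>)) -` (A \<times> B) \<inter> space \<Omega> = A \<inter> (S k i -` B \<inter> space \<Omega>)" by auto
      then show ?thesis using A' B by (simp add: emeasure_distr emeasure_eq_measure)
    qed
    ultimately show "emeasure D A * emeasure P B
        = emeasure (distr \<Omega> (?F \<Otimes>\<^sub>M P) (\<lambda>\<omega>. (\<omega>, S k i \<omega>))) (A \<times> B)"
      by (simp add: ennreal_mult')
  qed (auto simp: D_def D.sigma_finite_measure_axioms[unfolded D_def] P.sigma_finite_measure_axioms)
  have intD: "integrable (D \<Otimes>\<^sub>M P) H"
    using int unfolding eq by (simp add: integrable_distr_eq)
  have "(\<integral>\<omega>. H (\<omega>, S k i \<omega>) \<partial>\<Omega>) = (\<integral>p. H p \<partial>(D \<Otimes>\<^sub>M P))"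
    unfolding eq by (simp add: integral_distr)
  also have "\<dots> = (\<integral>\<omega>. (\<integral>s. H (\<omega>, s) \<partial>P) \<partial>D)"
    using DP.integral_fst'[OF intD] by simp
  also have "\<dots> = (\<integral>\<omega>. (\<integral>s. H (\<omega>, s) \<partial>P) \<partial>\<Omega>)"
    unfolding D_def by (rule integral_distr) (auto intro!: P.borel_measurable_lebesgue_integral)
  finally show ?thesis .
qed

section \<open>Change of the preconditioner\<close>

lemma borel_measurable_wnorm:
  fixes M :: "'w \<Rightarrow> 'a::euclidean_space \<Rightarrow> 'a"
  assumes lin: "\<And>\<omega>. \<omega> \<in> space N \<Longrightarrow> linear (M \<omega>)"
    and [measurable]: "\<And>v. (\<lambda>\<omega>. M \<omega> v) \<in> borel_measurable N" "v \<in> borel_measurable N"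
  shows "(\<lambda>\<omega>. wnorm (M \<omega>) (v \<omega>)) \<in> borel_measurable N"
proof -
  have "(\<lambda>\<omega>. sqrt (v \<omega> \<bullet> (\<Sum>b\<in>Basis. (v \<omega> \<bullet> b) *\<^sub>R M \<omega> b))) \<in> borel_measurable N"
    by measurable
  moreover have "wnorm (M \<omega>) (v \<omega>) = sqrt (v \<omega> \<bullet> (\<Sum>b\<in>Basis. (v \<omega> \<bullet> b) *\<^sub>R M \<omega> b))" if "\<omega> \<in> space N" for \<omega>
  proof -
    have "M \<omega> (v \<omega>) = M \<omega> (\<Sum>b\<in>Basis. (v \<omega> \<bullet> b) *\<^sub>R b)" by (simp add: euclidean_representation)
    also have "\<dots> = (\<Sum>b\<in>Basis. (v \<omega> \<bullet> b) *\<^sub>R M \<omega> b)"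
      by (simp only: linear_sum[OF lin[OF that]] linear_scale[OF lin[OF that]])
    finally show ?thesis by (simp add: wnorm_def)
  qed
  ultimately show ?thesis by (simp cong: measurable_cong)
qed

lemma wnorm_sq_le:
  assumes "spd M" "0 < \<mu>" "\<And>v. \<mu> * wnorm M v \<le> norm v"
  shows "(wnorm M v)\<^sup>2 \<le> (norm v)\<^sup>2 / \<mu>\<^sup>2"
proof -
  have "(\<mu> * wnorm M v)\<^sup>2 \<le> (norm v)\<^sup>2"
    using assms wnorm_nonneg[OF assms(1), of v] by (intro power_mono) auto
  then show ?thesis using assms(2) by (simp add: power_mult_distrib field_simps)
qed

lemma tendsto_wnorm_sq:
  assumes "spd M" "u \<longlonglongrightarrow> v"
  shows "(\<lambda>n. (wnorm M (u n))\<^sup>2) \<longlonglongrightarrow> (wnorm M v)\<^sup>2"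
proof -
  have bl: "bounded_linear M" using spd_linear[OF assms(1)] by (simp add: linear_conv_bounded_linear)
  show ?thesis unfolding wnorm_sq[OF assms(1)]
    by (intro tendsto_inner assms(2) bounded_linear.tendsto[OF bl])
qed

text \<open>
  The conditional expectation bound, assumed for fixed vectors, extends to vectors that depend on the
  past: a simple function is constant on finitely many past events, and simple functions approximate.
\<close>

lemma integral_wnorm_le_past:
  fixes M M' :: "'w \<Rightarrow> 'a::euclidean_space \<Rightarrow> 'a" and v :: "'w \<Rightarrow> 'a"
  assumes "prob_space \<Omega>" and sub: "subalgebra \<Omega> F"
    and spd: "\<And>\<omega>. \<omega> \<in> space \<Omega> \<Longrightarrow> spd (M \<omega>)" "\<And>\<omega>. \<omega> \<in> space \<Omega> \<Longrightarrow> spd (M' \<omega>)"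
    and meas: "\<And>v. (\<lambda>\<omega>. M \<omega> v) \<in> borel_measurable F" "\<And>v. (\<lambda>\<omega>. M' \<omega> v) \<in> borel_measurable \<Omega>"
    and \<mu>: "0 < \<mu>" "AE \<omega> in \<Omega>. \<forall>v. \<mu> * wnorm (M \<omega>) v \<le> norm v" "AE \<omega> in \<Omega>. \<forall>v. \<mu> * wnorm (M' \<omega>) v \<le> norm v"
    and L: "0 < L" "AE \<omega> in \<Omega>. \<forall>v. norm v \<le> L * wnorm (M \<omega>) v"
    and \<rho>: "\<And>v. v \<noteq> 0 \<Longrightarrow> AE \<omega> in \<Omega>.
       real_cond_exp \<Omega> F (\<lambda>\<omega>. (wnorm (M' \<omega>) v)\<^sup>2 / (wnorm (M \<omega>) v)\<^sup>2) \<omega> \<le> c"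
    and v: "v \<in> borel_measurable F" "integrable \<Omega> (\<lambda>\<omega>. (norm (v \<omega>))\<^sup>2)" and A: "A \<in> sets F"
  shows "(\<integral>\<omega>. indicator A \<omega> * (wnorm (M' \<omega>) (v \<omega>))\<^sup>2 \<partial>\<Omega>)
     \<le> c * (\<integral>\<omega>. indicator A \<omega> * (wnorm (M \<omega>) (v \<omega>))\<^sup>2 \<partial>\<Omega>)"
proof -
  interpret prob_space \<Omega> by fact
  interpret sub: finite_measure_subalgebra \<Omega> F by unfold_locales (rule sub)
  have sp: "space F = space \<Omega>" and setsF: "\<And>B. B \<in> sets F \<Longrightarrow> B \<in> sets \<Omega>"
    using sub by (auto simp: subalgebra_def)
  have measM[measurable]: "(\<lambda>\<omega>. wnorm (M \<omega>) (u \<omega>)) \<in> borel_measurable \<Omega>"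
     and measM'[measurable]: "(\<lambda>\<omega>. wnorm (M' \<omega>) (u \<omega>)) \<in> borel_measurable \<Omega>"
     if "u \<in> borel_measurable \<Omega>" for u
    using that spd meas(2) measurable_from_subalg[OF sub meas(1)]
    by (auto intro!: borel_measurable_wnorm spd_linear)
  have measF: "(\<lambda>\<omega>. wnorm (M \<omega>) u) \<in> borel_measurable F" for u
    using spd(1) meas(1) sp by (auto intro!: borel_measurable_wnorm spd_linear)
  have bM: "AE \<omega> in \<Omega>. \<forall>v. (wnorm (M \<omega>) v)\<^sup>2 \<le> (norm v)\<^sup>2 / \<mu>\<^sup>2"
    using \<mu>(2) AE_space by eventually_elim (intro allI wnorm_sq_le spd(1) \<mu>(1); simp)
  have bM': "AE \<omega> in \<Omega>. \<forall>v. (wnorm (M' \<omega>) v)\<^sup>2 \<le> (norm v)\<^sup>2 / \<mu>\<^sup>2"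
    using \<mu>(3) AE_space by eventually_elim (intro allI wnorm_sq_le spd(2) \<mu>(1); simp)
  have integ: "integrable \<Omega> (\<lambda>\<omega>. indicator B \<omega> * (wnorm (M \<omega>) (u \<omega>))\<^sup>2)"
     "integrable \<Omega> (\<lambda>\<omega>. indicator B \<omega> * (wnorm (M' \<omega>) (u \<omega>))\<^sup>2)"
     if B: "B \<in> sets \<Omega>" and u: "u \<in> borel_measurable \<Omega>" "integrable \<Omega> (\<lambda>\<omega>. (norm (u \<omega>))\<^sup>2)" for B u
  proof -
    have i: "integrable \<Omega> (\<lambda>\<omega>. (norm (u \<omega>))\<^sup>2 / \<mu>\<^sup>2)" using u(2) by simp
    show "integrable \<Omega> (\<lambda>\<omega>. indicator B \<omega> * (wnorm (M \<omega>) (u \<omega>))\<^sup>2)"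
    proof (rule Bochner_Integration.integrable_bound[OF i])
      show "AE \<omega> in \<Omega>. norm (indicator B \<omega> * (wnorm (M \<omega>) (u \<omega>))\<^sup>2) \<le> norm ((norm (u \<omega>))\<^sup>2 / \<mu>\<^sup>2)"
        using bM by eventually_elim (auto simp: indicator_def)
    qed (use B measM[OF u(1)] in measurable)
    show "integrable \<Omega> (\<lambda>\<omega>. indicator B \<omega> * (wnorm (M' \<omega>) (u \<omega>))\<^sup>2)"
    proof (rule Bochner_Integration.integrable_bound[OF i])
      show "AE \<omega> in \<Omega>. norm (indicator B \<omega> * (wnorm (M' \<omega>) (u \<omega>))\<^sup>2) \<le> norm ((norm (u \<omega>))\<^sup>2 / \<mu>\<^sup>2)"
        using bM' by eventually_elim (auto simp: indicator_def)
    qed (use B measM'[OF u(1)] in measurable)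
  qed
  have fixed: "(\<integral>\<omega>. indicator B \<omega> * (wnorm (M' \<omega>) u)\<^sup>2 \<partial>\<Omega>) \<le> c * (\<integral>\<omega>. indicator B \<omega> * (wnorm (M \<omega>) u)\<^sup>2 \<partial>\<Omega>)"
    if B: "B \<in> sets F" for B u
  proof (cases "u = 0")
    case True
    then show ?thesis by (simp add: wnorm_def)
  next
    case False
    let ?q = "\<lambda>\<omega>. (wnorm (M' \<omega>) u)\<^sup>2 / (wnorm (M \<omega>) u)\<^sup>2"
    let ?w = "\<lambda>\<omega>. indicator B \<omega> * (wnorm (M \<omega>) u)\<^sup>2"
    have pos: "0 < (wnorm (M \<omega>) u)\<^sup>2" if "\<omega> \<in> space \<Omega>" for \<omega>
      using spd(1)[OF that] False wnorm_sq[OF spd(1)[OF that], of u] by (simp add: spd_def)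
    have ae: "AE \<omega> in \<Omega>. indicator B \<omega> * (wnorm (M' \<omega>) u)\<^sup>2 = ?w \<omega> * ?q \<omega>"
    proof (rule AE_I2)
      fix \<omega> assume "\<omega> \<in> space \<Omega>"
      from pos[OF this] show "indicator B \<omega> * (wnorm (M' \<omega>) u)\<^sup>2 = ?w \<omega> * ?q \<omega>" by simp
    qed
    have intB: "integrable \<Omega> (\<lambda>\<omega>. indicator B \<omega> * (wnorm (M' \<omega>) u)\<^sup>2)" "integrable \<Omega> ?w"
      using integ[of B "\<lambda>_. u"] setsF[OF B] by simp_all
    have wF: "?w \<in> borel_measurable F" using measF[of u] B by measurable
    have qm: "?q \<in> borel_measurable \<Omega>" using measM[of "\<lambda>_. u"] measM'[of "\<lambda>_. u"] by simp
    have wq: "(\<lambda>\<omega>. ?w \<omega> * ?q \<omega>) \<in> borel_measurable \<Omega>"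
      using borel_measurable_times[OF measurable_from_subalg[OF sub wF] qm] by simp
    have iwq: "integrable \<Omega> (\<lambda>\<omega>. ?w \<omega> * ?q \<omega>)"
      by (rule integrable_cong_AE_imp[OF intB(1) wq ae])
    have eq: "(\<integral>\<omega>. indicator B \<omega> * (wnorm (M' \<omega>) u)\<^sup>2 \<partial>\<Omega>) = (\<integral>\<omega>. ?w \<omega> * ?q \<omega> \<partial>\<Omega>)"
      by (rule integral_cong_AE[OF borel_measurable_integrable[OF intB(1)] wq ae])
    note ce = sub.real_cond_exp_intg[OF iwq wF qm]
    have "(\<integral>\<omega>. ?w \<omega> * ?q \<omega> \<partial>\<Omega>) = (\<integral>\<omega>. ?w \<omega> * real_cond_exp \<Omega> F ?q \<omega> \<partial>\<Omega>)"
      using ce(2) by simp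
    also have "\<dots> \<le> (\<integral>\<omega>. c * ?w \<omega> \<partial>\<Omega>)"
    proof (rule integral_mono_AE[OF ce(1)])
      show "AE \<omega> in \<Omega>. ?w \<omega> * real_cond_exp \<Omega> F ?q \<omega> \<le> c * ?w \<omega>"
        using \<rho>[OF False]
      proof eventually_elim
        case (elim \<omega>)
        have "0 \<le> ?w \<omega>" by simp
        from mult_left_mono[OF elim this] show ?case by (simp only: mult.commute)
      qed
    qed (use intB in simp)
    finally show ?thesis using eq intB by simp
  qed
  obtain U where U: "\<And>i. simple_function F (U i)" "\<And>\<omega>. \<omega> \<in> space F \<Longrightarrow> (\<lambda>i. U i \<omega>) \<longlonglongrightarrow> v \<omega>"
    "\<And>i \<omega>. \<omega> \<in> space F \<Longrightarrow> dist (U i \<omega>) 0 \<le> 2 * dist (v \<omega>) 0"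
    using borel_measurable_implies_sequence_metric[OF v(1), of 0] by blast
  have Um: "U i \<in> borel_measurable F" for i using U(1) by (rule borel_measurable_simple_function)
  note Um' = measurable_from_subalg[OF sub Um]
  have vm: "v \<in> borel_measurable \<Omega>" by (rule measurable_from_subalg[OF sub v(1)])
  have Ub: "(norm (U i \<omega>))\<^sup>2 \<le> 4 * (norm (v \<omega>))\<^sup>2" if "\<omega> \<in> space \<Omega>" for i \<omega>
    using power_mono[OF U(3)[of \<omega> i], of 2] that sp by (simp add: power_mult_distrib)
  have Ui: "integrable \<Omega> (\<lambda>\<omega>. (norm (U i \<omega>))\<^sup>2)" for i
  proof (rule Bochner_Integration.integrable_bound)
    show "integrable \<Omega> (\<lambda>\<omega>. 4 * (norm (v \<omega>))\<^sup>2)" using v(2) by simp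
    show "AE \<omega> in \<Omega>. norm ((norm (U i \<omega>))\<^sup>2) \<le> norm (4 * (norm (v \<omega>))\<^sup>2)"
      using Ub by (auto intro!: AE_I2)
  qed (use Um' in measurable)
  have simple: "(\<integral>\<omega>. indicator A \<omega> * (wnorm (M' \<omega>) (U i \<omega>))\<^sup>2 \<partial>\<Omega>)
     \<le> c * (\<integral>\<omega>. indicator A \<omega> * (wnorm (M \<omega>) (U i \<omega>))\<^sup>2 \<partial>\<Omega>)" for i
  proof -
    define R where "R = U i ` space F"
    define B where "B y = A \<inter> (U i -` {y} \<inter> space F)" for y
    have fin: "finite R" using simple_functionD(1)[OF U(1)] by (simp add: R_def)
    have BF: "B y \<in> sets F" for y
      unfolding B_def using simple_functionD(2)[OF U(1), of i "{y}"] A by auto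
    have split: "indicator A \<omega> * h (U i \<omega>) = (\<Sum>y\<in>R. indicator (B y) \<omega> * h y)"
      if "\<omega> \<in> space \<Omega>" for \<omega> and h :: "'a \<Rightarrow> real"
    proof -
      have "(\<Sum>y\<in>R. indicator (B y) \<omega> * h y) = (\<Sum>y\<in>R. if U i \<omega> = y then indicator A \<omega> * h y else 0)"
        using that by (intro sum.cong) (auto simp: B_def indicator_def sp)
      also have "\<dots> = indicator A \<omega> * h (U i \<omega>)"
        using fin that by (simp add: R_def sp)
      finally show ?thesis by simp
    qed
    have "(\<integral>\<omega>. indicator A \<omega> * (wnorm (M' \<omega>) (U i \<omega>))\<^sup>2 \<partial>\<Omega>)
       = (\<integral>\<omega>. (\<Sum>y\<in>R. indicator (B y) \<omega> * (wnorm (M' \<omega>) y)\<^sup>2) \<partial>\<Omega>)"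
      by (intro Bochner_Integration.integral_cong refl split)
    also have "\<dots> = (\<Sum>y\<in>R. \<integral>\<omega>. indicator (B y) \<omega> * (wnorm (M' \<omega>) y)\<^sup>2 \<partial>\<Omega>)"
      using integ(2)[OF setsF[OF BF], of "\<lambda>_. _"] by (intro Bochner_Integration.integral_sum) simp
    also have "\<dots> \<le> (\<Sum>y\<in>R. c * (\<integral>\<omega>. indicator (B y) \<omega> * (wnorm (M \<omega>) y)\<^sup>2 \<partial>\<Omega>))"
      by (intro sum_mono fixed BF)
    also have "\<dots> = c * (\<Sum>y\<in>R. \<integral>\<omega>. indicator (B y) \<omega> * (wnorm (M \<omega>) y)\<^sup>2 \<partial>\<Omega>)"
      by (simp add: sum_distrib_left)
    also have "(\<Sum>y\<in>R. \<integral>\<omega>. indicator (B y) \<omega> * (wnorm (M \<omega>) y)\<^sup>2 \<partial>\<Omega>)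
       = (\<integral>\<omega>. (\<Sum>y\<in>R. indicator (B y) \<omega> * (wnorm (M \<omega>) y)\<^sup>2) \<partial>\<Omega>)"
      using integ(1)[OF setsF[OF BF], of "\<lambda>_. _"] by (intro Bochner_Integration.integral_sum[symmetric]) simp
    also have "\<dots> = (\<integral>\<omega>. indicator A \<omega> * (wnorm (M \<omega>) (U i \<omega>))\<^sup>2 \<partial>\<Omega>)"
      by (intro Bochner_Integration.integral_cong refl split[symmetric])
    finally show ?thesis .
  qed
  have lim: "(\<lambda>i. \<integral>\<omega>. indicator A \<omega> * (wnorm (N \<omega>) (U i \<omega>))\<^sup>2 \<partial>\<Omega>)
      \<longlonglongrightarrow> (\<integral>\<omega>. indicator A \<omega> * (wnorm (N \<omega>) (v \<omega>))\<^sup>2 \<partial>\<Omega>)"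
    if N: "\<And>u. u \<in> borel_measurable \<Omega> \<Longrightarrow> (\<lambda>\<omega>. wnorm (N \<omega>) (u \<omega>)) \<in> borel_measurable \<Omega>"
      "\<And>\<omega>. \<omega> \<in> space \<Omega> \<Longrightarrow> spd (N \<omega>)" "AE \<omega> in \<Omega>. \<forall>v. (wnorm (N \<omega>) v)\<^sup>2 \<le> (norm v)\<^sup>2 / \<mu>\<^sup>2" for N
  proof (rule integral_dominated_convergence)
    show "integrable \<Omega> (\<lambda>\<omega>. 4 * (norm (v \<omega>))\<^sup>2 / \<mu>\<^sup>2)" using v(2) by simp
    show "AE \<omega> in \<Omega>. (\<lambda>i. indicator A \<omega> * (wnorm (N \<omega>) (U i \<omega>))\<^sup>2) \<longlonglongrightarrow> indicator A \<omega> * (wnorm (N \<omega>) (v \<omega>))\<^sup>2"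
      using N(2) U(2) sp by (intro AE_I2 tendsto_mult tendsto_const tendsto_wnorm_sq) auto
    show "AE \<omega> in \<Omega>. norm (indicator A \<omega> * (wnorm (N \<omega>) (U i \<omega>))\<^sup>2) \<le> 4 * (norm (v \<omega>))\<^sup>2 / \<mu>\<^sup>2" for i
      using N(3) AE_space
    proof eventually_elim
      case (elim \<omega>)
      have "(wnorm (N \<omega>) (U i \<omega>))\<^sup>2 \<le> (norm (U i \<omega>))\<^sup>2 / \<mu>\<^sup>2" using elim by blast
      also have "\<dots> \<le> 4 * (norm (v \<omega>))\<^sup>2 / \<mu>\<^sup>2" using Ub elim(2) by (intro divide_right_mono) auto
      finally show ?case by (auto simp: indicator_def)
    qed
  qed (use N(1)[OF Um'] N(1)[OF vm] setsF[OF A] in measurable)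
  show ?thesis
    by (rule LIMSEQ_le[OF lim[OF measM' spd(2) bM'] tendsto_mult_left[OF lim[OF measM spd(1) bM]]]) (use simple in auto)
qed

section \<open>Elementary estimates\<close>

lemma summable_sq_minus_one:
  fixes \<rho> :: "nat \<Rightarrow> real"
  assumes "convergent_prod \<rho>" "\<And>k. 1 \<le> \<rho> k"
  shows "summable (\<lambda>k. (\<rho> k)\<^sup>2 - 1)"
proof -
  have eq: "(\<lambda>i. 1 + norm (\<rho> i - 1)) = \<rho>" using assms(2) by (auto simp: fun_eq_iff)
  have "abs_convergent_prod \<rho>" unfolding abs_convergent_prod_def eq by (rule assms(1))
  then have "summable (\<lambda>i. norm (\<rho> i - 1))" by (rule abs_convergent_prod_imp_summable)
  then have s: "summable (\<lambda>i. \<rho> i - 1)" using assms(2) by simp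
  then have "Bseq (\<lambda>i. \<rho> i - 1)" by (rule summable_imp_Bseq)
  then obtain K where K: "\<And>i. \<rho> i - 1 \<le> K" by (auto simp: Bseq_def abs_le_iff)
  show ?thesis
  proof (rule summable_comparison_test')
    show "summable (\<lambda>i. (K + 2) * (\<rho> i - 1))" using s by (rule summable_mult)
    fix i
    have "(\<rho> i)\<^sup>2 - 1 = (\<rho> i - 1 + 2) * (\<rho> i - 1)" by (simp add: power2_eq_square algebra_simps)
    also have "\<dots> \<le> (K + 2) * (\<rho> i - 1)" using K[of i] assms(2)[of i] by (intro mult_right_mono) auto
    finally show "norm ((\<rho> i)\<^sup>2 - 1) \<le> (K + 2) * (\<rho> i - 1)" using assms(2)[of i] by simp
  qed
qed

lemma norm_mean_sq_le:
  fixes v :: "nat \<Rightarrow> 'a::real_normed_vector"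
  assumes "0 < m"
  shows "(norm ((1 / real m) *\<^sub>R (\<Sum>i=1..m. v i)))\<^sup>2 \<le> 1 / real m * (\<Sum>i=1..m. (norm (v i))\<^sup>2)"
proof -
  have "(norm (\<Sum>i=1..m. v i))\<^sup>2 \<le> (\<Sum>i=1..m. norm (v i))\<^sup>2"
    by (intro power_mono norm_sum) simp
  also have "\<dots> \<le> (\<Sum>i=1..m. (norm (v i))\<^sup>2) * real m"
    using sum_squared_le_sum_of_squares[of "\<lambda>i. norm (v i)" "{1..m}"] by simp
  finally have "(1 / real m)\<^sup>2 * (norm (\<Sum>i=1..m. v i))\<^sup>2 \<le> (1 / real m)\<^sup>2 * ((\<Sum>i=1..m. (norm (v i))\<^sup>2) * real m)"
    by (rule mult_left_mono) simp
  also have "\<dots> = 1 / real m * (\<Sum>i=1..m. (norm (v i))\<^sup>2)"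
    using assms by (simp add: power2_eq_square)
  finally show ?thesis by (simp add: power_mult_distrib power_divide)
qed

text \<open>
  The weight \<open>a\<^sup>2\<close> in Young's inequality balances the errors: the factor \<open>1 + a\<^sup>2\<close> and the remainder
  \<open>(1 + 1 / a\<^sup>2) (\<gamma> a\<^sup>2)\<^sup>2\<close> are both summable perturbations.
\<close>

lemma wnorm_sq_inexact_le:
  assumes M: "spd M" and a: "0 < a" "a\<^sup>2 \<le> K" and z: "wnorm M (x' - z) \<le> \<gamma> * a\<^sup>2"
  shows "(wnorm M (x' - y))\<^sup>2 \<le> (1 + a\<^sup>2) * (wnorm M (z - y))\<^sup>2 + \<gamma>\<^sup>2 * (1 + K) * a\<^sup>2"
proof -
  have eq: "x' - y = (z - y) + (x' - z)" by simp
  have "(wnorm M (x' - y))\<^sup>2 \<le> (1 + a\<^sup>2) * (wnorm M (z - y))\<^sup>2 + (1 + 1 / a\<^sup>2) * (wnorm M (x' - z))\<^sup>2"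
    unfolding eq by (rule wnorm_sq_add_le[OF M]) (use a in simp)
  also have "(1 + 1 / a\<^sup>2) * (wnorm M (x' - z))\<^sup>2 \<le> (1 + 1 / a\<^sup>2) * (\<gamma> * a\<^sup>2)\<^sup>2"
    using z wnorm_nonneg[OF M] by (intro mult_left_mono power_mono) auto
  also have "(1 + 1 / a\<^sup>2) * (\<gamma> * a\<^sup>2)\<^sup>2 = \<gamma>\<^sup>2 * (1 + a\<^sup>2) * a\<^sup>2"
    using a(1) by (simp add: field_simps power2_eq_square)
  also have "\<dots> \<le> \<gamma>\<^sup>2 * (1 + K) * a\<^sup>2"
    using a(2) by (intro mult_right_mono mult_left_mono) auto
  finally show ?thesis by simp
qed

lemma inner_le_young:
  fixes h w :: "'a::real_inner"
  assumes "norm w \<le> L * t" "0 < a" "0 < L"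
  shows "- 2 * a * (h \<bullet> w) \<le> a\<^sup>2 * L\<^sup>2 * (norm h)\<^sup>2 + t\<^sup>2"
proof -
  have "- (h \<bullet> w) \<le> norm h * norm w" using Cauchy_Schwarz_ineq2[of h w] by linarith
  also have "\<dots> \<le> norm h * (L * t)" using assms(1) by (intro mult_left_mono) auto
  finally have "2 * a * (- (h \<bullet> w)) \<le> 2 * a * (norm h * (L * t))"
    using assms(2) by (intro mult_left_mono) auto
  also have "\<dots> = 2 * (a * L * norm h) * t" by simp
  also have "\<dots> \<le> (a * L * norm h)\<^sup>2 + t\<^sup>2" by (rule sum_squares_bound)
  finally show ?thesis by (simp add: power_mult_distrib)
qed

lemma integral_scaled_sum:
  fixes h :: "'i \<Rightarrow> 'w \<Rightarrow> real"
  assumes "\<And>i. i \<in> I \<Longrightarrow> integrable N (h i)"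
  shows "(\<integral>\<omega>. c * (\<Sum>i\<in>I. h i \<omega>) \<partial>N) = c * (\<Sum>i\<in>I. \<integral>\<omega>. h i \<omega> \<partial>N)"
  using assms by simp

lemma integral_affine_comb:
  fixes u v w t :: "'w \<Rightarrow> real"
  assumes "integrable N u" "integrable N v" "integrable N w" "integrable N t"
  shows "(\<integral>\<omega>. b * (u \<omega> - c * v \<omega> + d * w \<omega>) + t \<omega> \<partial>N)
    = b * ((\<integral>\<omega>. u \<omega> \<partial>N) - c * (\<integral>\<omega>. v \<omega> \<partial>N) + d * (\<integral>\<omega>. w \<omega> \<partial>N)) + (\<integral>\<omega>. t \<omega> \<partial>N)"
  using assms by simp

lemma norm_inner_le_sum_squares:
  fixes h w :: "'a::real_inner"
  shows "norm (h \<bullet> w) \<le> norm ((norm h)\<^sup>2 + (norm w)\<^sup>2)"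
proof -
  have "\<bar>h \<bullet> w\<bar> \<le> norm h * norm w" by (rule Cauchy_Schwarz_ineq2)
  moreover have "2 * norm h * norm w \<le> (norm h)\<^sup>2 + (norm w)\<^sup>2" by (rule sum_squares_bound)
  moreover have "0 \<le> norm h * norm w" by simp
  ultimately show ?thesis unfolding real_norm_def by linarith
qed

lemma integral_scaled_diff:
  fixes u v w :: "'w \<Rightarrow> real"
  assumes "integrable N u" "integrable N v" "integrable N w"
  shows "(\<integral>\<omega>. c * u \<omega> - d * v \<omega> - w \<omega> \<partial>N)
    = c * (\<integral>\<omega>. u \<omega> \<partial>N) - d * (\<integral>\<omega>. v \<omega> \<partial>N) - (\<integral>\<omega>. w \<omega> \<partial>N)"
  using assms by simp

lemma sum_telescope_comb:
  fixes u e b p :: "nat \<Rightarrow> real"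
  shows "(\<Sum>i<n. (u i - u (Suc i)) + e i * c1 + c2 * b i + c3 * (p i - p (Suc i)))
    = (u 0 - u n) + (\<Sum>i<n. e i) * c1 + c2 * (\<Sum>i<n. b i) + c3 * (p 0 - p n)"
  by (induction n) (simp_all add: algebra_simps)

section \<open>Quasi-Fejer convergence\<close>

lemma tendsto_of_le_null:
  fixes u :: "nat \<Rightarrow> 'a::real_normed_vector"
  assumes "\<And>n. norm (u n - v n) \<le> \<delta> n" "\<delta> \<longlonglongrightarrow> 0" "v \<longlonglongrightarrow> l"
  shows "u \<longlonglongrightarrow> l"
proof -
  have "(\<lambda>n. u n - v n) \<longlonglongrightarrow> 0"
    by (rule Lim_null_comparison[OF _ assms(2)]) (use assms(1) in simp)
  from tendsto_add[OF this assms(3)] show ?thesis by simp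
qed

text \<open>
  Quasi-Fejer convergence: a cluster point that belongs to the target set is the limit, because the
  distances to nearby points of the target set converge along the whole sequence.
\<close>

lemma cluster_point_imp_limit:
  fixes Y :: "nat \<Rightarrow> 'a::euclidean_space"
  assumes \<mu>: "0 < \<mu>" "\<And>n v. (wnorm (N n) v)\<^sup>2 \<le> (norm v)\<^sup>2 / \<mu>\<^sup>2"
    and L: "0 < L" "\<And>n v. (norm v)\<^sup>2 \<le> L\<^sup>2 * (wnorm (N n) v)\<^sup>2"
    and conv: "\<And>d. d \<in> T \<Longrightarrow> convergent (\<lambda>n. (wnorm (N n) (Y n - d))\<^sup>2)"
    and y: "y \<in> closure T" and q: "filterlim q at_top sequentially" "(\<lambda>j. Y (q j)) \<longlonglongrightarrow> y"
  shows "Y \<longlonglongrightarrow> y"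
proof (rule LIMSEQ_I)
  fix e :: real assume e: "0 < e"
  define t where "t = e / (2 * L / \<mu> + 1)"
  have c: "0 < 2 * L / \<mu> + 1" using L(1) \<mu>(1) by (simp add: add_pos_pos)
  have t: "0 < t" using e c by (simp add: t_def)
  obtain d where d: "d \<in> T" "dist d y < t" using y t closure_approachable by blast
  obtain l where l: "(\<lambda>n. (wnorm (N n) (Y n - d))\<^sup>2) \<longlonglongrightarrow> l" using conv[OF d(1)] by (auto simp: convergent_def)
  have "(\<lambda>j. (wnorm (N (q j)) (Y (q j) - d))\<^sup>2) \<longlonglongrightarrow> l"
    by (rule filterlim_compose[OF l q(1)])
  moreover have "(\<lambda>j. (norm (Y (q j) - d))\<^sup>2 / \<mu>\<^sup>2) \<longlonglongrightarrow> (norm (y - d))\<^sup>2 / \<mu>\<^sup>2"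
    using \<mu>(1) by (intro tendsto_intros q(2)) simp
  ultimately have "l \<le> (norm (y - d))\<^sup>2 / \<mu>\<^sup>2"
    by (rule LIMSEQ_le) (use \<mu>(2) in blast)
  also have "\<dots> < t\<^sup>2 / \<mu>\<^sup>2"
    using d(2) \<mu>(1) t by (intro divide_strict_right_mono power_strict_mono) (auto simp: dist_norm norm_minus_commute)
  also have "\<dots> < (2 * t / \<mu>)\<^sup>2" using t \<mu>(1) by (simp add: power_divide power_mult_distrib divide_strict_right_mono)
  finally have "eventually (\<lambda>n. (wnorm (N n) (Y n - d))\<^sup>2 < (2 * t / \<mu>)\<^sup>2) sequentially"
    by (rule order_tendstoD(2)[OF l])
  then obtain n0 where n0: "\<And>n. n \<ge> n0 \<Longrightarrow> (wnorm (N n) (Y n - d))\<^sup>2 < (2 * t / \<mu>)\<^sup>2"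
    by (auto simp: eventually_sequentially)
  have "norm (Y n - y) < e" if "n \<ge> n0" for n
  proof -
    have "(norm (Y n - d))\<^sup>2 \<le> L\<^sup>2 * (wnorm (N n) (Y n - d))\<^sup>2" by (rule L(2))
    also have "\<dots> < L\<^sup>2 * (2 * t / \<mu>)\<^sup>2" using n0[OF that] L(1) by (intro mult_strict_left_mono) auto
    also have "\<dots> = (L * (2 * t / \<mu>))\<^sup>2" by (rule power_mult_distrib[symmetric])
    finally have "norm (Y n - d) < L * (2 * t / \<mu>)"
      by (rule power_less_imp_less_base) (use L(1) \<mu>(1) t in simp)
    moreover have "norm (Y n - y) \<le> norm (Y n - d) + norm (d - y)"
      using norm_triangle_ineq[of "Y n - d" "d - y"] by simp
    moreover have "norm (d - y) < t" using d(2) by (simp add: dist_norm)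
    ultimately have "norm (Y n - y) < L * (2 * t / \<mu>) + t" by linarith
    also have "\<dots> = t * (2 * L / \<mu> + 1)" by (simp add: algebra_simps)
    also have "\<dots> = e" using c by (simp add: t_def)
    finally show ?thesis .
  qed
  then show "\<exists>no. \<forall>n\<ge>no. norm (Y n - y) < e" by blast
qed

text \<open>
  Gaps bounded away from \<open>0\<close> would make the stepsizes themselves summable.
\<close>

lemma small_gap_infinitely_often:
  fixes \<alpha> e gap :: "nat \<Rightarrow> real"
  assumes "\<And>n. 0 < \<alpha> n" "\<not> summable \<alpha>" "summable e" "\<And>n. 2 * \<alpha> n * gap n \<le> e n" "0 < \<eta>"
  shows "\<exists>n\<ge>k. gap n < \<eta>"
proof (rule ccontr)
  assume "\<not> ?thesis"
  then have ge: "\<And>n. n \<ge> k \<Longrightarrow> \<eta> \<le> gap n" by (meson not_less)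
  have "summable \<alpha>"
  proof (rule summable_comparison_test'[where N=k])
    show "summable (\<lambda>n. e n / (2 * \<eta>))" using assms(3) by (rule summable_divide)
    fix n assume "n \<ge> k"
    then have "2 * \<alpha> n * \<eta> \<le> 2 * \<alpha> n * gap n" using ge assms(1)[of n] by (intro mult_left_mono) auto
    also have "\<dots> \<le> e n" by (rule assms(4))
    finally show "norm (\<alpha> n) \<le> e n / (2 * \<eta>)"
      using assms(1)[of n] assms(5) by (simp add: field_simps)
  qed
  with assms(2) show False by simp
qed

section \<open>The algorithm with exact convex models\<close>

text \<open>
  The hypotheses of the theorem with both constants set to \<open>0\<close>. Steps are counted from \<open>0\<close>: step \<open>n\<close> starts
  from \<open>x (Suc n)\<close>, which is known at time \<open>n\<close>, and uses the stepsize, the minibatch and the preconditioner of index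
  \<open>Suc n\<close>.
\<close>

locale exact_ispPPA =
  fixes P :: "'s measure" and \<Omega> :: "'w measure"
    and f :: "'a::euclidean_space \<Rightarrow> 's \<Rightarrow> ereal" and r :: "'a \<Rightarrow> ereal"
    and V :: "'a set" and fm :: "'a \<Rightarrow> 'a \<Rightarrow> 's \<Rightarrow> real"
    and m :: nat and S :: "nat \<Rightarrow> nat \<Rightarrow> 'w \<Rightarrow> 's"
    and \<alpha> \<epsilon> \<mu> L \<rho> :: "nat \<Rightarrow> real" and M :: "nat \<Rightarrow> 'w \<Rightarrow> 'a \<Rightarrow> 'a"
    and \<mu>_inf L_inf \<gamma> :: real and x1 :: 'a and x :: "nat \<Rightarrow> 'w \<Rightarrow> 'a"
  assumes prob_P: "prob_space P" and prob_Om: "prob_space \<Omega>"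
    and family: "model_family P r V fm"
    and accuracy: "model_accuracy P f V fm 0"
    and precond: "preconditioner_condition \<Omega> (sample_filtration \<Omega> P m S) M \<mu>_inf L_inf \<mu> L \<rho>"
    and regular: "regularity P f r V fm 0"
    and argmin_nonempty: "argmin (objective P f r) \<noteq> {}"
    and selection_bounded: "\<exists>\<sigma>>0. \<forall>xs \<in> argmin (objective P f r). \<forall>g \<in> borel_measurable P.
           (AE s in P. g s \<in> subdifferential (sample_objective f r s) xs) \<longrightarrow>
           (\<integral>\<^sup>+ s. ennreal ((norm (g s))\<^sup>2) \<partial>P) \<le> ennreal (\<sigma>\<^sup>2)"
    and selection: "\<forall>xs \<in> argmin (objective P f r). \<forall>v \<in> subdifferential (objective P f r) xs.
           \<exists>g \<in> borel_measurable P.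
             (AE s in P. g s \<in> subdifferential (sample_objective f r s) xs) \<and>
             integrable P g \<and> (\<integral>s. g s \<partial>P) = v"
    and iterates: "ispPPA \<Omega> P m S r V fm \<alpha> \<epsilon> M 0 x1 x"
    and \<gamma>_nonneg: "0 \<le> \<gamma>" and \<epsilon>_eq: "\<forall>k\<ge>1. \<epsilon> k = \<gamma> * (\<alpha> k)\<^sup>2"
    and steps_sq_summable: "summable (\<lambda>k. (\<alpha> (Suc k))\<^sup>2)"
begin

interpretation P: prob_space P by (rule prob_P)
interpretation prob_space \<Omega> by (rule prob_Om)

abbreviation "X \<equiv> argmin (objective P f r)"
abbreviation "F \<equiv> sample_filtration \<Omega> P m S"
abbreviation "R y \<equiv> real_of_ereal (r y)"

lemma m_pos: "0 < m"
  using iterates unfolding ispPPA_def by (elim conjE)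

lemma iid: "iid_samples \<Omega> P m S"
  using iterates unfolding ispPPA_def by (elim conjE)

lemma \<alpha>_pos: "0 < \<alpha> (Suc n)"
proof -
  have "\<forall>k\<ge>1. 0 < \<alpha> k \<and> 0 \<le> \<epsilon> k" using iterates unfolding ispPPA_def by (elim conjE)
  then show ?thesis by simp
qed

lemma \<mu>_pos: "0 < \<mu>_inf"
  using precond unfolding preconditioner_condition_def by (elim conjE)

lemma \<mu>_le_1: "\<mu>_inf \<le> 1"
  using precond unfolding preconditioner_condition_def by (elim conjE)

lemma L_ge_1: "1 \<le> L_inf"
  using precond unfolding preconditioner_condition_def by (elim conjE)

lemma L_pos: "0 < L_inf" using L_ge_1 by simp

lemma M_0: "\<omega> \<in> space \<Omega> \<Longrightarrow> M 0 \<omega> = id"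
  using precond unfolding preconditioner_condition_def by (elim conjE) (rule bspec)

lemma precond_Suc:
  "\<mu>_inf \<le> \<mu> (Suc n) \<and> 0 < L (Suc n) \<and> L (Suc n) \<le> L_inf \<and> 1 \<le> \<rho> (Suc n) \<and>
   (AE \<omega> in \<Omega>. \<forall>v. \<mu> (Suc n) * wnorm (M (Suc n) \<omega>) v \<le> norm v \<and> norm v \<le> L (Suc n) * wnorm (M (Suc n) \<omega>) v) \<and>
   (\<forall>v. v \<noteq> 0 \<longrightarrow>
          (AE \<omega> in \<Omega>.
             1 / (\<rho> (Suc n))\<^sup>2 \<le> real_cond_exp \<Omega> (F (Suc n - 1))
               (\<lambda>\<omega>. (wnorm (M (Suc n) \<omega>) v)\<^sup>2 / (wnorm (M (Suc n - 1) \<omega>) v)\<^sup>2) \<omega> \<and>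
             real_cond_exp \<Omega> (F (Suc n - 1))
               (\<lambda>\<omega>. (wnorm (M (Suc n) \<omega>) v)\<^sup>2 / (wnorm (M (Suc n - 1) \<omega>) v)\<^sup>2) \<omega> \<le> (\<rho> (Suc n))\<^sup>2))"
  using precond unfolding preconditioner_condition_def by (elim conjE) (erule allE[of _ "Suc n"], erule mp, simp)

lemma \<rho>_ge_1: "1 \<le> \<rho> k"
proof (cases k)
  case 0
  have "\<rho> 0 = 1" using precond unfolding preconditioner_condition_def by (elim conjE)
  then show ?thesis using 0 by simp
next
  case (Suc n)
  then show ?thesis using precond_Suc[of n] by (elim conjE) simp
qed

lemma spd_M: "\<omega> \<in> space \<Omega> \<Longrightarrow> spd (M k \<omega>)"
proof (cases k)
  case 0
  assume "\<omega> \<in> space \<Omega>"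
  then have "M k \<omega> = (\<lambda>x. x)" using M_0 0 by (simp add: id_def)
  then show ?thesis by (auto simp: spd_def linear_id[unfolded id_def] adjoint_unique)
next
  case (Suc n)
  assume "\<omega> \<in> space \<Omega>"
  moreover have "\<forall>k\<ge>1. \<forall>\<omega>\<in>space \<Omega>. spd (M k \<omega>)"
    using iterates unfolding ispPPA_def by (elim conjE)
  ultimately show ?thesis using Suc by simp
qed

lemma subalg: "subalgebra \<Omega> (F k)"
  by (rule sample_filtration_subalgebra[OF prob_Om iid])

lemma F_sets: "A \<in> sets (F k) \<Longrightarrow> A \<in> sets \<Omega>"
  using subalg by (auto simp: subalgebra_def)

lemma F_mono: "k \<le> l \<Longrightarrow> A \<in> sets (F k) \<Longrightarrow> A \<in> sets (F l)"
  using sample_filtration_mono by blast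

lemma F_measurable_mono: "k \<le> l \<Longrightarrow> h \<in> measurable (F k) N \<Longrightarrow> h \<in> measurable (F l) N"
proof -
  assume "k \<le> l" "h \<in> measurable (F k) N"
  then show "h \<in> measurable (F l) N"
    using F_mono[of k l] measurable_sets[of h "F k" N] measurable_space[of h "F k" N]
    by (intro measurableI) (simp_all only: space_sample_filtration)
qed

lemma F_measurable: "h \<in> measurable (F k) N \<Longrightarrow> h \<in> measurable \<Omega> N"
  by (rule measurable_from_subalg[OF subalg])

lemma M_measurable: "(\<lambda>\<omega>. M k \<omega> v) \<in> borel_measurable (F k)"
proof (cases k)
  case 0
  have "(\<lambda>\<omega>. M k \<omega> v) \<in> borel_measurable (F k) \<longleftrightarrow> (\<lambda>\<omega>. v) \<in> borel_measurable (F k)"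
    by (rule measurable_cong) (use M_0 0 in simp)
  then show ?thesis by simp
next
  case (Suc n)
  have "\<forall>k\<ge>1. \<forall>v. (\<lambda>\<omega>. M k \<omega> v) \<in> borel_measurable (F k)"
    using iterates unfolding ispPPA_def by (elim conjE)
  then show ?thesis using Suc by simp
qed

lemma x_measurable: "x (Suc n) \<in> borel_measurable (F n)"
proof (cases n)
  case 0
  have "x (Suc n) \<in> borel_measurable (F n) \<longleftrightarrow> (\<lambda>\<omega>. x1) \<in> borel_measurable (F n)"
  proof (rule measurable_cong)
    have "\<forall>\<omega>\<in>space \<Omega>. x 1 \<omega> = x1" using iterates unfolding ispPPA_def by (elim conjE)
    then show "x (Suc n) \<omega> = x1" if "\<omega> \<in> space (F n)" for \<omega> using that 0 by simp
  qed
  then show ?thesis by simp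
next
  case (Suc k)
  have "\<forall>k\<ge>1. x (k + 1) \<in> borel_measurable (F k)" using iterates unfolding ispPPA_def by (elim conjE)
  then show ?thesis using Suc by simp
qed

lemma x_measurable': "x (Suc n) \<in> borel_measurable \<Omega>"
  by (rule F_measurable[OF x_measurable])

lemma AE_norm_equiv: "AE \<omega> in \<Omega>. \<forall>k v. \<mu>_inf * wnorm (M k \<omega>) v \<le> norm v \<and> norm v \<le> L_inf * wnorm (M k \<omega>) v"
proof (subst AE_all_countable, rule allI)
  fix k
  show "AE \<omega> in \<Omega>. \<forall>v. \<mu>_inf * wnorm (M k \<omega>) v \<le> norm v \<and> norm v \<le> L_inf * wnorm (M k \<omega>) v"
  proof (cases k)
    case 0
    show ?thesis
    proof (intro AE_I2 allI)
      fix \<omega> v assume "\<omega> \<in> space \<Omega>"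
      then have "M k \<omega> = id" using M_0 0 by simp
      then have "wnorm (M k \<omega>) v = norm v" by (simp add: wnorm_def norm_eq_sqrt_inner)
      moreover have "\<mu>_inf * norm v \<le> 1 * norm v" "1 * norm v \<le> L_inf * norm v"
        using \<mu>_le_1 L_ge_1 by (intro mult_right_mono; simp)+
      ultimately show "\<mu>_inf * wnorm (M k \<omega>) v \<le> norm v \<and> norm v \<le> L_inf * wnorm (M k \<omega>) v" by simp
    qed
  next
    case (Suc n)
    have b: "\<mu>_inf \<le> \<mu> k" "L k \<le> L_inf"
      using precond_Suc[of n] unfolding Suc by simp_all
    have ae: "AE \<omega> in \<Omega>. \<forall>v. \<mu> k * wnorm (M k \<omega>) v \<le> norm v \<and> norm v \<le> L k * wnorm (M k \<omega>) v"
      using precond_Suc[of n] unfolding Suc by (elim conjE)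
    from ae AE_space show ?thesis
    proof eventually_elim
      case (elim \<omega>)
      have "0 \<le> wnorm (M k \<omega>) v" for v by (rule wnorm_nonneg[OF spd_M[OF elim(2)]])
      then have "\<mu>_inf * wnorm (M k \<omega>) v \<le> \<mu> k * wnorm (M k \<omega>) v" "L k * wnorm (M k \<omega>) v \<le> L_inf * wnorm (M k \<omega>) v" for v
        using b by (auto intro: mult_right_mono)
      then show ?case using elim(1) by (meson order_trans)
    qed
  qed
qed

lemma AE_samples:
  assumes Q: "AE s in P. Q s"
  shows "AE \<omega> in \<Omega>. \<forall>n. \<forall>i\<in>{1..m}. Q (S (Suc n) i \<omega>)"
proof -
  have "AE \<omega> in \<Omega>. Q (S (Suc n) i \<omega>)" if i: "i \<in> {1..m}" for n i
  proof (rule AE_distrD[where M=\<Omega> and M'=P and f="S (Suc n) i"])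
    show "S (Suc n) i \<in> measurable \<Omega> P" using i by (intro iid_samples_measurable[OF prob_Om iid]) auto
    have law: "distr \<Omega> P (S (Suc n) i) = P" using iid i by (auto simp: iid_samples_def)
    show "AE s in distr \<Omega> P (S (Suc n) i). Q s" unfolding law by (rule Q)
  qed
  then show ?thesis by (simp add: AE_all_countable AE_ball_countable)
qed

lemma r_proper: "proper r" using regular unfolding regularity_def by (elim conjE)

lemma r_closed: "closed_fun r" using regular unfolding regularity_def by (elim conjE)

lemma dom_V: "effdom r \<subseteq> V" using family unfolding model_family_def by (elim conjE)

lemma minimizer_dom: assumes "xs \<in> X" shows "xs \<in> effdom r"
proof -
  obtain y where "y \<in> effdom r" using r_proper by (auto simp: proper_def)
  then have "objective P f r y < \<infinity>" by (simp add: effdom_def objective_def)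
  moreover have "objective P f r xs \<le> objective P f r y"
    using assms by (auto simp: argmin_def is_arg_min_def not_less)
  ultimately show ?thesis by (cases "r xs") (auto simp: effdom_def objective_def)
qed

lemma objective_real: "y \<in> effdom r \<Longrightarrow> objective P f r y = ereal (risk P f y + R y)"
  by (subst objective_def, subst effdom_real[OF r_proper]) auto

abbreviation "excess xs z \<equiv> risk P f z + R z - (risk P f xs + R xs)"

lemma minimizer_le:
  assumes "xs \<in> X" "y \<in> effdom r" shows "risk P f xs + R xs \<le> risk P f y + R y"
proof -
  have "objective P f r xs \<le> objective P f r y"
    using assms by (auto simp: argmin_def is_arg_min_def not_less)
  then show ?thesis using objective_real[OF minimizer_dom[OF assms(1)]] objective_real[OF assms(2)] by simp
qed

text \<open>
  At a minimizer \<open>0\<close> is a subgradient of the objective, so the sample subgradients may be selected with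
  mean \<open>0\<close>. This is what removes the term of first order in the stepsize.
\<close>

lemma centred_selection:
  assumes "xs \<in> X"
  obtains g where "g \<in> borel_measurable P"
    "AE s in P. g s \<in> subdifferential (sample_objective f r s) xs"
    "integrable P g" "(\<integral>s. g s \<partial>P) = 0" "integrable P (\<lambda>s. (norm (g s))\<^sup>2)"
proof -
  have "0 \<in> subdifferential (objective P f r) xs"
    using objective_real[OF minimizer_dom[OF assms]]
    by (intro argmin_imp_zero_subdifferential[OF assms]) auto
  then obtain g where g: "g \<in> borel_measurable P"
    "AE s in P. g s \<in> subdifferential (sample_objective f r s) xs"
    "integrable P g" "(\<integral>s. g s \<partial>P) = 0"
    using bspec[OF bspec[OF selection assms] \<open>0 \<in> subdifferential (objective P f r) xs\<close>] by (elim bexE conjE)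
  obtain \<sigma> where "(\<integral>\<^sup>+ s. ennreal ((norm (g s))\<^sup>2) \<partial>P) \<le> ennreal (\<sigma>\<^sup>2)"
  proof -
    from selection_bounded obtain \<sigma> where "\<forall>xs \<in> X. \<forall>g \<in> borel_measurable P.
           (AE s in P. g s \<in> subdifferential (sample_objective f r s) xs) \<longrightarrow>
           (\<integral>\<^sup>+ s. ennreal ((norm (g s))\<^sup>2) \<partial>P) \<le> ennreal (\<sigma>\<^sup>2)" by (elim exE conjE)
    from bspec[OF bspec[OF this assms] g(1)] g(2) show ?thesis by (intro that) (rule mp)
  qed
  then have "(\<integral>\<^sup>+ s. ennreal ((norm (g s))\<^sup>2) \<partial>P) < \<infinity>"
    by (rule order_le_less_trans) (simp add: ennreal_less_top)
  then have "integrable P (\<lambda>s. (norm (g s))\<^sup>2)"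
    using g(1) by (intro integrableI_nonneg) auto
  with g show ?thesis by (rule that)
qed

abbreviation "fbar n \<omega> y \<equiv> 1 / real m * (\<Sum>i=1..m. fm (x (Suc n) \<omega>) y (S (Suc n) i \<omega>))"

text \<open>
  The exact proximal point \<open>z\<close> is a pathwise object. It is never integrated, so no measurable choice of it
  is made.
\<close>

lemma AE_step:
  "AE \<omega> in \<Omega>. \<forall>n. x (Suc n) \<omega> \<in> V \<and>
    (\<exists>z\<in>effdom r. wnorm (M (Suc n) \<omega>) (x (Suc (Suc n)) \<omega> - z) \<le> \<gamma> * (\<alpha> (Suc n))\<^sup>2 \<and>
      (\<forall>xs\<in>effdom r. (wnorm (M (Suc n) \<omega>) (z - xs))\<^sup>2
         \<le> (wnorm (M (Suc n) \<omega>) (x (Suc n) \<omega> - xs))\<^sup>2 - (wnorm (M (Suc n) \<omega>) (z - x (Suc n) \<omega>))\<^sup>2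
           + 2 * \<alpha> (Suc n) * (fbar n \<omega> xs + R xs - (fbar n \<omega> z + R z))))"
proof -
  obtain x0 where x0: "x0 \<in> X" using argmin_nonempty by blast
  obtain g where g: "AE s in P. g s \<in> subdifferential (sample_objective f r s) x0"
    using centred_selection[OF x0] by metis
  have "AE \<omega> in \<Omega>. \<forall>k\<ge>1. x k \<omega> \<in> V \<and> inexact_step (M k \<omega>) 0 (\<alpha> k) (\<epsilon> k)
          (minibatch_objective fm r m (x k \<omega>) (\<lambda>i. S k i \<omega>)) (x k \<omega>) (x (k + 1) \<omega>)"
    using iterates unfolding ispPPA_def by (elim conjE)
  with AE_norm_equiv AE_samples[OF g] AE_samples[OF AE_exact_convex_sample[OF accuracy regular]] AE_space
  show ?thesis
  proof eventually_elim
    case (elim \<omega>)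
    show ?case
    proof
      fix n
      have st: "x (Suc n) \<omega> \<in> V" "inexact_step (M (Suc n) \<omega>) 0 (\<alpha> (Suc n)) (\<gamma> * (\<alpha> (Suc n))\<^sup>2)
          (minibatch_objective fm r m (x (Suc n) \<omega>) (\<lambda>i. S (Suc n) i \<omega>)) (x (Suc n) \<omega>) (x (Suc (Suc n)) \<omega>)"
        using elim(5)[rule_format, of "Suc n"] \<epsilon>_eq by simp_all
      show "x (Suc n) \<omega> \<in> V \<and>
    (\<exists>z\<in>effdom r. wnorm (M (Suc n) \<omega>) (x (Suc (Suc n)) \<omega> - z) \<le> \<gamma> * (\<alpha> (Suc n))\<^sup>2 \<and>
      (\<forall>xs\<in>effdom r. (wnorm (M (Suc n) \<omega>) (z - xs))\<^sup>2
         \<le> (wnorm (M (Suc n) \<omega>) (x (Suc n) \<omega> - xs))\<^sup>2 - (wnorm (M (Suc n) \<omega>) (z - x (Suc n) \<omega>))\<^sup>2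
           + 2 * \<alpha> (Suc n) * (fbar n \<omega> xs + R xs - (fbar n \<omega> z + R z))))"
      proof (rule conjI[OF st(1)], rule minibatch_step[OF m_pos _ dom_V st(1) r_proper r_closed])
        show "inexact_step (M (Suc n) \<omega>) 0 (\<alpha> (Suc n)) (\<gamma> * (\<alpha> (Suc n))\<^sup>2)
          (minibatch_objective fm r m (x (Suc n) \<omega>) (\<lambda>i. S (Suc n) i \<omega>)) (x (Suc n) \<omega>) (x (Suc (Suc n)) \<omega>)"
          by (rule st(2))
        show "exact_convex_sample f r V fm (S (Suc n) i \<omega>)" if "i \<in> {1..m}" for i using elim(3) that by blast
        show "g (S (Suc n) i \<omega>) \<in> subdifferential (sample_objective f r (S (Suc n) i \<omega>)) x0" if "i \<in> {1..m}" for i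
          using elim(2) that by blast
        show "norm v \<le> L_inf * wnorm (M (Suc n) \<omega>) v" for v using elim(1) by blast
      qed (use x0 minimizer_dom spd_M[OF elim(4)] L_pos \<alpha>_pos \<gamma>_nonneg in auto)
    qed
  qed
qed

section \<open>Boundedness of the iterates\<close>


abbreviation "a n \<equiv> \<alpha> (Suc n)"

text \<open>
  The sum serves also as a bound for each single squared stepsize.
\<close>

definition "K = (\<Sum>n. (a n)\<^sup>2)"

abbreviation "sqdist xs n \<omega> \<equiv> (wnorm (M n \<omega>) (x (Suc n) \<omega> - xs))\<^sup>2"

abbreviation "sqdist_pre xs n \<omega> \<equiv> (wnorm (M (Suc n) \<omega>) (x (Suc n) \<omega> - xs))\<^sup>2"

abbreviation "inexactness n \<equiv> \<gamma>\<^sup>2 * (1 + K) * (a n)\<^sup>2"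

lemma a_sq_le: "(a n)\<^sup>2 \<le> K"
  unfolding K_def using sum_le_suminf[OF steps_sq_summable, of "{n}"] by simp

lemma K_nonneg: "0 \<le> K" by (rule order_trans[OF zero_le_power2 a_sq_le[of 0]])

lemma wsq_measurable:
  assumes "v \<in> borel_measurable \<Omega>"
  shows "(\<lambda>\<omega>. (wnorm (M k \<omega>) (v \<omega>))\<^sup>2) \<in> borel_measurable \<Omega>"
proof -
  have "(\<lambda>\<omega>. wnorm (M k \<omega>) (v \<omega>)) \<in> borel_measurable \<Omega>"
    by (rule borel_measurable_wnorm[OF spd_linear[OF spd_M] F_measurable[OF M_measurable] assms])
  then show ?thesis by measurable
qed

lemma wsq_measurable_F:
  assumes "v \<in> borel_measurable (F k)"
  shows "(\<lambda>\<omega>. (wnorm (M k \<omega>) (v \<omega>))\<^sup>2) \<in> borel_measurable (F k)"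
proof -
  have "(\<lambda>\<omega>. wnorm (M k \<omega>) (v \<omega>)) \<in> borel_measurable (F k)"
    by (rule borel_measurable_wnorm[OF _ M_measurable assms]) (use spd_linear[OF spd_M] in simp)
  then show ?thesis by measurable
qed

lemma AE_wsq_le: "AE \<omega> in \<Omega>. \<forall>k v. (wnorm (M k \<omega>) v)\<^sup>2 \<le> (norm v)\<^sup>2 / \<mu>_inf\<^sup>2"
  using AE_norm_equiv AE_space
proof eventually_elim
  case (elim \<omega>)
  show ?case
    by (intro allI wnorm_sq_le[OF spd_M[OF elim(2)] \<mu>_pos]) (use elim(1) in blast)
qed

lemma AE_le_wsq: "AE \<omega> in \<Omega>. \<forall>k v. (norm v)\<^sup>2 \<le> L_inf\<^sup>2 * (wnorm (M k \<omega>) v)\<^sup>2"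
  using AE_norm_equiv
proof eventually_elim
  case (elim \<omega>)
  have "(norm v)\<^sup>2 \<le> (L_inf * wnorm (M k \<omega>) v)\<^sup>2" for k v
    using elim by (intro power_mono) auto
  then show ?case by (simp add: power_mult_distrib)
qed

lemma wsq_integrable:
  assumes v: "v \<in> borel_measurable \<Omega>" "integrable \<Omega> (\<lambda>\<omega>. (norm (v \<omega>))\<^sup>2)"
  shows "integrable \<Omega> (\<lambda>\<omega>. (wnorm (M k \<omega>) (v \<omega>))\<^sup>2)"
proof (rule Bochner_Integration.integrable_bound)
  show "integrable \<Omega> (\<lambda>\<omega>. (norm (v \<omega>))\<^sup>2 / \<mu>_inf\<^sup>2)" using v(2) by simp
  show "AE \<omega> in \<Omega>. norm ((wnorm (M k \<omega>) (v \<omega>))\<^sup>2) \<le> norm ((norm (v \<omega>))\<^sup>2 / \<mu>_inf\<^sup>2)"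
    using AE_wsq_le by eventually_elim auto
qed (rule wsq_measurable[OF v(1)])

lemma integrable_indicator_mult:
  fixes h :: "'w \<Rightarrow> real"
  assumes "A \<in> sets \<Omega>" "integrable \<Omega> h" shows "integrable \<Omega> (\<lambda>\<omega>. indicator A \<omega> * h \<omega>)"
  using integrable_real_mult_indicator[OF assms] by (simp add: mult.commute)

lemma preconditioner_change:
  assumes A: "A \<in> sets (F n)" and v: "v \<in> borel_measurable (F n)" "integrable \<Omega> (\<lambda>\<omega>. (norm (v \<omega>))\<^sup>2)"
  shows "(\<integral>\<omega>. indicator A \<omega> * (wnorm (M (Suc n) \<omega>) (v \<omega>))\<^sup>2 \<partial>\<Omega>)
    \<le> (\<rho> (Suc n))\<^sup>2 * (\<integral>\<omega>. indicator A \<omega> * (wnorm (M n \<omega>) (v \<omega>))\<^sup>2 \<partial>\<Omega>)"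
proof (rule integral_wnorm_le_past[OF prob_Om subalg spd_M spd_M M_measurable F_measurable[OF M_measurable] \<mu>_pos _ _ L_pos _ _ v A])
  show "AE \<omega> in \<Omega>. \<forall>v. \<mu>_inf * wnorm (M n \<omega>) v \<le> norm v" using AE_norm_equiv by eventually_elim blast
  show "AE \<omega> in \<Omega>. \<forall>v. \<mu>_inf * wnorm (M (Suc n) \<omega>) v \<le> norm v" using AE_norm_equiv by eventually_elim blast
  show "AE \<omega> in \<Omega>. \<forall>v. norm v \<le> L_inf * wnorm (M n \<omega>) v" using AE_norm_equiv by eventually_elim blast
  fix v :: 'a assume "v \<noteq> 0"
  then have "AE \<omega> in \<Omega>. 1 / (\<rho> (Suc n))\<^sup>2 \<le> real_cond_exp \<Omega> (F (Suc n - 1))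
               (\<lambda>\<omega>. (wnorm (M (Suc n) \<omega>) v)\<^sup>2 / (wnorm (M (Suc n - 1) \<omega>) v)\<^sup>2) \<omega> \<and>
             real_cond_exp \<Omega> (F (Suc n - 1))
               (\<lambda>\<omega>. (wnorm (M (Suc n) \<omega>) v)\<^sup>2 / (wnorm (M (Suc n - 1) \<omega>) v)\<^sup>2) \<omega> \<le> (\<rho> (Suc n))\<^sup>2"
    using precond_Suc[of n] by blast
  then show "AE \<omega> in \<Omega>. real_cond_exp \<Omega> (F n)
      (\<lambda>\<omega>. (wnorm (M (Suc n) \<omega>) v)\<^sup>2 / (wnorm (M n \<omega>) v)\<^sup>2) \<omega> \<le> (\<rho> (Suc n))\<^sup>2"
    unfolding diff_Suc_1 by eventually_elim blast
qed

lemma S_measurable: "i \<in> {1..m} \<Longrightarrow> S (Suc n) i \<in> measurable \<Omega> P"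
  by (rule iid_samples_measurable[OF prob_Om iid]) auto

lemma S_distr: "i \<in> {1..m} \<Longrightarrow> distr \<Omega> P (S (Suc n) i) = P"
  using iid by (auto simp: iid_samples_def)

lemma sample_integrable:
  fixes h :: "'s \<Rightarrow> 'b::{banach, second_countable_topology}"
  assumes "i \<in> {1..m}" "integrable P h" shows "integrable \<Omega> (\<lambda>\<omega>. h (S (Suc n) i \<omega>))"
  using integrable_distr[OF S_measurable[OF assms(1), of n], where f=h] assms(2) S_distr[OF assms(1), of n] by simp

lemma sample_freeze:
  fixes H :: "'w \<times> 's \<Rightarrow> real"
  assumes "i \<in> {1..m}" "H \<in> borel_measurable (F n \<Otimes>\<^sub>M P)" "integrable \<Omega> (\<lambda>\<omega>. H (\<omega>, S (Suc n) i \<omega>))"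
  shows "(\<integral>\<omega>. H (\<omega>, S (Suc n) i \<omega>) \<partial>\<Omega>) = (\<integral>\<omega>. (\<integral>s. H (\<omega>, s) \<partial>P) \<partial>\<Omega>)"
  by (rule integral_freeze_past[OF prob_Om prob_P iid _ assms]) simp

lemma sample_indicator_integral:
  fixes h :: "'s \<Rightarrow> real"
  assumes i: "i \<in> {1..m}" and h: "integrable P h" and A: "A \<in> sets (F n)"
  shows "(\<integral>\<omega>. indicator A \<omega> * h (S (Suc n) i \<omega>) \<partial>\<Omega>) = (\<integral>s. h s \<partial>P) * prob A"
proof -
  have [measurable]: "h \<in> borel_measurable P" "A \<in> sets (F n)" using h A by auto
  have "(\<integral>\<omega>. indicator A \<omega> * h (S (Suc n) i \<omega>) \<partial>\<Omega>) = (\<integral>\<omega>. (\<integral>s. indicator A \<omega> * h s \<partial>P) \<partial>\<Omega>)"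
    using sample_freeze[OF i, of "\<lambda>(\<omega>, s). indicator A \<omega> * h s" n]
      integrable_indicator_mult[OF F_sets[OF A] sample_integrable[OF i h, of n]] by simp
  also have "\<dots> = (\<integral>\<omega>. (\<integral>s. h s \<partial>P) * indicator A \<omega> \<partial>\<Omega>)" using h by (simp add: mult.commute)
  also have "\<dots> = (\<integral>s. h s \<partial>P) * prob A" using F_sets[OF A] by simp
  finally show ?thesis .
qed

definition "factor_excess n = (1 + (a n)\<^sup>2) * (\<rho> (Suc n))\<^sup>2 - 1"

lemma factor_excess_nonneg: "0 \<le> factor_excess n"
proof -
  have "1 * 1 \<le> (1 + (a n)\<^sup>2) * (\<rho> (Suc n))\<^sup>2"
    using \<rho>_ge_1[of "Suc n"] by (intro mult_mono) auto
  then show ?thesis by (simp add: factor_excess_def)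
qed

lemma factor_excess_summable: "summable factor_excess"
proof -
  have "convergent_prod \<rho>" using precond unfolding preconditioner_condition_def by (elim conjE)
  then have "summable (\<lambda>k. (\<rho> k)\<^sup>2 - 1)" using \<rho>_ge_1 by (rule summable_sq_minus_one)
  then have s: "summable (\<lambda>n. (\<rho> (Suc n))\<^sup>2 - 1)" by (subst summable_Suc_iff)
  have "summable (\<lambda>n. (1 + K) * ((\<rho> (Suc n))\<^sup>2 - 1) + (a n)\<^sup>2)"
    by (intro summable_add summable_mult s steps_sq_summable)
  then show ?thesis
  proof (rule summable_comparison_test'[where N=0])
    fix n
    have "factor_excess n = (1 + (a n)\<^sup>2) * ((\<rho> (Suc n))\<^sup>2 - 1) + (a n)\<^sup>2"
      by (simp add: factor_excess_def algebra_simps)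
    also have "\<dots> \<le> (1 + K) * ((\<rho> (Suc n))\<^sup>2 - 1) + (a n)\<^sup>2"
      using a_sq_le[of n] \<rho>_ge_1[of "Suc n"] by (intro add_right_mono mult_right_mono) auto
    finally show "norm (factor_excess n) \<le> (1 + K) * ((\<rho> (Suc n))\<^sup>2 - 1) + (a n)\<^sup>2"
      using factor_excess_nonneg[of n] by simp
  qed
qed

context
  fixes xs :: 'a and g :: "'s \<Rightarrow> 'a"
  assumes xs: "xs \<in> X" and g: "g \<in> borel_measurable P"
    "AE s in P. g s \<in> subdifferential (sample_objective f r s) xs"
    "integrable P g" "(\<integral>s. g s \<partial>P) = 0" "integrable P (\<lambda>s. (norm (g s))\<^sup>2)"
begin

abbreviation "subgrad n \<omega> \<equiv> (1 / real m) *\<^sub>R (\<Sum>i=1..m. g (S (Suc n) i \<omega>))"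
definition "subgrad_var = (\<integral>s. (norm (g s))\<^sup>2 \<partial>P)"

text \<open>
  The minibatch subgradient at \<open>xs\<close> bounds the decrease of the objective. Its product with \<open>z - xs\<close> is
  split at \<open>x (Suc n)\<close>: the part along \<open>z - x (Suc n)\<close> is absorbed by the proximal term, at the price of a
  square.
\<close>

lemma AE_noise_recursion:
  "AE \<omega> in \<Omega>. \<forall>n. sqdist xs (Suc n) \<omega> \<le> (1 + (a n)\<^sup>2) * (sqdist_pre xs n \<omega>
      - 2 * a n * (subgrad n \<omega> \<bullet> (x (Suc n) \<omega> - xs)) + (a n)\<^sup>2 * L_inf\<^sup>2 * (norm (subgrad n \<omega>))\<^sup>2) + inexactness n"
  using AE_step AE_norm_equiv AE_samples[OF g(2)] AE_samples[OF AE_exact_convex_sample[OF accuracy regular]] AE_space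
proof eventually_elim
  case (elim \<omega>)
  show ?case
  proof
    fix n
    let ?M = "M (Suc n) \<omega>" and ?x = "x (Suc n) \<omega>"
    have spd: "spd ?M" by (rule spd_M[OF elim(5)])
    have xV: "?x \<in> V" using elim(1) by blast
    obtain z where z: "z \<in> effdom r" "wnorm ?M (x (Suc (Suc n)) \<omega> - z) \<le> \<gamma> * (a n)\<^sup>2"
      and step: "(wnorm ?M (z - xs))\<^sup>2 \<le> (wnorm ?M (?x - xs))\<^sup>2 - (wnorm ?M (z - ?x))\<^sup>2
           + 2 * a n * (fbar n \<omega> xs + R xs - (fbar n \<omega> z + R z))"
      using elim(1)[rule_format, of n] minimizer_dom[OF xs] by (elim conjE bexE) (rule that, assumption+, erule bspec)
    have "fbar n \<omega> xs + R xs + subgrad n \<omega> \<bullet> (z - xs) \<le> fbar n \<omega> z + R z"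
      using elim(3,4)
      by (intro minibatch_subgradient_ineq[OF m_pos _ dom_V xV r_proper r_closed _ minimizer_dom[OF xs] z(1)]) blast+
    then have "2 * a n * (fbar n \<omega> xs + R xs - (fbar n \<omega> z + R z)) \<le> 2 * a n * (- (subgrad n \<omega> \<bullet> (z - xs)))"
      using \<alpha>_pos[of n] by (intro mult_left_mono) auto
    also have "\<dots> = - 2 * a n * (subgrad n \<omega> \<bullet> (?x - xs)) + (- 2 * a n * (subgrad n \<omega> \<bullet> (z - ?x)))"
      by (simp add: inner_diff_right algebra_simps)
    also have "- 2 * a n * (subgrad n \<omega> \<bullet> (z - ?x)) \<le> (a n)\<^sup>2 * L_inf\<^sup>2 * (norm (subgrad n \<omega>))\<^sup>2 + (wnorm ?M (z - ?x))\<^sup>2"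
      using elim(2) \<alpha>_pos[of n] L_pos by (intro inner_le_young) auto
    finally have "(wnorm ?M (z - xs))\<^sup>2 \<le> (wnorm ?M (?x - xs))\<^sup>2
      - 2 * a n * (subgrad n \<omega> \<bullet> (?x - xs)) + (a n)\<^sup>2 * L_inf\<^sup>2 * (norm (subgrad n \<omega>))\<^sup>2"
      using step by linarith
    then have "(1 + (a n)\<^sup>2) * (wnorm ?M (z - xs))\<^sup>2 \<le> (1 + (a n)\<^sup>2) * ((wnorm ?M (?x - xs))\<^sup>2
      - 2 * a n * (subgrad n \<omega> \<bullet> (?x - xs)) + (a n)\<^sup>2 * L_inf\<^sup>2 * (norm (subgrad n \<omega>))\<^sup>2)"
      by (intro mult_left_mono) auto
    then show "sqdist xs (Suc n) \<omega> \<le> (1 + (a n)\<^sup>2) * (sqdist_pre xs n \<omega>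
      - 2 * a n * (subgrad n \<omega> \<bullet> (x (Suc n) \<omega> - xs)) + (a n)\<^sup>2 * L_inf\<^sup>2 * (norm (subgrad n \<omega>))\<^sup>2) + inexactness n"
      using wnorm_sq_inexact_le[OF spd \<alpha>_pos a_sq_le z(2), of xs] by linarith
  qed
qed

lemma subgrad_measurable: "subgrad n \<in> borel_measurable \<Omega>"
proof -
  have "(\<lambda>\<omega>. g (S (Suc n) i \<omega>)) \<in> borel_measurable \<Omega>" if "i \<in> {1..m}" for i
    using measurable_compose[OF S_measurable[OF that] g(1)] .
  then show ?thesis by (intro borel_measurable_scaleR borel_measurable_sum) auto
qed

lemma subgrad_sq_integrable: "integrable \<Omega> (\<lambda>\<omega>. (norm (subgrad n \<omega>))\<^sup>2)"
proof (rule Bochner_Integration.integrable_bound)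
  show "integrable \<Omega> (\<lambda>\<omega>. 1 / real m * (\<Sum>i=1..m. (norm (g (S (Suc n) i \<omega>)))\<^sup>2))"
    using sample_integrable[OF _ g(5)] by (intro integrable_mult_right Bochner_Integration.integrable_sum) auto
  show "AE \<omega> in \<Omega>. norm ((norm (subgrad n \<omega>))\<^sup>2) \<le> norm (1 / real m * (\<Sum>i=1..m. (norm (g (S (Suc n) i \<omega>)))\<^sup>2))"
    using norm_mean_sq_le[OF m_pos] by (intro AE_I2) (simp add: sum_nonneg)
qed (use subgrad_measurable in measurable)

lemma cross_integrable:
  assumes "integrable \<Omega> (\<lambda>\<omega>. (norm (x (Suc n) \<omega> - xs))\<^sup>2)"
  shows "integrable \<Omega> (\<lambda>\<omega>. subgrad n \<omega> \<bullet> (x (Suc n) \<omega> - xs))"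
proof (rule Bochner_Integration.integrable_bound)
  show "integrable \<Omega> (\<lambda>\<omega>. (norm (subgrad n \<omega>))\<^sup>2 + (norm (x (Suc n) \<omega> - xs))\<^sup>2)"
    by (intro Bochner_Integration.integrable_add subgrad_sq_integrable assms)
  show "AE \<omega> in \<Omega>. norm (subgrad n \<omega> \<bullet> (x (Suc n) \<omega> - xs)) \<le> norm ((norm (subgrad n \<omega>))\<^sup>2 + (norm (x (Suc n) \<omega> - xs))\<^sup>2)"
    by (rule AE_I2) (rule norm_inner_le_sum_squares)
qed (use subgrad_measurable[of n] x_measurable'[of n] in measurable)

text \<open>
  Integrability is inherited from step to step through the recursion.
\<close>

lemma x_sq_integrable: "integrable \<Omega> (\<lambda>\<omega>. (norm (x (Suc n) \<omega> - xs))\<^sup>2)"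
proof (induction n)
  case 0
  have "\<forall>\<omega>\<in>space \<Omega>. x 1 \<omega> = x1" using iterates unfolding ispPPA_def by (elim conjE)
  then have "integrable \<Omega> (\<lambda>\<omega>. (norm (x (Suc 0) \<omega> - xs))\<^sup>2) \<longleftrightarrow> integrable \<Omega> (\<lambda>\<omega>. (norm (x1 - xs))\<^sup>2)"
    by (intro Bochner_Integration.integrable_cong) auto
  then show ?case by simp
next
  case (Suc n)
  note [measurable] = x_measurable' subgrad_measurable
  define B where "B \<omega> = L_inf\<^sup>2 * ((1 + (a n)\<^sup>2) * (sqdist_pre xs n \<omega>
      - 2 * a n * (subgrad n \<omega> \<bullet> (x (Suc n) \<omega> - xs)) + (a n)\<^sup>2 * L_inf\<^sup>2 * (norm (subgrad n \<omega>))\<^sup>2) + inexactness n)" for \<omega>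
  show ?case
  proof (rule Bochner_Integration.integrable_bound)
    show "integrable \<Omega> B"
      unfolding B_def
      by (intro integrable_mult_right Bochner_Integration.integrable_add Bochner_Integration.integrable_diff
          integrable_const cross_integrable[OF Suc] subgrad_sq_integrable wsq_integrable Suc) measurable
    show "AE \<omega> in \<Omega>. norm ((norm (x (Suc (Suc n)) \<omega> - xs))\<^sup>2) \<le> norm (B \<omega>)"
      using AE_noise_recursion AE_le_wsq
    proof eventually_elim
      case (elim \<omega>)
      have "(norm (x (Suc (Suc n)) \<omega> - xs))\<^sup>2 \<le> L_inf\<^sup>2 * sqdist xs (Suc n) \<omega>" using elim(2) by blast
      also have "\<dots> \<le> B \<omega>" unfolding B_def using elim(1) by (intro mult_left_mono) auto
      finally show ?case by simp
    qed
  qed measurable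
qed


text \<open>
  The average subgradient is centred and independent of \<open>x (Suc n)\<close>. It enters the recursion paired
  with \<open>x (Suc n) - xs\<close> and not with the proximal point, which depends on the same minibatch.
\<close>

lemma cross_zero:
  assumes A: "A \<in> sets (F n)"
  shows "(\<integral>\<omega>. indicator A \<omega> * (subgrad n \<omega> \<bullet> (x (Suc n) \<omega> - xs)) \<partial>\<Omega>) = 0"
proof -
  note [measurable] = A x_measurable[of n] g(1)
  have sq: "integrable \<Omega> (\<lambda>\<omega>. (norm (g (S (Suc n) i \<omega>)))\<^sup>2)" if "i \<in> {1..m}" for i
    by (rule sample_integrable[OF that g(5)])
  have int: "integrable \<Omega> (\<lambda>\<omega>. indicator A \<omega> * (g (S (Suc n) i \<omega>) \<bullet> (x (Suc n) \<omega> - xs)))" if i: "i \<in> {1..m}" for i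
  proof (rule integrable_indicator_mult[OF F_sets[OF A]], rule Bochner_Integration.integrable_bound)
    show "integrable \<Omega> (\<lambda>\<omega>. (norm (g (S (Suc n) i \<omega>)))\<^sup>2 + (norm (x (Suc n) \<omega> - xs))\<^sup>2)"
      by (intro Bochner_Integration.integrable_add sq i x_sq_integrable)
    show "AE \<omega> in \<Omega>. norm (g (S (Suc n) i \<omega>) \<bullet> (x (Suc n) \<omega> - xs))
        \<le> norm ((norm (g (S (Suc n) i \<omega>)))\<^sup>2 + (norm (x (Suc n) \<omega> - xs))\<^sup>2)"
      by (rule AE_I2) (rule norm_inner_le_sum_squares)
    show "(\<lambda>\<omega>. g (S (Suc n) i \<omega>) \<bullet> (x (Suc n) \<omega> - xs)) \<in> borel_measurable \<Omega>"
      using measurable_compose[OF S_measurable[OF i, of n] g(1)] x_measurable'[of n] by measurable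
  qed
  have zero: "(\<integral>\<omega>. indicator A \<omega> * (g (S (Suc n) i \<omega>) \<bullet> (x (Suc n) \<omega> - xs)) \<partial>\<Omega>) = 0" if i: "i \<in> {1..m}" for i
  proof -
    have "(\<integral>\<omega>. indicator A \<omega> * (g (S (Suc n) i \<omega>) \<bullet> (x (Suc n) \<omega> - xs)) \<partial>\<Omega>)
       = (\<integral>\<omega>. (\<integral>s. indicator A \<omega> * (g s \<bullet> (x (Suc n) \<omega> - xs)) \<partial>P) \<partial>\<Omega>)"
      using sample_freeze[OF i, of "\<lambda>(\<omega>, s). indicator A \<omega> * (g s \<bullet> (x (Suc n) \<omega> - xs))" n] int[OF i]
      by simp
    also have "\<dots> = 0" using g(3,4) by simp
    finally show ?thesis .
  qed
  have "(\<integral>\<omega>. indicator A \<omega> * (subgrad n \<omega> \<bullet> (x (Suc n) \<omega> - xs)) \<partial>\<Omega>)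
     = (\<integral>\<omega>. 1 / real m * (\<Sum>i=1..m. indicator A \<omega> * (g (S (Suc n) i \<omega>) \<bullet> (x (Suc n) \<omega> - xs))) \<partial>\<Omega>)"
    by (intro Bochner_Integration.integral_cong refl) (simp only: inner_scaleR_left inner_sum_left sum_distrib_left mult.left_commute)
  also have "\<dots> = 1 / real m * (\<Sum>i=1..m. \<integral>\<omega>. indicator A \<omega> * (g (S (Suc n) i \<omega>) \<bullet> (x (Suc n) \<omega> - xs)) \<partial>\<Omega>)"
    by (rule integral_scaled_sum[OF int])
  finally show ?thesis by (simp add: zero)
qed

lemma noise_sq_le:
  assumes A: "A \<in> sets (F n)"
  shows "(\<integral>\<omega>. indicator A \<omega> * (norm (subgrad n \<omega>))\<^sup>2 \<partial>\<Omega>) \<le> subgrad_var * prob A"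
proof -
  let ?h = "\<lambda>i \<omega>. indicator A \<omega> * (norm (g (S (Suc n) i \<omega>)))\<^sup>2"
  have int: "integrable \<Omega> (?h i)" if "i \<in> {1..m}" for i
    by (rule integrable_indicator_mult[OF F_sets[OF A] sample_integrable[OF that g(5)]])
  have "(\<integral>\<omega>. indicator A \<omega> * (norm (subgrad n \<omega>))\<^sup>2 \<partial>\<Omega>) \<le> (\<integral>\<omega>. 1 / real m * (\<Sum>i=1..m. ?h i \<omega>) \<partial>\<Omega>)"
  proof (rule integral_mono)
    show "indicator A \<omega> * (norm (subgrad n \<omega>))\<^sup>2 \<le> 1 / real m * (\<Sum>i=1..m. ?h i \<omega>)" for \<omega>
      using norm_mean_sq_le[OF m_pos, of "\<lambda>i. g (S (Suc n) i \<omega>)"] by (auto simp: indicator_def)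
    show "integrable \<Omega> (\<lambda>\<omega>. indicator A \<omega> * (norm (subgrad n \<omega>))\<^sup>2)"
      by (rule integrable_indicator_mult[OF F_sets[OF A] subgrad_sq_integrable])
    show "integrable \<Omega> (\<lambda>\<omega>. 1 / real m * (\<Sum>i=1..m. ?h i \<omega>))"
      by (intro integrable_mult_right Bochner_Integration.integrable_sum int)
  qed
  also have "\<dots> = 1 / real m * (\<Sum>i=1..m. \<integral>\<omega>. ?h i \<omega> \<partial>\<Omega>)"
    by (rule integral_scaled_sum[OF int])
  also have "\<dots> = subgrad_var * prob A"
    using m_pos by (simp add: sample_indicator_integral[OF _ g(5) A] subgrad_var_def)
  finally show ?thesis .
qed

lemma dist_recursion:
  assumes A: "A \<in> sets (F n)"
  shows "(\<integral>\<omega>. indicator A \<omega> * sqdist xs (Suc n) \<omega> \<partial>\<Omega>)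
     \<le> (1 + (a n)\<^sup>2) * (\<rho> (Suc n))\<^sup>2 * (\<integral>\<omega>. indicator A \<omega> * sqdist xs n \<omega> \<partial>\<Omega>)
       + ((1 + K) * L_inf\<^sup>2 * subgrad_var + \<gamma>\<^sup>2 * (1 + K)) * (a n)\<^sup>2 * prob A"
proof -
  have A': "A \<in> sets \<Omega>" by (rule F_sets[OF A])
  have xF: "(\<lambda>\<omega>. x (Suc n) \<omega> - xs) \<in> borel_measurable (F n)" using x_measurable[of n] by measurable
  have xO: "(\<lambda>\<omega>. x (Suc k) \<omega> - xs) \<in> borel_measurable \<Omega>" for k using x_measurable'[of k] by measurable
  let ?W = "\<lambda>\<omega>. indicator A \<omega> * (wnorm (M (Suc n) \<omega>) (x (Suc n) \<omega> - xs))\<^sup>2"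
  let ?C = "\<lambda>\<omega>. indicator A \<omega> * (subgrad n \<omega> \<bullet> (x (Suc n) \<omega> - xs))"
  let ?N = "\<lambda>\<omega>. indicator A \<omega> * (norm (subgrad n \<omega>))\<^sup>2"
  let ?b = "(a n)\<^sup>2"
  have iW: "integrable \<Omega> ?W" by (rule integrable_indicator_mult[OF A' wsq_integrable[OF xO x_sq_integrable]])
  have iN: "integrable \<Omega> ?N" by (rule integrable_indicator_mult[OF A' subgrad_sq_integrable])
  have iC: "integrable \<Omega> ?C" by (rule integrable_indicator_mult[OF A' cross_integrable[OF x_sq_integrable]])
  have "(\<integral>\<omega>. indicator A \<omega> * sqdist xs (Suc n) \<omega> \<partial>\<Omega>)
     \<le> (\<integral>\<omega>. (1 + ?b) * (?W \<omega> - 2 * a n * ?C \<omega> + ?b * L_inf\<^sup>2 * ?N \<omega>) + inexactness n * indicator A \<omega> \<partial>\<Omega>)"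
  proof (rule integral_mono_AE)
    show "integrable \<Omega> (\<lambda>\<omega>. indicator A \<omega> * sqdist xs (Suc n) \<omega>)"
      by (rule integrable_indicator_mult[OF A' wsq_integrable[OF xO x_sq_integrable]])
    show "integrable \<Omega> (\<lambda>\<omega>. (1 + ?b) * (?W \<omega> - 2 * a n * ?C \<omega> + ?b * L_inf\<^sup>2 * ?N \<omega>) + inexactness n * indicator A \<omega>)"
      using A' by (intro Bochner_Integration.integrable_add Bochner_Integration.integrable_diff
          integrable_mult_right iW iN iC) (auto intro!: integrable_real_indicator simp: emeasure_eq_measure)
    show "AE \<omega> in \<Omega>. indicator A \<omega> * sqdist xs (Suc n) \<omega>
        \<le> (1 + ?b) * (?W \<omega> - 2 * a n * ?C \<omega> + ?b * L_inf\<^sup>2 * ?N \<omega>) + inexactness n * indicator A \<omega>"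
      using AE_noise_recursion
    proof eventually_elim
      case (elim \<omega>)
      then show ?case by (cases "\<omega> \<in> A") simp_all
    qed
  qed
  also have "\<dots> = (1 + ?b) * ((\<integral>\<omega>. ?W \<omega> \<partial>\<Omega>) - 2 * a n * (\<integral>\<omega>. ?C \<omega> \<partial>\<Omega>) + ?b * L_inf\<^sup>2 * (\<integral>\<omega>. ?N \<omega> \<partial>\<Omega>)) + inexactness n * prob A"
  proof -
    have "integrable \<Omega> (\<lambda>\<omega>. inexactness n * indicator A \<omega>)"
      using A' by (intro integrable_mult_right) (auto intro!: integrable_real_indicator simp: emeasure_eq_measure)
    from integral_affine_comb[OF iW iC iN this] show ?thesis using A' by simp
  qed
  also have "\<dots> \<le> (1 + ?b) * ((\<rho> (Suc n))\<^sup>2 * (\<integral>\<omega>. indicator A \<omega> * sqdist xs n \<omega> \<partial>\<Omega>) + ?b * L_inf\<^sup>2 * (subgrad_var * prob A)) + inexactness n * prob A"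
    unfolding cross_zero[OF A]
    using preconditioner_change[OF A xF x_sq_integrable] noise_sq_le[OF A]
    by (intro add_right_mono mult_left_mono add_mono) auto
  also have "\<dots> \<le> (1 + ?b) * (\<rho> (Suc n))\<^sup>2 * (\<integral>\<omega>. indicator A \<omega> * sqdist xs n \<omega> \<partial>\<Omega>)
       + ((1 + K) * L_inf\<^sup>2 * subgrad_var + \<gamma>\<^sup>2 * (1 + K)) * ?b * prob A"
  proof -
    have "0 \<le> subgrad_var" by (simp add: subgrad_var_def)
    then have "(1 + ?b) * (?b * L_inf\<^sup>2 * (subgrad_var * prob A)) \<le> (1 + K) * (?b * L_inf\<^sup>2 * (subgrad_var * prob A))"
      using a_sq_le[of n] by (intro mult_right_mono) auto
    then show ?thesis by (simp add: algebra_simps)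
  qed
  finally show ?thesis .
qed

lemma AE_dist_convergent: "AE \<omega> in \<Omega>. convergent (\<lambda>n. sqdist xs n \<omega>)"
proof (rule robbins_siegmund[where F=F and b="\<lambda>n. ((1 + K) * L_inf\<^sup>2 * subgrad_var + \<gamma>\<^sup>2 * (1 + K)) * (a n)\<^sup>2" and a=factor_excess])
  show "prob_space \<Omega>" by (rule prob_Om)
  show "subalgebra \<Omega> (F n)" for n by (rule subalg)
  show "sets (F n) \<subseteq> sets (F (Suc n))" for n by (rule sample_filtration_mono) simp
  show "(\<lambda>\<omega>. sqdist xs n \<omega>) \<in> borel_measurable (F n)" for n
    by (rule wsq_measurable_F) (use x_measurable[of n] in measurable)
  show "integrable \<Omega> (\<lambda>\<omega>. sqdist xs n \<omega>)" for n
    by (rule wsq_integrable) (use x_measurable'[of n] x_sq_integrable in measurable)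
  show "0 \<le> sqdist xs n \<omega>" for n \<omega> by simp
  show "0 \<le> factor_excess n" for n by (rule factor_excess_nonneg)
  show "summable factor_excess" by (rule factor_excess_summable)
  show "0 \<le> ((1 + K) * L_inf\<^sup>2 * subgrad_var + \<gamma>\<^sup>2 * (1 + K)) * (a n)\<^sup>2" for n
    using K_nonneg by (intro mult_nonneg_nonneg add_nonneg_nonneg) (auto simp: subgrad_var_def)
  show "summable (\<lambda>n. ((1 + K) * L_inf\<^sup>2 * subgrad_var + \<gamma>\<^sup>2 * (1 + K)) * (a n)\<^sup>2)"
    by (rule summable_mult[OF steps_sq_summable])
  show "(\<integral>\<omega>. indicator A \<omega> * sqdist xs (Suc n) \<omega> \<partial>\<Omega>)
     \<le> (1 + factor_excess n) * (\<integral>\<omega>. indicator A \<omega> * sqdist xs n \<omega> \<partial>\<Omega>)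
       + ((1 + K) * L_inf\<^sup>2 * subgrad_var + \<gamma>\<^sup>2 * (1 + K)) * (a n)\<^sup>2 * prob A" if "A \<in> sets (F n)" for n A
    using dist_recursion[OF that] by (simp add: factor_excess_def)
qed

end

lemma AE_dist_to_minimizer_convergent:
  assumes "xs \<in> X"
  shows "AE \<omega> in \<Omega>. convergent (\<lambda>n. sqdist xs n \<omega>)"
proof -
  obtain g where "g \<in> borel_measurable P"
    "AE s in P. g s \<in> subdifferential (sample_objective f r s) xs"
    "integrable P g" "(\<integral>s. g s \<partial>P) = 0" "integrable P (\<lambda>s. (norm (g s))\<^sup>2)"
    by (rule centred_selection[OF assms])
  from AE_dist_convergent[OF assms this] show ?thesis .
qed

lemma AE_bounded: "AE \<omega> in \<Omega>. \<exists>B. \<forall>n. norm (x (Suc n) \<omega>) \<le> B"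
proof -
  obtain xs where "xs \<in> X" using argmin_nonempty by blast
  from AE_dist_to_minimizer_convergent[OF this] AE_le_wsq show ?thesis
  proof eventually_elim
    case (elim \<omega>)
    from convergent_imp_Bseq[OF elim(1)] obtain B where
      B: "\<And>n. norm ((wnorm (M n \<omega>) (x (Suc n) \<omega> - xs))\<^sup>2) \<le> B" by (auto simp: Bseq_def)
    have "norm (x (Suc n) \<omega>) \<le> sqrt (L_inf\<^sup>2 * B) + norm xs" for n
    proof -
      have "(norm (x (Suc n) \<omega> - xs))\<^sup>2 \<le> L_inf\<^sup>2 * (wnorm (M n \<omega>) (x (Suc n) \<omega> - xs))\<^sup>2" using elim(2) by blast
      also have "\<dots> \<le> L_inf\<^sup>2 * B" using B[of n] by (intro mult_left_mono) auto
      finally have "norm (x (Suc n) \<omega> - xs) \<le> sqrt (L_inf\<^sup>2 * B)" by (rule real_le_rsqrt)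
      moreover have "norm (x (Suc n) \<omega>) \<le> norm (x (Suc n) \<omega> - xs) + norm xs"
        using norm_triangle_ineq[of "x (Suc n) \<omega> - xs" xs] by simp
      ultimately show ?thesis by linarith
    qed
    then show ?case by blast
  qed
qed

section \<open>Deterministic conclusion\<close>

lemma risk_continuous: "isCont (risk P f) y"
proof -
  have "\<forall>x. \<exists>u>0. \<exists>L. L-lipschitz_on (cball x u) (risk P f)"
    using regular unfolding regularity_def by (elim conjE)
  then obtain u L where u: "0 < u" and L: "L-lipschitz_on (cball y u) (risk P f)" by blast
  have "continuous_on (cball y u) (risk P f)" by (rule lipschitz_on_continuous_on[OF L])
  then show ?thesis
    by (rule continuous_on_interior) (use u in simp)
qed

text \<open>
  The epigraph of \<open>r\<close> is closed and the risk is continuous, so the value of the objective at the limit is at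
  most the limit of the values.
\<close>

lemma minimizer_limit:
  assumes xs: "xs \<in> X" and w: "\<And>j. w j \<in> effdom r" "w \<longlonglongrightarrow> y"
    and val: "(\<lambda>j. risk P f (w j) + R (w j)) \<longlonglongrightarrow> risk P f xs + R xs"
  shows "y \<in> X"
proof -
  have risk: "(\<lambda>j. risk P f (w j)) \<longlonglongrightarrow> risk P f y"
    by (rule isCont_tendsto_compose[OF risk_continuous w(2)])
  have "(\<lambda>j. R (w j)) \<longlonglongrightarrow> risk P f xs + R xs - risk P f y"
    using tendsto_diff[OF val risk] by simp
  then have lim: "(\<lambda>j. (w j, R (w j))) \<longlonglongrightarrow> (y, risk P f xs + R xs - risk P f y)"
    by (rule tendsto_Pair[OF w(2)])
  have "(w j, R (w j)) \<in> ereal_epigraph r" for j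
    using effdom_real[OF r_proper w(1)[of j]] by (simp add: ereal_epigraph_def)
  then have "(y, risk P f xs + R xs - risk P f y) \<in> ereal_epigraph r"
    using closed_sequentially[OF r_closed[unfolded closed_fun_def] _ lim] by blast
  then have "ereal (risk P f y) + r y \<le> ereal (risk P f y) + ereal (risk P f xs + R xs - risk P f y)"
    by (intro add_left_mono) (simp add: ereal_epigraph_def)
  then have "objective P f r y \<le> objective P f r xs"
    unfolding objective_real[OF minimizer_dom[OF xs]] by (simp add: objective_def)
  then show ?thesis using xs unfolding argmin_def is_arg_min_def
    by (auto simp: not_less intro: order_trans)
qed

lemma convergence_to_minimizer:
  fixes Y :: "nat \<Rightarrow> 'a"
  assumes xs: "xs \<in> X"
    and \<mu>': "0 < \<mu>'" "\<And>n v. (wnorm (N n) v)\<^sup>2 \<le> (norm v)\<^sup>2 / \<mu>'\<^sup>2"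
    and L': "0 < L'" "\<And>n v. (norm v)\<^sup>2 \<le> L'\<^sup>2 * (wnorm (N n) v)\<^sup>2"
    and T: "X \<subseteq> closure T" "\<And>d. d \<in> T \<Longrightarrow> convergent (\<lambda>n. (wnorm (N n) (Y n - d))\<^sup>2)"
    and bdd: "\<And>n. norm (Y n) \<le> B"
    and step: "\<And>n. \<exists>z\<in>effdom r. norm (Y (Suc n) - z) \<le> \<delta> n \<and>
        2 * \<alpha>' n * excess xs z \<le> e n"
    and \<delta>: "\<delta> \<longlonglongrightarrow> 0" and e: "summable e" and \<alpha>': "\<And>n. 0 < \<alpha>' n" "\<not> summable \<alpha>'"
  shows "\<exists>y\<in>X. Y \<longlonglongrightarrow> y"
proof -
  define gap where "gap z = excess xs z" for z
  obtain z where z: "\<And>n. z n \<in> effdom r" "\<And>n. norm (Y (Suc n) - z n) \<le> \<delta> n"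
      "\<And>n. 2 * \<alpha>' n * gap (z n) \<le> e n"
    using step unfolding gap_def by metis
  have gap0: "0 \<le> gap (z n)" for n using minimizer_le[OF xs z(1)[of n]] by (simp add: gap_def)
  have "\<exists>n\<ge>k. gap (z n) < 1 / real (Suc k)" for k
    by (rule small_gap_infinitely_often[OF \<alpha>' e z(3)]) simp
  then obtain p where p: "\<And>k. k \<le> p k" "\<And>k. gap (z (p k)) < 1 / real (Suc k)" by metis
  have ptop: "filterlim p at_top sequentially"
    by (rule filterlim_at_top_mono[OF filterlim_ident]) (use p(1) in simp)
  obtain C where C: "\<And>n. \<delta> n \<le> C"
    using convergent_imp_Bseq[of \<delta>] \<delta> by (auto simp: convergent_def Bseq_def abs_le_iff)
  have "bounded (range (\<lambda>k. Y (Suc (p k))))" using bdd by (auto simp: bounded_iff)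
  from bounded_imp_convergent_subsequence[OF this] obtain y s
    where s: "strict_mono s" and y: "((\<lambda>k. Y (Suc (p k))) \<circ> s) \<longlonglongrightarrow> y" by blast
  have stop: "filterlim s at_top sequentially" by (rule filterlim_subseq[OF s])
  define q where "q j = p (s j)" for j
  have qtop: "filterlim q at_top sequentially" unfolding q_def by (rule filterlim_compose[OF ptop stop])
  have Yq: "(\<lambda>j. Y (Suc (q j))) \<longlonglongrightarrow> y" using y by (simp add: q_def comp_def)
  have \<delta>q: "(\<lambda>j. \<delta> (q j)) \<longlonglongrightarrow> 0" by (rule filterlim_compose[OF \<delta> qtop])
  have zq: "(\<lambda>j. z (q j)) \<longlonglongrightarrow> y"
    by (rule tendsto_of_le_null[OF _ \<delta>q Yq]) (use z(2) norm_minus_commute in metis)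
  have "(\<lambda>j. gap (z (q j))) \<longlonglongrightarrow> 0"
  proof (rule Lim_null_comparison)
    show "eventually (\<lambda>j. norm (gap (z (q j))) \<le> 1 / real (Suc (s j))) sequentially"
      using p(2) gap0 by (intro always_eventually) (simp add: q_def less_imp_le)
    have "(\<lambda>k. 1 / real (Suc k)) \<longlonglongrightarrow> 0" using LIMSEQ_inverse_real_of_nat by (simp add: inverse_eq_divide)
    then show "(\<lambda>j. 1 / real (Suc (s j))) \<longlonglongrightarrow> 0" by (rule filterlim_compose[OF _ stop])
  qed
  from tendsto_add[OF this tendsto_const[of "risk P f xs + R xs"]]
  have "(\<lambda>j. risk P f (z (q j)) + R (z (q j))) \<longlonglongrightarrow> risk P f xs + R xs" by (simp add: gap_def)
  then have yX: "y \<in> X" by (rule minimizer_limit[OF xs z(1) zq])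
  have Sq: "filterlim (\<lambda>j. Suc (q j)) at_top sequentially"
    by (rule filterlim_compose[OF filterlim_Suc qtop])
  have "Y \<longlonglongrightarrow> y"
  proof (rule cluster_point_imp_limit[where T=T, OF \<mu>' L' _ _ Sq Yq])
    show "convergent (\<lambda>n. (wnorm (N n) (Y n - d))\<^sup>2)" if "d \<in> T" for d by (rule T(2)[OF that])
    show "y \<in> closure T" using yX T(1) by blast
  qed
  with yX show ?thesis by blast
qed

section \<open>Summability of the objective gaps\<close>


lemma x_minus_minimizer_sq_integrable:
  assumes "xs \<in> X" shows "integrable \<Omega> (\<lambda>\<omega>. (norm (x (Suc n) \<omega> - xs))\<^sup>2)"
proof -
  obtain g where "g \<in> borel_measurable P"
    "AE s in P. g s \<in> subdifferential (sample_objective f r s) xs"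
    "integrable P g" "(\<integral>s. g s \<partial>P) = 0" "integrable P (\<lambda>s. (norm (g s))\<^sup>2)"
    by (rule centred_selection[OF assms])
  from x_sq_integrable[OF assms this] show ?thesis .
qed

text \<open>
  The Lipschitz constants depend on a bounded set, hence the localization to paths in the ball of radius
  \<open>\<beta>\<close>. The set \<open>U\<close> contains the minimizer \<open>xs\<close>, the iterates of such paths, and also their exact proximal points,
  which lie within \<open>L_inf * (\<gamma> * K)\<close> of the iterates.
\<close>

context
  fixes xs :: 'a and \<beta> :: real and U :: "'a set" and Lf :: "'s \<Rightarrow> real"
  assumes xs: "xs \<in> X" and \<beta>: "0 \<le> \<beta>"
    and U: "U = V \<inter> cball 0 (\<beta> + L_inf * (\<gamma> * K) + norm xs)"
    and Lf: "Lf \<in> borel_measurable P" "\<And>s. 0 \<le> Lf s" "integrable P (\<lambda>s. (Lf s)\<^sup>2)"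
      "AE s in P. \<forall>y\<in>U. \<forall>z\<in>U. \<bar>fm y y s - fm y z s\<bar> \<le> Lf s * norm (y - z)"
begin

lemma xs_V: "xs \<in> V" using minimizer_dom[OF xs] dom_V by blast

lemma xs_U: "xs \<in> U" using xs_V \<beta> L_pos \<gamma>_nonneg K_nonneg by (simp add: U)

lemma in_U: "y \<in> V \<Longrightarrow> norm y \<le> \<beta> + L_inf * (\<gamma> * K) \<Longrightarrow> y \<in> U"
proof -
  assume y: "y \<in> V" "norm y \<le> \<beta> + L_inf * (\<gamma> * K)"
  then have "norm y \<le> \<beta> + L_inf * (\<gamma> * K) + norm xs" using norm_ge_zero[of xs] by linarith
  with y(1) show "y \<in> U" by (simp add: U)
qed

lemma x_in_U: "y \<in> V \<Longrightarrow> norm y \<le> \<beta> \<Longrightarrow> y \<in> U"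
proof -
  assume "y \<in> V" "norm y \<le> \<beta>"
  moreover have "0 \<le> L_inf * (\<gamma> * K)" using L_pos \<gamma>_nonneg K_nonneg by simp
  ultimately show "y \<in> U" by (intro in_U) auto
qed

lemma Lf_integrable: "integrable P Lf"
proof (rule Bochner_Integration.integrable_bound)
  show "integrable P (\<lambda>s. 1 + (Lf s)\<^sup>2)" using Lf(3) by simp
  show "AE s in P. norm (Lf s) \<le> norm (1 + (Lf s)\<^sup>2)"
  proof (rule AE_I2)
    fix s
    have "2 * 1 * Lf s \<le> 1\<^sup>2 + (Lf s)\<^sup>2" by (rule sum_squares_bound)
    then show "norm (Lf s) \<le> norm (1 + (Lf s)\<^sup>2)" using Lf(2)[of s] by simp
  qed
qed (rule Lf(1))

definition "LF = (\<integral>s. Lf s \<partial>P)"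

lemma LF_nonneg: "0 \<le> LF" unfolding LF_def using Lf(2) by simp

abbreviation "good \<equiv> exact_convex_sample f r V fm"

lemma good_eq: "good s \<Longrightarrow> y \<in> V \<Longrightarrow> z \<in> V \<Longrightarrow> f z s = ereal (fm y z s)"
  by (simp add: exact_convex_sample_def)

lemma good_eq': "good s \<Longrightarrow> y \<in> V \<Longrightarrow> y' \<in> V \<Longrightarrow> z \<in> V \<Longrightarrow> fm y z s = fm y' z s"
  using good_eq[of s y z] good_eq[of s y' z] by simp

lemma f_integrable: "integrable P (\<lambda>s. real_of_ereal (f y s))"
  using regular unfolding regularity_def by (elim conjE) (rule spec)

lemma risk_lipschitz:
  assumes "y \<in> U" "z \<in> U" shows "\<bar>risk P f y - risk P f z\<bar> \<le> LF * norm (y - z)"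
proof -
  have V: "y \<in> V" "z \<in> V" using assms by (auto simp: U)
  have "\<bar>risk P f y - risk P f z\<bar> = \<bar>\<integral>s. real_of_ereal (f y s) - real_of_ereal (f z s) \<partial>P\<bar>"
    unfolding risk_def by (simp add: f_integrable)
  also have "\<dots> \<le> (\<integral>s. \<bar>real_of_ereal (f y s) - real_of_ereal (f z s)\<bar> \<partial>P)"
    by (rule integral_abs_bound)
  also have "\<dots> \<le> (\<integral>s. Lf s * norm (y - z) \<partial>P)"
  proof (rule integral_mono_AE)
    show "AE s in P. \<bar>real_of_ereal (f y s) - real_of_ereal (f z s)\<bar> \<le> Lf s * norm (y - z)"
      using Lf(4) AE_exact_convex_sample[OF accuracy regular]
    proof eventually_elim
      case (elim s)
      have "f y s = ereal (fm y y s)" "f z s = ereal (fm y z s)"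
        using good_eq[OF elim(2)] V by auto
      then show ?case using elim(1) assms by simp
    qed
  qed (use f_integrable Lf_integrable in auto)
  also have "\<dots> = LF * norm (y - z)" by (simp add: LF_def)
  finally show ?thesis .
qed

text \<open>
  The loss at \<open>y\<close> minus the loss at \<open>xs\<close>. Evaluated through the model at the fixed base point \<open>xs\<close>, which by
  exactness changes nothing almost surely, it is jointly measurable; moving points off \<open>V\<close> to \<open>xs\<close> makes this hold
  on the whole space.
\<close>

definition loss_diff :: "'a \<Rightarrow> 's \<Rightarrow> real" where
  "loss_diff y s = fm xs (if y \<in> V then y else xs) s - fm xs xs s"

lemma loss_diff_measurable: "(\<lambda>(y, s). loss_diff y s) \<in> borel_measurable (borel \<Otimes>\<^sub>M P)"
proof -
  let ?RV = "restrict_space borel V"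
  have fam: "(\<lambda>(x, y, s). fm x y s) \<in> borel_measurable (?RV \<Otimes>\<^sub>M (?RV \<Otimes>\<^sub>M P))"
    using family unfolding model_family_def by (elim conjE)
  have "open V" using family unfolding model_family_def by (elim conjE)
  have [measurable]: "V \<in> sets borel" using \<open>open V\<close> by simp
  have "(\<lambda>y. if y \<in> V then y else xs) \<in> measurable borel ?RV"
    by (rule measurable_restrict_space2) (use xs_V in auto)
  then have k[measurable]: "(\<lambda>p. if fst p \<in> V then fst p else xs) \<in> measurable (borel \<Otimes>\<^sub>M P) ?RV"
    by (rule measurable_compose[OF measurable_fst])
  have c[measurable]: "(\<lambda>p. xs) \<in> measurable (borel \<Otimes>\<^sub>M P) ?RV"
    by (rule measurable_const) (use xs_V in \<open>simp add: space_restrict_space\<close>)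
  have "(\<lambda>p. (xs, if fst p \<in> V then fst p else xs, snd p)) \<in> measurable (borel \<Otimes>\<^sub>M P) (?RV \<Otimes>\<^sub>M (?RV \<Otimes>\<^sub>M P))"
    by (intro measurable_Pair c k measurable_snd)
  from measurable_compose[OF this fam]
  have 1: "(\<lambda>p. fm xs (if fst p \<in> V then fst p else xs) (snd p)) \<in> borel_measurable (borel \<Otimes>\<^sub>M P)" by simp
  have "(\<lambda>p. (xs, xs, snd p)) \<in> measurable (borel \<Otimes>\<^sub>M P) (?RV \<Otimes>\<^sub>M (?RV \<Otimes>\<^sub>M P))"
    by (intro measurable_Pair c measurable_snd)
  from measurable_compose[OF this fam]
  have 2: "(\<lambda>p. fm xs xs (snd p)) \<in> borel_measurable (borel \<Otimes>\<^sub>M P)" by simp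
  from borel_measurable_diff[OF 1 2] show ?thesis by (simp add: loss_diff_def case_prod_beta)
qed

lemma loss_diff_measurable2: "u \<in> borel_measurable N \<Longrightarrow> v \<in> measurable N P \<Longrightarrow> (\<lambda>\<omega>. loss_diff (u \<omega>) (v \<omega>)) \<in> borel_measurable N"
  using measurable_compose[OF measurable_Pair[of u N borel v P] loss_diff_measurable] by simp

definition "risk_diff y = (\<integral>s. loss_diff y s \<partial>P)"

lemma risk_diff_measurable: "risk_diff \<in> borel_measurable borel"
  unfolding risk_diff_def[abs_def] by (rule P.borel_measurable_lebesgue_integral) (rule loss_diff_measurable)

lemma AE_loss_diff_le: "AE s in P. \<forall>y\<in>U. \<bar>loss_diff y s\<bar> \<le> Lf s * norm (y - xs)"
  using Lf(4)
proof eventually_elim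
  case (elim s)
  show ?case
  proof
    fix y assume y: "y \<in> U"
    then have "\<bar>fm xs xs s - fm xs y s\<bar> \<le> Lf s * norm (xs - y)" using elim xs_U by blast
    then show "\<bar>loss_diff y s\<bar> \<le> Lf s * norm (y - xs)"
      using y by (simp add: loss_diff_def U abs_minus_commute norm_minus_commute)
  qed
qed

lemma risk_diff_eq: assumes "y \<in> V" shows "risk_diff y = risk P f y - risk P f xs"
proof -
  have "risk_diff y = (\<integral>s. real_of_ereal (f y s) - real_of_ereal (f xs s) \<partial>P)"
    unfolding risk_diff_def
  proof (rule integral_cong_AE)
    show "loss_diff y \<in> borel_measurable P" by (rule loss_diff_measurable2) auto
    show "AE s in P. loss_diff y s = real_of_ereal (f y s) - real_of_ereal (f xs s)"
      using AE_exact_convex_sample[OF accuracy regular]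
    proof eventually_elim
      case (elim s)
      show ?case using good_eq[OF elim xs_V xs_V] good_eq[OF elim xs_V assms] assms by (simp add: loss_diff_def)
    qed
  qed (use f_integrable in auto)
  also have "\<dots> = risk P f y - risk P f xs" unfolding risk_def by (simp add: f_integrable)
  finally show ?thesis .
qed

lemma risk_diff_le: "y \<in> U \<Longrightarrow> \<bar>risk_diff y\<bar> \<le> LF * norm (y - xs)"
  using risk_diff_eq[of y] risk_lipschitz[OF _ xs_U, of y] by (simp add: U)

text \<open>
  Not having left the ball is known at time \<open>n\<close>, so that this event may multiply centred noise of step
  \<open>n\<close>.
\<close>

definition "stay n = {\<omega>\<in>space \<Omega>. \<forall>j\<le>n. norm (x (Suc j) \<omega>) \<le> \<beta>}"

lemma stay_F: "stay n \<in> sets (F n)"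
proof -
  have "{\<omega>\<in>space (F n). norm (x (Suc j) \<omega>) \<le> \<beta>} \<in> sets (F n)" if "j \<in> {..n}" for j
  proof -
    have [measurable]: "x (Suc j) \<in> borel_measurable (F n)"
      using F_measurable_mono[OF _ x_measurable[of j], of n] that by simp
    show ?thesis by measurable
  qed
  then have "{\<omega>\<in>space (F n). \<forall>j\<in>{..n}. norm (x (Suc j) \<omega>) \<le> \<beta>} \<in> sets (F n)"
    by (intro sets.sets_Collect_finite_All) auto
  moreover have "stay n = {\<omega>\<in>space (F n). \<forall>j\<in>{..n}. norm (x (Suc j) \<omega>) \<le> \<beta>}"
    unfolding stay_def space_sample_filtration by auto
  ultimately show ?thesis by (simp only:)
qed

lemma stay_sets: "stay n \<in> sets \<Omega>" by (rule F_sets[OF stay_F])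

lemma stay_Suc: "stay (Suc n) \<subseteq> stay n" by (auto simp: stay_def)

text \<open>
  \<open>batch_lip\<close> bounds the Lipschitz constants of the minibatch loss and of the risk together, and
  \<open>loss_noise\<close> is the error of the minibatch in estimating the difference of the risks at \<open>x (Suc n)\<close> and \<open>xs\<close>,
  stopped at the exit from the ball. \<open>slack\<close> is the upper bound for the next squared distance that holds with a zero
  objective gap, minus that distance.
\<close>

abbreviation "batch_lip n \<omega> \<equiv> 1 / real m * (\<Sum>i=1..m. Lf (S (Suc n) i \<omega>)) + LF"
abbreviation "batch_diff n \<omega> \<equiv> 1 / real m * (\<Sum>i=1..m. loss_diff (x (Suc n) \<omega>) (S (Suc n) i \<omega>))"
abbreviation "loss_noise n \<omega> \<equiv> indicator (stay n) \<omega> * (batch_diff n \<omega> - risk_diff (x (Suc n) \<omega>))"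
abbreviation "\<beta>' \<equiv> \<beta> + norm xs"
abbreviation "slack n \<omega> \<equiv> (1 + (a n)\<^sup>2) * (sqdist_pre xs n \<omega> - 2 * a n * loss_noise n \<omega> + (a n)\<^sup>2 * L_inf\<^sup>2 * (batch_lip n \<omega>)\<^sup>2)
    + (inexactness n - sqdist xs (Suc n) \<omega>)"

text \<open>
  The minibatch loss at \<open>z\<close> is moved to \<open>x (Suc n)\<close>, where it has conditional mean equal to the risk, and
  the risk is moved back to \<open>z\<close>. Both moves cost a Lipschitz constant times the norm of \<open>z - x (Suc n)\<close>, which is
  absorbed by the proximal term.
\<close>

lemma AE_gap_le_slack:
  "AE \<omega> in \<Omega>. \<forall>n. \<omega> \<in> stay (Suc n) \<longrightarrow> (\<exists>z\<in>effdom r.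
     wnorm (M (Suc n) \<omega>) (x (Suc (Suc n)) \<omega> - z) \<le> \<gamma> * (a n)\<^sup>2 \<and>
     2 * a n * excess xs z \<le> slack n \<omega>)"
  using AE_step AE_norm_equiv AE_samples[OF Lf(4)] AE_samples[OF AE_exact_convex_sample[OF accuracy regular]] AE_space
proof eventually_elim
  case (elim \<omega>)
  show ?case
  proof (intro allI impI)
    fix n assume st: "\<omega> \<in> stay (Suc n)"
    let ?M = "M (Suc n) \<omega>" and ?x = "x (Suc n) \<omega>" and ?x' = "x (Suc (Suc n)) \<omega>"
    have spd: "spd ?M" by (rule spd_M[OF elim(5)])
    have xb: "norm ?x \<le> \<beta>" and x'b: "norm ?x' \<le> \<beta>" using st by (auto simp: stay_def)
    have xV: "?x \<in> V" using elim(1) by blast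
    have xU: "?x \<in> U" by (rule x_in_U[OF xV xb])
    obtain z where z: "z \<in> effdom r" "wnorm ?M (?x' - z) \<le> \<gamma> * (a n)\<^sup>2"
      and step: "(wnorm ?M (z - xs))\<^sup>2 \<le> (wnorm ?M (?x - xs))\<^sup>2 - (wnorm ?M (z - ?x))\<^sup>2
           + 2 * a n * (fbar n \<omega> xs + R xs - (fbar n \<omega> z + R z))"
      using elim(1)[rule_format, of n] minimizer_dom[OF xs] by (elim conjE bexE) (rule that, assumption+, erule bspec)
    have zV: "z \<in> V" using z(1) dom_V by blast
    have "norm (?x' - z) \<le> L_inf * wnorm ?M (?x' - z)" using elim(2) by blast
    also have "\<dots> \<le> L_inf * (\<gamma> * K)"
      using z(2) a_sq_le[of n] \<gamma>_nonneg L_pos by (meson mult_left_mono order_trans less_imp_le)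
    finally have "norm z \<le> \<beta> + L_inf * (\<gamma> * K)"
      using x'b norm_triangle_ineq3[of ?x' z] by linarith
    then have zU: "z \<in> U" by (rule in_U[OF zV])
    define lbar where "lbar = 1 / real m * (\<Sum>i=1..m. Lf (S (Suc n) i \<omega>))"
    have good: "good (S (Suc n) i \<omega>)" if "i \<in> {1..m}" for i using elim(4) that by blast
    have hm: "batch_diff n \<omega> = fbar n \<omega> ?x - fbar n \<omega> xs"
    proof -
      have "loss_diff ?x (S (Suc n) i \<omega>) = fm ?x ?x (S (Suc n) i \<omega>) - fm ?x xs (S (Suc n) i \<omega>)" if "i \<in> {1..m}" for i
        unfolding loss_diff_def using xV
        by (simp add: good_eq'[OF good[OF that] xs_V xV xV] good_eq'[OF good[OF that] xs_V xV xs_V])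
      then have "(\<Sum>i=1..m. loss_diff ?x (S (Suc n) i \<omega>))
         = (\<Sum>i=1..m. fm ?x ?x (S (Suc n) i \<omega>)) - (\<Sum>i=1..m. fm ?x xs (S (Suc n) i \<omega>))"
        by (simp add: sum_subtractf)
      then show ?thesis by (simp only: right_diff_distrib)
    qed
    have lip: "fbar n \<omega> ?x - fbar n \<omega> z \<le> lbar * norm (z - ?x)"
    proof -
      have "fm ?x ?x (S (Suc n) i \<omega>) - fm ?x z (S (Suc n) i \<omega>) \<le> Lf (S (Suc n) i \<omega>) * norm (?x - z)"
        if "i \<in> {1..m}" for i
      proof -
        have "\<bar>fm ?x ?x (S (Suc n) i \<omega>) - fm ?x z (S (Suc n) i \<omega>)\<bar> \<le> Lf (S (Suc n) i \<omega>) * norm (?x - z)"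
          using elim(3) that xU zU by blast
        then show ?thesis by linarith
      qed
      then have "(\<Sum>i=1..m. fm ?x ?x (S (Suc n) i \<omega>) - fm ?x z (S (Suc n) i \<omega>))
          \<le> (\<Sum>i=1..m. Lf (S (Suc n) i \<omega>) * norm (?x - z))" by (rule sum_mono)
      then have "1 / real m * (\<Sum>i=1..m. fm ?x ?x (S (Suc n) i \<omega>) - fm ?x z (S (Suc n) i \<omega>))
          \<le> 1 / real m * (\<Sum>i=1..m. Lf (S (Suc n) i \<omega>) * norm (?x - z))" by (rule mult_left_mono) simp
      also have "\<dots> = lbar * norm (z - ?x)"
        by (simp only: lbar_def sum_distrib_right[symmetric] mult.assoc norm_minus_commute)
      finally show ?thesis by (simp only: sum_subtractf right_diff_distrib)
    qed
    define gap where "gap = excess xs z"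
    have d: "loss_noise n \<omega> = batch_diff n \<omega> - (risk P f ?x - risk P f xs)"
      using st stay_Suc risk_diff_eq[OF xV] by (auto simp: indicator_def)
    have "risk P f z - risk P f ?x \<le> LF * norm (z - ?x)" using risk_lipschitz[OF zU xU] by linarith
    with hm lip d have "fbar n \<omega> xs + R xs - (fbar n \<omega> z + R z) \<le> - loss_noise n \<omega> + batch_lip n \<omega> * norm (z - ?x) - gap"
      unfolding gap_def lbar_def[symmetric] distrib_right by linarith
    then have "2 * a n * (fbar n \<omega> xs + R xs - (fbar n \<omega> z + R z))
        \<le> 2 * a n * (- loss_noise n \<omega> + batch_lip n \<omega> * norm (z - ?x) - gap)"
      using \<alpha>_pos[of n] by (intro mult_left_mono) auto
    also have "\<dots> = - 2 * a n * loss_noise n \<omega> - 2 * a n * gap + (- 2 * a n * (batch_lip n \<omega> \<bullet> (- norm (z - ?x))))"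
      unfolding inner_real_def by (simp only: distrib_left right_diff_distrib mult_minus_left mult_minus_right minus_minus mult.assoc)
    also have "- 2 * a n * (batch_lip n \<omega> \<bullet> (- norm (z - ?x))) \<le> (a n)\<^sup>2 * L_inf\<^sup>2 * (norm (batch_lip n \<omega>))\<^sup>2 + (wnorm ?M (z - ?x))\<^sup>2"
      using elim(2) \<alpha>_pos[of n] L_pos by (intro inner_le_young) auto
    finally have key: "(wnorm ?M (z - xs))\<^sup>2 \<le> sqdist_pre xs n \<omega> - 2 * a n * loss_noise n \<omega> + (a n)\<^sup>2 * L_inf\<^sup>2 * (batch_lip n \<omega>)\<^sup>2 - 2 * a n * gap"
      using step by (simp only: real_norm_def power2_abs) linarith
    have "0 \<le> gap" using minimizer_le[OF xs z(1)] by (simp add: gap_def)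
    then have g0: "0 \<le> 2 * a n * gap" using \<alpha>_pos[of n] by simp
    have "(1 + (a n)\<^sup>2) * (2 * a n * gap) = 2 * a n * gap + (a n)\<^sup>2 * (2 * a n * gap)" by (simp only: distrib_right mult_1_left)
    with g0 have g1: "2 * a n * gap \<le> (1 + (a n)\<^sup>2) * (2 * a n * gap)" by simp
    have "(1 + (a n)\<^sup>2) * (wnorm ?M (z - xs))\<^sup>2 \<le> (1 + (a n)\<^sup>2) *
        (sqdist_pre xs n \<omega> - 2 * a n * loss_noise n \<omega> + (a n)\<^sup>2 * L_inf\<^sup>2 * (batch_lip n \<omega>)\<^sup>2 - 2 * a n * gap)"
      using key by (rule mult_left_mono) simp
    also have "\<dots> = (1 + (a n)\<^sup>2) * (sqdist_pre xs n \<omega> - 2 * a n * loss_noise n \<omega> + (a n)\<^sup>2 * L_inf\<^sup>2 * (batch_lip n \<omega>)\<^sup>2) - (1 + (a n)\<^sup>2) * (2 * a n * gap)"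
      by (rule right_diff_distrib)
    finally have "2 * a n * gap \<le> slack n \<omega>"
      using wnorm_sq_inexact_le[OF spd \<alpha>_pos a_sq_le z(2), of xs] g1 by linarith
    then show "\<exists>z\<in>effdom r. wnorm ?M (?x' - z) \<le> \<gamma> * (a n)\<^sup>2 \<and>
       2 * a n * excess xs z \<le> slack n \<omega>"
      unfolding gap_def using z by blast
  qed
qed

lemma AE_loss_noise_le: "AE \<omega> in \<Omega>. \<forall>n. \<bar>loss_noise n \<omega>\<bar> \<le> batch_lip n \<omega> * \<beta>'"
  using AE_step AE_samples[OF AE_loss_diff_le]
proof eventually_elim
  case (elim \<omega>)
  show ?case
  proof
    fix n
    have l0: "0 \<le> batch_lip n \<omega>" using Lf(2) LF_nonneg by (simp add: sum_nonneg)
    show "\<bar>loss_noise n \<omega>\<bar> \<le> batch_lip n \<omega> * \<beta>'"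
    proof (cases "\<omega> \<in> stay n")
      case False
      then show ?thesis using l0 \<beta> by simp
    next
      case True
      then have xb: "norm (x (Suc n) \<omega>) \<le> \<beta>" by (simp add: stay_def)
      have xU: "x (Suc n) \<omega> \<in> U" using elim(1) xb by (intro x_in_U) auto
      have nb: "norm (x (Suc n) \<omega> - xs) \<le> \<beta>'" using xb norm_triangle_ineq4[of "x (Suc n) \<omega>" xs] by linarith
      have "\<bar>\<Sum>i=1..m. loss_diff (x (Suc n) \<omega>) (S (Suc n) i \<omega>)\<bar> \<le> (\<Sum>i=1..m. \<bar>loss_diff (x (Suc n) \<omega>) (S (Suc n) i \<omega>)\<bar>)"
        by (rule sum_abs)
      also have "\<dots> \<le> (\<Sum>i=1..m. Lf (S (Suc n) i \<omega>) * \<beta>')"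
      proof (rule sum_mono)
        fix i assume i: "i \<in> {1..m}"
        have "\<bar>loss_diff (x (Suc n) \<omega>) (S (Suc n) i \<omega>)\<bar> \<le> Lf (S (Suc n) i \<omega>) * norm (x (Suc n) \<omega> - xs)"
          using elim(2) i xU by blast
        also have "\<dots> \<le> Lf (S (Suc n) i \<omega>) * \<beta>'" using nb Lf(2) by (intro mult_left_mono)
        finally show "\<bar>loss_diff (x (Suc n) \<omega>) (S (Suc n) i \<omega>)\<bar> \<le> Lf (S (Suc n) i \<omega>) * \<beta>'" .
      qed
      also have "\<dots> = (\<Sum>i=1..m. Lf (S (Suc n) i \<omega>)) * \<beta>'" by (rule sum_distrib_right[symmetric])
      finally have "\<bar>batch_diff n \<omega>\<bar> \<le> 1 / real m * ((\<Sum>i=1..m. Lf (S (Suc n) i \<omega>)) * \<beta>')"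
        unfolding abs_mult by (intro mult_mono) auto
      moreover have "\<bar>risk_diff (x (Suc n) \<omega>)\<bar> \<le> LF * \<beta>'"
        using risk_diff_le[OF xU] mult_left_mono[OF nb LF_nonneg] by linarith
      ultimately have "\<bar>batch_diff n \<omega> - risk_diff (x (Suc n) \<omega>)\<bar> \<le> batch_lip n \<omega> * \<beta>'"
        unfolding distrib_right mult.assoc by linarith
      then show ?thesis using True by simp
    qed
  qed
qed

lemma batch_lip_measurable: "(\<lambda>\<omega>. batch_lip n \<omega>) \<in> borel_measurable \<Omega>"
proof -
  have "(\<lambda>\<omega>. Lf (S (Suc n) i \<omega>)) \<in> borel_measurable \<Omega>" if "i \<in> {1..m}" for i
    using measurable_compose[OF S_measurable[OF that] Lf(1)] .
  then show ?thesis by (intro borel_measurable_add borel_measurable_times borel_measurable_sum) auto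
qed

definition "\<Lambda> = 2 * (\<integral>s. (Lf s)\<^sup>2 \<partial>P) + 2 * LF\<^sup>2"

lemma \<Lambda>_nonneg: "0 \<le> \<Lambda>" by (simp add: \<Lambda>_def)

lemma batch_lip_sq: "integrable \<Omega> (\<lambda>\<omega>. (batch_lip n \<omega>)\<^sup>2)" "(\<integral>\<omega>. (batch_lip n \<omega>)\<^sup>2 \<partial>\<Omega>) \<le> \<Lambda>"
proof -
  let ?B = "\<lambda>\<omega>. 2 / real m * (\<Sum>i=1..m. (Lf (S (Suc n) i \<omega>))\<^sup>2) + 2 * LF\<^sup>2"
  have le: "(batch_lip n \<omega>)\<^sup>2 \<le> ?B \<omega>" for \<omega>
  proof -
    have "(1 / real m * (\<Sum>i=1..m. Lf (S (Suc n) i \<omega>)))\<^sup>2 \<le> 1 / real m * (\<Sum>i=1..m. (Lf (S (Suc n) i \<omega>))\<^sup>2)"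
      using norm_mean_sq_le[OF m_pos, of "\<lambda>i. Lf (S (Suc n) i \<omega>)"] by (simp add: power_divide)
    then have "2 * (1 / real m * (\<Sum>i=1..m. Lf (S (Suc n) i \<omega>)))\<^sup>2 + 2 * LF\<^sup>2
        \<le> 2 * (1 / real m * (\<Sum>i=1..m. (Lf (S (Suc n) i \<omega>))\<^sup>2)) + 2 * LF\<^sup>2"
      by (intro add_right_mono mult_left_mono) auto
    moreover have "(u + v)\<^sup>2 \<le> 2 * u\<^sup>2 + 2 * v\<^sup>2" for u v :: real
      using sum_squares_bound[of u v] by (simp add: power2_sum)
    ultimately have "(batch_lip n \<omega>)\<^sup>2 \<le> 2 * (1 / real m * (\<Sum>i=1..m. (Lf (S (Suc n) i \<omega>))\<^sup>2)) + 2 * LF\<^sup>2"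
      by (rule order_trans[rotated])
    also have "2 * (1 / real m * (\<Sum>i=1..m. (Lf (S (Suc n) i \<omega>))\<^sup>2)) = 2 / real m * (\<Sum>i=1..m. (Lf (S (Suc n) i \<omega>))\<^sup>2)"
      by simp
    finally show ?thesis .
  qed
  have int: "integrable \<Omega> (\<lambda>\<omega>. (Lf (S (Suc n) i \<omega>))\<^sup>2)" if "i \<in> {1..m}" for i
    by (rule sample_integrable[OF that Lf(3)])
  have iB1: "integrable \<Omega> (\<lambda>\<omega>. 2 / real m * (\<Sum>i=1..m. (Lf (S (Suc n) i \<omega>))\<^sup>2))"
    by (intro integrable_mult_right Bochner_Integration.integrable_sum int)
  then have iB: "integrable \<Omega> ?B" by simp
  show i: "integrable \<Omega> (\<lambda>\<omega>. (batch_lip n \<omega>)\<^sup>2)"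
  proof (rule Bochner_Integration.integrable_bound[OF iB])
    show "AE \<omega> in \<Omega>. norm ((batch_lip n \<omega>)\<^sup>2) \<le> norm (?B \<omega>)"
    proof (rule AE_I2)
      have "norm s \<le> norm t" if "0 \<le> s" "s \<le> t" for s t :: real using that by simp
      from this[OF zero_le_power2 le] show "norm ((batch_lip n \<omega>)\<^sup>2) \<le> norm (?B \<omega>)" for \<omega> .
    qed
  qed (use batch_lip_measurable[of n] in measurable)
  have "(\<integral>\<omega>. (batch_lip n \<omega>)\<^sup>2 \<partial>\<Omega>) \<le> (\<integral>\<omega>. ?B \<omega> \<partial>\<Omega>)" by (rule integral_mono[OF i iB le])
  also have "\<dots> = (\<integral>\<omega>. 2 / real m * (\<Sum>i=1..m. (Lf (S (Suc n) i \<omega>))\<^sup>2) \<partial>\<Omega>) + 2 * LF\<^sup>2"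
    using Bochner_Integration.integral_add[OF iB1, of "\<lambda>_. 2 * LF\<^sup>2"] by (simp add: prob_space)
  also have "\<dots> = 2 / real m * (\<Sum>i=1..m. \<integral>\<omega>. (Lf (S (Suc n) i \<omega>))\<^sup>2 \<partial>\<Omega>) + 2 * LF\<^sup>2"
    by (simp only: integral_scaled_sum[OF int])
  also have "\<dots> = \<Lambda>"
  proof -
    have "(\<integral>\<omega>. (Lf (S (Suc n) i \<omega>))\<^sup>2 \<partial>\<Omega>) = (\<integral>s. (Lf s)\<^sup>2 \<partial>P)" if "i \<in> {1..m}" for i
    proof -
      have "(\<lambda>s. (Lf s)\<^sup>2) \<in> borel_measurable P" using Lf(1) by measurable
      from integral_distr[OF S_measurable[OF that, of n] this] show ?thesis unfolding S_distr[OF that] ..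
    qed
    then show ?thesis using m_pos by (simp add: \<Lambda>_def)
  qed
  finally show "(\<integral>\<omega>. (batch_lip n \<omega>)\<^sup>2 \<partial>\<Omega>) \<le> \<Lambda>" .
qed


lemma loss_noise_measurable: "(\<lambda>\<omega>. loss_noise n \<omega>) \<in> borel_measurable \<Omega>"
proof -
  have "(\<lambda>\<omega>. loss_diff (x (Suc n) \<omega>) (S (Suc n) i \<omega>)) \<in> borel_measurable \<Omega>" if "i \<in> {1..m}" for i
    by (rule loss_diff_measurable2[OF x_measurable' S_measurable[OF that]])
  then have hm: "(\<lambda>\<omega>. batch_diff n \<omega>) \<in> borel_measurable \<Omega>"
    by (intro borel_measurable_times borel_measurable_sum borel_measurable_const)
  have hb: "(\<lambda>\<omega>. risk_diff (x (Suc n) \<omega>)) \<in> borel_measurable \<Omega>"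
    by (rule measurable_compose[OF x_measurable' risk_diff_measurable])
  show ?thesis
    by (rule borel_measurable_times[OF borel_measurable_indicator[OF stay_sets] borel_measurable_diff[OF hm hb]])
qed

lemma loss_noise_integrable: "integrable \<Omega> (\<lambda>\<omega>. loss_noise n \<omega>)"
proof (rule Bochner_Integration.integrable_bound)
  show "integrable \<Omega> (\<lambda>\<omega>. (batch_lip n \<omega>)\<^sup>2 + \<beta>'\<^sup>2)" using batch_lip_sq(1)[of n] by (intro Bochner_Integration.integrable_add) auto
  show "AE \<omega> in \<Omega>. norm (loss_noise n \<omega>) \<le> norm ((batch_lip n \<omega>)\<^sup>2 + \<beta>'\<^sup>2)"
    using AE_loss_noise_le
  proof eventually_elim
    case (elim \<omega>)
    have "\<bar>loss_noise n \<omega>\<bar> \<le> batch_lip n \<omega> * \<beta>'" using elim by (rule spec)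
    also have "\<dots> \<le> norm (batch_lip n \<omega> \<bullet> \<beta>')" unfolding inner_real_def real_norm_def by (rule abs_ge_self)
    also have "\<dots> \<le> norm ((norm (batch_lip n \<omega>))\<^sup>2 + (norm \<beta>')\<^sup>2)" by (rule norm_inner_le_sum_squares)
    finally show ?case by (simp only: real_norm_def power2_abs)
  qed
qed (rule loss_noise_measurable)

text \<open>
  The stopping event and \<open>x (Suc n)\<close> belong to the past, so the samples are integrated out with these
  frozen.
\<close>

lemma loss_noise_mean_zero: "(\<integral>\<omega>. loss_noise n \<omega> \<partial>\<Omega>) = 0"
proof -
  let ?A = "indicator (stay n) :: 'w \<Rightarrow> real"
  let ?b = "\<lambda>\<omega>. ?A \<omega> * risk_diff (x (Suc n) \<omega>)"
  let ?u = "\<lambda>i \<omega>. ?A \<omega> * loss_diff (x (Suc n) \<omega>) (S (Suc n) i \<omega>)"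
  have xF: "x (Suc n) \<in> borel_measurable (F n)" by (rule x_measurable)
  have bnd: "AE \<omega> in \<Omega>. \<omega> \<in> stay n \<longrightarrow> x (Suc n) \<omega> \<in> U \<and> norm (x (Suc n) \<omega> - xs) \<le> \<beta>'"
    using AE_step
  proof eventually_elim
    case (elim \<omega>)
    show ?case
    proof
      assume "\<omega> \<in> stay n"
      then have xb: "norm (x (Suc n) \<omega>) \<le> \<beta>" by (simp add: stay_def)
      then show "x (Suc n) \<omega> \<in> U \<and> norm (x (Suc n) \<omega> - xs) \<le> \<beta>'"
        using elim norm_triangle_ineq4[of "x (Suc n) \<omega>" xs] by (auto intro!: x_in_U)
    qed
  qed
  have ib: "integrable \<Omega> ?b"
  proof (rule integrable_const_bound[where B="LF * \<beta>'"])
    show "AE \<omega> in \<Omega>. norm (?b \<omega>) \<le> LF * \<beta>'"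
      using bnd
    proof eventually_elim
      case (elim \<omega>)
      show ?case
      proof (cases "\<omega> \<in> stay n")
        case True
        then have "\<bar>risk_diff (x (Suc n) \<omega>)\<bar> \<le> LF * norm (x (Suc n) \<omega> - xs)" using elim risk_diff_le by blast
        also have "\<dots> \<le> LF * \<beta>'" using True elim LF_nonneg by (intro mult_left_mono) auto
        finally show ?thesis using True by simp
      qed (use LF_nonneg \<beta> in simp)
    qed
    show "?b \<in> borel_measurable \<Omega>"
      by (intro borel_measurable_times borel_measurable_indicator stay_sets
          measurable_compose[OF x_measurable' risk_diff_measurable])
  qed
  have iu: "integrable \<Omega> (?u i)" if i: "i \<in> {1..m}" for i
  proof (rule Bochner_Integration.integrable_bound)
    show "integrable \<Omega> (\<lambda>\<omega>. Lf (S (Suc n) i \<omega>) * \<beta>')" using sample_integrable[OF i Lf_integrable] by simp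
    show "AE \<omega> in \<Omega>. norm (?u i \<omega>) \<le> norm (Lf (S (Suc n) i \<omega>) * \<beta>')"
      using bnd AE_samples[OF AE_loss_diff_le]
    proof eventually_elim
      case (elim \<omega>)
      show ?case
      proof (cases "\<omega> \<in> stay n")
        case True
        then have "\<bar>loss_diff (x (Suc n) \<omega>) (S (Suc n) i \<omega>)\<bar> \<le> Lf (S (Suc n) i \<omega>) * norm (x (Suc n) \<omega> - xs)"
          using elim i by blast
        also have "\<dots> \<le> Lf (S (Suc n) i \<omega>) * \<beta>'" using True elim Lf(2) by (intro mult_left_mono) auto
        finally show ?thesis using True by simp
      qed simp
    qed
    show "?u i \<in> borel_measurable \<Omega>"
      by (intro borel_measurable_times borel_measurable_indicator stay_sets
          loss_diff_measurable2[OF x_measurable' S_measurable[OF i]])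
  qed
  have eq: "(\<integral>\<omega>. ?u i \<omega> \<partial>\<Omega>) = (\<integral>\<omega>. ?b \<omega> \<partial>\<Omega>)" if i: "i \<in> {1..m}" for i
  proof -
    have "(\<lambda>p. indicator (stay n) (fst p) * loss_diff (x (Suc n) (fst p)) (snd p) :: real) \<in> borel_measurable (F n \<Otimes>\<^sub>M P)"
    proof (intro borel_measurable_times loss_diff_measurable2)
      show "(\<lambda>p. indicator (stay n) (fst p) :: real) \<in> borel_measurable (F n \<Otimes>\<^sub>M P)"
        by (rule measurable_compose[OF measurable_fst borel_measurable_indicator[OF stay_F]])
      show "(\<lambda>p. x (Suc n) (fst p)) \<in> borel_measurable (F n \<Otimes>\<^sub>M P)"
        by (rule measurable_compose[OF measurable_fst xF])
    qed (rule measurable_snd)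
    from sample_freeze[OF i this] iu[OF i]
    have "(\<integral>\<omega>. ?u i \<omega> \<partial>\<Omega>) = (\<integral>\<omega>. (\<integral>s. ?A \<omega> * loss_diff (x (Suc n) \<omega>) s \<partial>P) \<partial>\<Omega>)" by simp
    then show ?thesis by (simp add: risk_diff_def)
  qed
  have isum: "integrable \<Omega> (\<lambda>\<omega>. 1 / real m * (\<Sum>i=1..m. ?u i \<omega>))"
    by (intro integrable_mult_right Bochner_Integration.integrable_sum iu)
  have "(\<integral>\<omega>. loss_noise n \<omega> \<partial>\<Omega>) = (\<integral>\<omega>. 1 / real m * (\<Sum>i=1..m. ?u i \<omega>) - ?b \<omega> \<partial>\<Omega>)"
    by (intro Bochner_Integration.integral_cong refl)
       (simp only: right_diff_distrib sum_distrib_left mult.left_commute)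
  also have "\<dots> = (\<integral>\<omega>. 1 / real m * (\<Sum>i=1..m. ?u i \<omega>) \<partial>\<Omega>) - (\<integral>\<omega>. ?b \<omega> \<partial>\<Omega>)"
    by (rule Bochner_Integration.integral_diff[OF isum ib])
  also have "(\<integral>\<omega>. 1 / real m * (\<Sum>i=1..m. ?u i \<omega>) \<partial>\<Omega>) = 1 / real m * (\<Sum>i=1..m. \<integral>\<omega>. ?u i \<omega> \<partial>\<Omega>)"
    by (rule integral_scaled_sum[OF iu])
  also have "\<dots> = (\<integral>\<omega>. ?b \<omega> \<partial>\<Omega>)"
    using m_pos by (subst sum.cong[OF refl eq]) auto
  finally show ?thesis by simp
qed

lemma xs_diff_measurable:
  "(\<lambda>\<omega>. x (Suc n) \<omega> - xs) \<in> borel_measurable \<Omega>" "(\<lambda>\<omega>. x (Suc n) \<omega> - xs) \<in> borel_measurable (F n)"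
  using x_measurable'[of n] x_measurable[of n] by measurable

lemma sqdist_integrable: "integrable \<Omega> (\<lambda>\<omega>. sqdist xs n \<omega>)"
  by (rule wsq_integrable[OF xs_diff_measurable(1) x_minus_minimizer_sq_integrable[OF xs]])

lemma sqdist_pre_integrable: "integrable \<Omega> (\<lambda>\<omega>. sqdist_pre xs n \<omega>)"
  by (rule wsq_integrable[OF xs_diff_measurable(1) x_minus_minimizer_sq_integrable[OF xs]])

lemma slack_integrable: "integrable \<Omega> (\<lambda>\<omega>. slack n \<omega>)"
  by (intro Bochner_Integration.integrable_add Bochner_Integration.integrable_diff integrable_mult_right
      integrable_const sqdist_pre_integrable sqdist_integrable loss_noise_integrable batch_lip_sq(1))

abbreviation "stopped_dist n \<equiv> (\<integral>\<omega>. indicator (stay n) \<omega> * sqdist xs n \<omega> \<partial>\<Omega>)"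

lemma stopped_dist_nonneg: "0 \<le> stopped_dist n" by (rule Bochner_Integration.integral_nonneg) simp

lemma stopped_dist_le: "stopped_dist n \<le> \<beta>'\<^sup>2 / \<mu>_inf\<^sup>2"
proof -
  have "stopped_dist n \<le> (\<integral>\<omega>. \<beta>'\<^sup>2 / \<mu>_inf\<^sup>2 \<partial>\<Omega>)"
  proof (rule integral_mono_AE)
    show "AE \<omega> in \<Omega>. indicator (stay n) \<omega> * sqdist xs n \<omega> \<le> \<beta>'\<^sup>2 / \<mu>_inf\<^sup>2"
      using AE_wsq_le
    proof eventually_elim
      case (elim \<omega>)
      show ?case
      proof (cases "\<omega> \<in> stay n")
        case True
        then have "norm (x (Suc n) \<omega> - xs) \<le> \<beta>'"
          using norm_triangle_ineq4[of "x (Suc n) \<omega>" xs] by (auto simp: stay_def)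
        then have "(norm (x (Suc n) \<omega> - xs))\<^sup>2 / \<mu>_inf\<^sup>2 \<le> \<beta>'\<^sup>2 / \<mu>_inf\<^sup>2"
          by (intro divide_right_mono power_mono) auto
        moreover have "sqdist xs n \<omega> \<le> (norm (x (Suc n) \<omega> - xs))\<^sup>2 / \<mu>_inf\<^sup>2" using elim by blast
        ultimately show ?thesis using True by simp
      qed simp
    qed
  qed (auto intro!: integrable_indicator_mult stay_sets sqdist_integrable)
  then show ?thesis by (simp add: prob_space)
qed

text \<open>
  The slack is controlled only up to the exit from the ball, while the noise is centred on \<open>stay n\<close> and not on
  \<open>stay (Suc n)\<close>. On the difference of the two events the noise times \<open>2 * a n\<close> is at most \<open>1\<close> plus a quantity of order \<open>(a n)\<^sup>2\<close>;
  the differences are disjoint for different \<open>n\<close>, so that the \<open>1\<close> contributes telescoping probabilities.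
\<close>

lemma slack_integral_le:
  "(\<integral>\<omega>. indicator (stay (Suc n)) \<omega> * slack n \<omega> \<partial>\<Omega>)
    \<le> (stopped_dist n - stopped_dist (Suc n)) + factor_excess n * (\<beta>'\<^sup>2 / \<mu>_inf\<^sup>2)
      + ((1 + K) * (L_inf\<^sup>2 + \<beta>'\<^sup>2) * \<Lambda> + \<gamma>\<^sup>2 * (1 + K)) * (a n)\<^sup>2
      + (1 + K) * (prob (stay n) - prob (stay (Suc n)))"
proof -
  let ?I = "indicator (stay n) :: 'w \<Rightarrow> real" and ?J = "indicator (stay (Suc n)) :: 'w \<Rightarrow> real"
  let ?b = "(a n)\<^sup>2" and ?q = "L_inf\<^sup>2 + \<beta>'\<^sup>2"
  let ?t = "\<lambda>\<omega>. (inexactness n + (1 + K)) * ?I \<omega> - (1 + K) * ?J \<omega> - ?J \<omega> * sqdist xs (Suc n) \<omega>"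
  have iI: "integrable \<Omega> ?I" "integrable \<Omega> ?J"
    using stay_sets by (auto intro!: integrable_real_indicator simp: emeasure_eq_measure)
  have iJD: "integrable \<Omega> (\<lambda>\<omega>. ?J \<omega> * sqdist xs (Suc n) \<omega>)"
    by (rule integrable_indicator_mult[OF stay_sets sqdist_integrable])
  have iIW: "integrable \<Omega> (\<lambda>\<omega>. ?I \<omega> * sqdist_pre xs n \<omega>)"
    by (rule integrable_indicator_mult[OF stay_sets sqdist_pre_integrable])
  have it: "integrable \<Omega> ?t"
    by (intro Bochner_Integration.integrable_diff integrable_mult_right iI iJD)
  have "(\<integral>\<omega>. ?J \<omega> * slack n \<omega> \<partial>\<Omega>)
     \<le> (\<integral>\<omega>. (1 + ?b) * (?I \<omega> * sqdist_pre xs n \<omega> - 2 * a n * loss_noise n \<omega> + ?b * ?q * (batch_lip n \<omega>)\<^sup>2) + ?t \<omega> \<partial>\<Omega>)"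
  proof (rule integral_mono_AE)
    show "integrable \<Omega> (\<lambda>\<omega>. ?J \<omega> * slack n \<omega>)"
      by (rule integrable_indicator_mult[OF stay_sets slack_integrable])
    show "integrable \<Omega> (\<lambda>\<omega>. (1 + ?b) * (?I \<omega> * sqdist_pre xs n \<omega> - 2 * a n * loss_noise n \<omega> + ?b * ?q * (batch_lip n \<omega>)\<^sup>2) + ?t \<omega>)"
      by (intro Bochner_Integration.integrable_add[OF _ it] Bochner_Integration.integrable_add
          Bochner_Integration.integrable_diff integrable_mult_right iIW loss_noise_integrable batch_lip_sq(1))
    show "AE \<omega> in \<Omega>. ?J \<omega> * slack n \<omega>
        \<le> (1 + ?b) * (?I \<omega> * sqdist_pre xs n \<omega> - 2 * a n * loss_noise n \<omega> + ?b * ?q * (batch_lip n \<omega>)\<^sup>2) + ?t \<omega>"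
      using AE_loss_noise_le
    proof eventually_elim
      case (elim \<omega>)
      define d l W D where "d = loss_noise n \<omega>" and "l = batch_lip n \<omega>" and "W = sqdist_pre xs n \<omega>" and "D = sqdist xs (Suc n) \<omega>"
      have d: "\<bar>d\<bar> \<le> l * \<beta>'" using elim unfolding d_def l_def by blast
      have nn: "0 \<le> W" "0 \<le> D" "0 \<le> l\<^sup>2 * ?b * \<beta>'\<^sup>2" "0 \<le> ?b * L_inf\<^sup>2 * l\<^sup>2" "0 \<le> inexactness n"
        using K_nonneg by (auto simp: W_def D_def)
      have q: "?b * ?q * l\<^sup>2 = ?b * L_inf\<^sup>2 * l\<^sup>2 + l\<^sup>2 * ?b * \<beta>'\<^sup>2" by (simp add: algebra_simps)
      consider "\<omega> \<in> stay (Suc n)" "\<omega> \<in> stay n" | "\<omega> \<notin> stay (Suc n)" "\<omega> \<in> stay n" | "\<omega> \<notin> stay (Suc n)" "\<omega> \<notin> stay n"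
        using stay_Suc by blast
      then show ?case unfolding d_def[symmetric] l_def[symmetric] W_def[symmetric] D_def[symmetric]
      proof cases
        case 1
        have "(1 + ?b) * (W - 2 * a n * d + ?b * L_inf\<^sup>2 * l\<^sup>2) \<le> (1 + ?b) * (W - 2 * a n * d + ?b * ?q * l\<^sup>2)"
          unfolding q using nn by (intro mult_left_mono) auto
        then show "?J \<omega> * ((1 + ?b) * (W - 2 * a n * d + ?b * L_inf\<^sup>2 * l\<^sup>2) + (inexactness n - D))
          \<le> (1 + ?b) * (?I \<omega> * W - 2 * a n * d + ?b * ?q * l\<^sup>2) + ((inexactness n + (1 + K)) * ?I \<omega> - (1 + K) * ?J \<omega> - ?J \<omega> * D)"
          using 1 by simp
      next
        case 2
        have "2 * a n * d \<le> 2 * a n * (l * \<beta>')"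
          using d \<alpha>_pos[of n] by (intro mult_left_mono) auto
        also have "\<dots> = 2 * 1 * (a n * l * \<beta>')" by simp
        also have "\<dots> \<le> 1\<^sup>2 + (a n * l * \<beta>')\<^sup>2" by (rule sum_squares_bound)
        also have "(a n * l * \<beta>')\<^sup>2 = l\<^sup>2 * ?b * \<beta>'\<^sup>2" by (simp add: power_mult_distrib)
        finally have "- 1 \<le> W - 2 * a n * d + ?b * ?q * l\<^sup>2" unfolding q power_one using nn by linarith
        then have "(1 + ?b) * (- 1) \<le> (1 + ?b) * (W - 2 * a n * d + ?b * ?q * l\<^sup>2)"
          by (rule mult_left_mono) simp
        then show "?J \<omega> * ((1 + ?b) * (W - 2 * a n * d + ?b * L_inf\<^sup>2 * l\<^sup>2) + (inexactness n - D))
          \<le> (1 + ?b) * (?I \<omega> * W - 2 * a n * d + ?b * ?q * l\<^sup>2) + ((inexactness n + (1 + K)) * ?I \<omega> - (1 + K) * ?J \<omega> - ?J \<omega> * D)"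
          using 2 nn a_sq_le[of n] by simp
      next
        case 3
        then have "d = 0" by (simp add: d_def)
        moreover have "0 \<le> (1 + ?b) * (?b * ?q * l\<^sup>2)" by simp
        ultimately show "?J \<omega> * ((1 + ?b) * (W - 2 * a n * d + ?b * L_inf\<^sup>2 * l\<^sup>2) + (inexactness n - D))
          \<le> (1 + ?b) * (?I \<omega> * W - 2 * a n * d + ?b * ?q * l\<^sup>2) + ((inexactness n + (1 + K)) * ?I \<omega> - (1 + K) * ?J \<omega> - ?J \<omega> * D)"
          using 3 by simp
      qed
    qed
  qed
  also have "\<dots> = (1 + ?b) * ((\<integral>\<omega>. ?I \<omega> * sqdist_pre xs n \<omega> \<partial>\<Omega>) - 2 * a n * (\<integral>\<omega>. loss_noise n \<omega> \<partial>\<Omega>) + ?b * ?q * (\<integral>\<omega>. (batch_lip n \<omega>)\<^sup>2 \<partial>\<Omega>))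
      + (\<integral>\<omega>. ?t \<omega> \<partial>\<Omega>)"
    by (rule integral_affine_comb[OF iIW loss_noise_integrable batch_lip_sq(1) it])
  also have "\<dots> \<le> (1 + ?b) * ((\<rho> (Suc n))\<^sup>2 * stopped_dist n - 2 * a n * 0 + ?b * ?q * \<Lambda>) + (\<integral>\<omega>. ?t \<omega> \<partial>\<Omega>)"
    unfolding loss_noise_mean_zero
    using preconditioner_change[OF stay_F xs_diff_measurable(2) x_minus_minimizer_sq_integrable[OF xs]] batch_lip_sq(2) \<alpha>_pos[of n]
    by (intro add_right_mono mult_left_mono add_mono diff_mono) auto
  also have "(\<integral>\<omega>. ?t \<omega> \<partial>\<Omega>) = (inexactness n + (1 + K)) * prob (stay n) - (1 + K) * prob (stay (Suc n)) - stopped_dist (Suc n)"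
    unfolding integral_scaled_diff[OF iI iJD] using stay_sets by simp
  finally have "(\<integral>\<omega>. ?J \<omega> * slack n \<omega> \<partial>\<Omega>) \<le> (1 + ?b) * ((\<rho> (Suc n))\<^sup>2 * stopped_dist n - 2 * a n * 0 + ?b * ?q * \<Lambda>)
      + ((inexactness n + (1 + K)) * prob (stay n) - (1 + K) * prob (stay (Suc n)) - stopped_dist (Suc n))" .
  also have "\<dots> = (stopped_dist n - stopped_dist (Suc n)) + factor_excess n * stopped_dist n + (1 + ?b) * (?q * \<Lambda> * ?b) + inexactness n * prob (stay n)
      + (1 + K) * (prob (stay n) - prob (stay (Suc n)))"
    by (simp add: factor_excess_def algebra_simps)
  also have "\<dots> \<le> (stopped_dist n - stopped_dist (Suc n)) + factor_excess n * (\<beta>'\<^sup>2 / \<mu>_inf\<^sup>2) + (1 + K) * (?q * \<Lambda> * ?b) + inexactness n * 1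
      + (1 + K) * (prob (stay n) - prob (stay (Suc n)))"
  proof (intro add_mono order_refl)
    show "factor_excess n * stopped_dist n \<le> factor_excess n * (\<beta>'\<^sup>2 / \<mu>_inf\<^sup>2)"
      by (rule mult_left_mono[OF stopped_dist_le factor_excess_nonneg])
    show "(1 + ?b) * (?q * \<Lambda> * ?b) \<le> (1 + K) * (?q * \<Lambda> * ?b)"
      using a_sq_le[of n] \<Lambda>_nonneg by (intro mult_right_mono) auto
    show "inexactness n * prob (stay n) \<le> inexactness n * 1"
      using K_nonneg by (intro mult_left_mono) auto
  qed
  also have "\<dots> = (stopped_dist n - stopped_dist (Suc n)) + factor_excess n * (\<beta>'\<^sup>2 / \<mu>_inf\<^sup>2)
      + ((1 + K) * (L_inf\<^sup>2 + \<beta>'\<^sup>2) * \<Lambda> + \<gamma>\<^sup>2 * (1 + K)) * (a n)\<^sup>2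
      + (1 + K) * (prob (stay n) - prob (stay (Suc n)))" by (simp add: algebra_simps)
  finally show ?thesis .
qed

lemma AE_slack_summable: "AE \<omega> in \<Omega>. summable (\<lambda>n. indicator (stay (Suc n)) \<omega> * slack n \<omega>)"
proof (rule integrable_sum_bounded_imp_AE_summable)
  show "integrable \<Omega> (\<lambda>\<omega>. indicator (stay (Suc n)) \<omega> * slack n \<omega>)" for n
    by (rule integrable_indicator_mult[OF stay_sets slack_integrable])
  show "AE \<omega> in \<Omega>. 0 \<le> indicator (stay (Suc n)) \<omega> * slack n \<omega>" for n
    using AE_gap_le_slack
  proof eventually_elim
    case (elim \<omega>)
    show ?case
    proof (cases "\<omega> \<in> stay (Suc n)")
      case True
      then obtain z where z: "z \<in> effdom r" "2 * a n * excess xs z \<le> slack n \<omega>"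
        using elim by blast
      have "0 \<le> 2 * a n * excess xs z"
        using minimizer_le[OF xs z(1)] \<alpha>_pos[of n] by simp
      with z(2) True show ?thesis by simp
    qed simp
  qed
  let ?c1 = "\<beta>'\<^sup>2 / \<mu>_inf\<^sup>2" and ?c2 = "(1 + K) * (L_inf\<^sup>2 + \<beta>'\<^sup>2) * \<Lambda> + \<gamma>\<^sup>2 * (1 + K)"
  fix n
  have "(\<Sum>i<n. \<integral>\<omega>. indicator (stay (Suc i)) \<omega> * slack i \<omega> \<partial>\<Omega>)
     \<le> (\<Sum>i<n. (stopped_dist i - stopped_dist (Suc i)) + factor_excess i * ?c1 + ?c2 * (a i)\<^sup>2
        + (1 + K) * (prob (stay i) - prob (stay (Suc i))))"
    by (rule sum_mono) (rule slack_integral_le)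
  also have "\<dots> = (stopped_dist 0 - stopped_dist n) + (\<Sum>i<n. factor_excess i) * ?c1 + ?c2 * (\<Sum>i<n. (a i)\<^sup>2)
     + (1 + K) * (prob (stay 0) - prob (stay n))"
    by (rule sum_telescope_comb[where u=stopped_dist and p="\<lambda>i. prob (stay i)"])
  also have "\<dots> \<le> stopped_dist 0 + suminf factor_excess * ?c1 + ?c2 * K + (1 + K) * prob (stay 0)"
  proof (intro add_mono)
    show "stopped_dist 0 - stopped_dist n \<le> stopped_dist 0" using stopped_dist_nonneg[of n] by simp
    show "(\<Sum>i<n. factor_excess i) * ?c1 \<le> suminf factor_excess * ?c1"
      using factor_excess_nonneg by (intro mult_right_mono sum_le_suminf factor_excess_summable) auto
    have "(\<Sum>i<n. (a i)\<^sup>2) \<le> K" unfolding K_def by (intro sum_le_suminf steps_sq_summable) auto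
    then show "?c2 * (\<Sum>i<n. (a i)\<^sup>2) \<le> ?c2 * K"
      using K_nonneg \<Lambda>_nonneg by (intro mult_left_mono add_nonneg_nonneg mult_nonneg_nonneg) auto
    show "(1 + K) * (prob (stay 0) - prob (stay n)) \<le> (1 + K) * prob (stay 0)"
      using K_nonneg by (intro mult_left_mono) auto
  qed
  finally show "(\<Sum>i<n. \<integral>\<omega>. indicator (stay (Suc i)) \<omega> * slack i \<omega> \<partial>\<Omega>)
     \<le> stopped_dist 0 + suminf factor_excess * ?c1 + ?c2 * K + (1 + K) * prob (stay 0)" .
qed

lemma AE_gaps_summable:
  "AE \<omega> in \<Omega>. (\<forall>n. norm (x (Suc n) \<omega>) \<le> \<beta>) \<longrightarrow> (\<exists>e. summable e \<and> (\<forall>n. \<exists>z\<in>effdom r.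
     wnorm (M (Suc n) \<omega>) (x (Suc (Suc n)) \<omega> - z) \<le> \<gamma> * (a n)\<^sup>2 \<and>
     2 * a n * excess xs z \<le> e n))"
  using AE_gap_le_slack AE_slack_summable AE_space
proof eventually_elim
  case (elim \<omega>)
  show ?case
  proof (intro impI exI conjI)
    assume "\<forall>n. norm (x (Suc n) \<omega>) \<le> \<beta>"
    then have st: "\<omega> \<in> stay n" for n using elim(3) by (simp add: stay_def)
    show "summable (\<lambda>n. slack n \<omega>)" using elim(2) st by simp
    show "\<forall>n. \<exists>z\<in>effdom r. wnorm (M (Suc n) \<omega>) (x (Suc (Suc n)) \<omega> - z) \<le> \<gamma> * (a n)\<^sup>2 \<and>
     2 * a n * excess xs z \<le> slack n \<omega>"
      using elim(1) st by blast
  qed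
qed

end

text \<open>
  Almost every path is bounded and hence stays in a ball of integer radius. The exceptional
  null sets are indexed by these radii and by a countable dense set of minimizers.
\<close>

lemma AE_convergence:
  assumes LL: "local_lipschitz_models P V fm" and div: "\<not> summable (\<lambda>k. \<alpha> (Suc k))"
  shows "AE \<omega> in \<Omega>. \<exists>y\<in>X. (\<lambda>n. x (Suc n) \<omega>) \<longlonglongrightarrow> y"
proof -
  obtain xs where xs: "xs \<in> X" using argmin_nonempty by blast
  obtain T where T: "countable T" "T \<subseteq> X" "X \<subseteq> closure T" using separable by blast
  have gaps: "AE \<omega> in \<Omega>. (\<forall>n. norm (x (Suc n) \<omega>) \<le> real j) \<longrightarrow> (\<exists>e. summable e \<and> (\<forall>n. \<exists>z\<in>effdom r.
     wnorm (M (Suc n) \<omega>) (x (Suc (Suc n)) \<omega> - z) \<le> \<gamma> * (a n)\<^sup>2 \<and>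
     2 * a n * excess xs z \<le> e n))" for j :: nat
  proof -
    define U where "U = V \<inter> cball 0 (real j + L_inf * (\<gamma> * K) + norm xs)"
    have "bounded U \<and> U \<subseteq> V" by (auto simp: U_def intro: bounded_subset[OF bounded_cball])
    then obtain Lf where Lf: "Lf \<in> borel_measurable P" "\<forall>s. 0 \<le> Lf s" "integrable P (\<lambda>s. (Lf s)\<^sup>2)"
      "AE s in P. \<forall>y\<in>U. \<forall>z\<in>U. \<bar>fm y y s - fm y z s\<bar> \<le> Lf s * norm (y - z)"
      using LL unfolding local_lipschitz_models_def by blast
    show ?thesis
      by (rule AE_gaps_summable[OF xs _ U_def Lf(1) _ Lf(3,4)]) (use Lf(2) in auto)
  qed
  have conv: "AE \<omega> in \<Omega>. \<forall>d\<in>T. convergent (\<lambda>n. (wnorm (M n \<omega>) (x (Suc n) \<omega> - d))\<^sup>2)"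
    using T AE_dist_to_minimizer_convergent by (subst AE_ball_countable) auto
  have "AE \<omega> in \<Omega>. \<forall>j::nat. (\<forall>n. norm (x (Suc n) \<omega>) \<le> real j) \<longrightarrow> (\<exists>e. summable e \<and> (\<forall>n. \<exists>z\<in>effdom r.
     wnorm (M (Suc n) \<omega>) (x (Suc (Suc n)) \<omega> - z) \<le> \<gamma> * (a n)\<^sup>2 \<and>
     2 * a n * excess xs z \<le> e n))"
    using gaps by (subst AE_all_countable) blast
  with conv AE_bounded AE_norm_equiv AE_wsq_le AE_le_wsq show ?thesis
  proof eventually_elim
    case (elim \<omega>)
    obtain B where B: "\<And>n. norm (x (Suc n) \<omega>) \<le> B" using elim(2) by blast
    obtain j :: nat where "B \<le> real j" using real_arch_simple by blast
    then have "\<forall>n. norm (x (Suc n) \<omega>) \<le> real j" using B order_trans by blast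
    then obtain e where e: "summable e" "\<And>n. \<exists>z\<in>effdom r.
       wnorm (M (Suc n) \<omega>) (x (Suc (Suc n)) \<omega> - z) \<le> \<gamma> * (a n)\<^sup>2 \<and>
       2 * a n * excess xs z \<le> e n"
      using elim(6) by blast
    show ?case
    proof (rule convergence_to_minimizer[OF xs \<mu>_pos _ L_pos _ T(3) _ B _ _ e(1) \<alpha>_pos div])
      show "(wnorm (M n \<omega>) v)\<^sup>2 \<le> (norm v)\<^sup>2 / \<mu>_inf\<^sup>2" for n v using elim(4) by blast
      show "(norm v)\<^sup>2 \<le> L_inf\<^sup>2 * (wnorm (M n \<omega>) v)\<^sup>2" for n v using elim(5) by blast
      show "convergent (\<lambda>n. (wnorm (M n \<omega>) (x (Suc n) \<omega> - d))\<^sup>2)" if "d \<in> T" for d using elim(1) that by blast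
      show "\<exists>z\<in>effdom r. norm (x (Suc (Suc n)) \<omega> - z) \<le> L_inf * (\<gamma> * (a n)\<^sup>2) \<and>
        2 * a n * excess xs z \<le> e n" for n
      proof -
        obtain z where z: "z \<in> effdom r" "wnorm (M (Suc n) \<omega>) (x (Suc (Suc n)) \<omega> - z) \<le> \<gamma> * (a n)\<^sup>2"
          "2 * a n * excess xs z \<le> e n"
          using e(2)[of n] by (elim bexE conjE)
        have "norm (x (Suc (Suc n)) \<omega> - z) \<le> L_inf * wnorm (M (Suc n) \<omega>) (x (Suc (Suc n)) \<omega> - z)"
          using elim(3) by blast
        also have "\<dots> \<le> L_inf * (\<gamma> * (a n)\<^sup>2)" using z(2) L_pos by (intro mult_left_mono) auto
        finally show ?thesis using z by (intro bexI[of _ z] conjI)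
      qed
      have "(\<lambda>n. L_inf * (\<gamma> * (a n)\<^sup>2)) \<longlonglongrightarrow> L_inf * (\<gamma> * 0)"
        by (intro tendsto_mult tendsto_const summable_LIMSEQ_zero steps_sq_summable)
      then show "(\<lambda>n. L_inf * (\<gamma> * (a n)\<^sup>2)) \<longlonglongrightarrow> 0" by simp
    qed
  qed
qed

end

theorem theorem2p6:
  fixes P :: "'s measure" and \<Omega> :: "'w measure"
    and f :: "'a::euclidean_space \<Rightarrow> 's \<Rightarrow> ereal" and r :: "'a \<Rightarrow> ereal"
    and V :: "'a set" and fm :: "'a \<Rightarrow> 'a \<Rightarrow> 's \<Rightarrow> real"
    and m :: nat and S :: "nat \<Rightarrow> nat \<Rightarrow> 'w \<Rightarrow> 's"
    and \<alpha> \<epsilon> \<mu> L \<rho> :: "nat \<Rightarrow> real" and M :: "nat \<Rightarrow> 'w \<Rightarrow> 'a \<Rightarrow> 'a"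
    and \<mu>_inf L_inf \<eta> \<tau> \<gamma> :: real and x1 :: 'a and x :: "nat \<Rightarrow> 'w \<Rightarrow> 'a"
  assumes "prob_space P" and "prob_space \<Omega>"
    and "\<eta> = 0" and "\<tau> = 0"
    and "model_family P r V fm"
    and "model_accuracy P f V fm \<eta>"
    and "preconditioner_condition \<Omega> (sample_filtration \<Omega> P m S) M \<mu>_inf L_inf \<mu> L \<rho>"
    and "regularity P f r V fm \<tau>"
    and "argmin (objective P f r) \<noteq> {}"
    and "\<exists>\<sigma>>0. \<forall>xs \<in> argmin (objective P f r). \<forall>g \<in> borel_measurable P.
           (AE s in P. g s \<in> subdifferential (sample_objective f r s) xs) \<longrightarrow>
           (\<integral>\<^sup>+ s. ennreal ((norm (g s))\<^sup>2) \<partial>P) \<le> ennreal (\<sigma>\<^sup>2)"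
    and "\<forall>xs \<in> argmin (objective P f r). \<forall>v \<in> subdifferential (objective P f r) xs.
           \<exists>g \<in> borel_measurable P.
             (AE s in P. g s \<in> subdifferential (sample_objective f r s) xs) \<and>
             integrable P g \<and> (\<integral>s. g s \<partial>P) = v"
    and "ispPPA \<Omega> P m S r V fm \<alpha> \<epsilon> M (L_inf\<^sup>2 * \<tau>) x1 x"
    and "0 \<le> \<gamma>" and "\<forall>k\<ge>1. \<epsilon> k = \<gamma> * (\<alpha> k)\<^sup>2"
    and "summable (\<lambda>k. (\<alpha> (Suc k))\<^sup>2)"
  shows "(AE \<omega> in \<Omega>. (SUP k\<in>{1..}. ereal (norm (x k \<omega>))) < \<infinity>) \<and>
         (local_lipschitz_models P V fm \<and> \<not> summable (\<lambda>k. \<alpha> (Suc k)) \<longrightarrow>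
           (AE \<omega> in \<Omega>. \<exists>xs \<in> argmin (objective P f r). (\<lambda>k. norm (x k \<omega> - xs)) \<longlonglongrightarrow> 0))"
proof -
  interpret exact_ispPPA P \<Omega> f r V fm m S \<alpha> \<epsilon> \<mu> L \<rho> M \<mu>_inf L_inf \<gamma> x1 x
    using assms by (intro exact_ispPPA.intro) simp_all
  have "AE \<omega> in \<Omega>. (SUP k\<in>{1..}. ereal (norm (x k \<omega>))) < \<infinity>"
    using AE_bounded
  proof eventually_elim
    case (elim \<omega>)
    then obtain B where B: "\<And>n. norm (x (Suc n) \<omega>) \<le> B" by blast
    have "(SUP k\<in>{1..}. ereal (norm (x k \<omega>))) \<le> ereal B"
    proof (rule SUP_least)
      fix k :: nat assume "k \<in> {1..}"
      then show "ereal (norm (x k \<omega>)) \<le> ereal B" using B[of "k - 1"] by simp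
    qed
    then show ?case by (rule order_le_less_trans) simp
  qed
  moreover have "AE \<omega> in \<Omega>. \<exists>xs \<in> argmin (objective P f r). (\<lambda>k. norm (x k \<omega> - xs)) \<longlonglongrightarrow> 0"
    if "local_lipschitz_models P V fm \<and> \<not> summable (\<lambda>k. \<alpha> (Suc k))"
    using AE_convergence[OF that[THEN conjunct1] that[THEN conjunct2]]
  proof eventually_elim
    case (elim \<omega>)
    then obtain y where y: "y \<in> argmin (objective P f r)" "(\<lambda>n. x (Suc n) \<omega>) \<longlonglongrightarrow> y" by blast
    have "(\<lambda>k. x k \<omega>) \<longlonglongrightarrow> y" using y(2) by (rule LIMSEQ_imp_Suc)
    then have "(\<lambda>k. norm (x k \<omega> - y)) \<longlonglongrightarrow> 0"
      by (intro tendsto_norm_zero) (simp add: LIM_zero_iff)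
    with y(1) show ?case by blast
  qed
  ultimately show ?thesis by blast
qed

end
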